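(* Let $k\in\mathbb N$ and let $\mu$ be a Borel probability measure on $[0,1]^k$ satisfying \[ \dim_{\ell^1}(\mu)>k-\frac{k-1}{k+1}. \] Then $\mu$ is inhomogeneous divergent Khinchin and inhomogeneous divergent Gallagher.
   Context: $\|x\|$ is the distance from $x\in\mathbb R$ to the nearest integer, $e(x)=e^{2\pi i x}$. For a Borel probability measure $\nu$ on $[0,1]^k$, $\hat\nu({\boldsymbol{\xi}})=\int e(-{\boldsymbol{\xi}}\cdot\mathbf x)\,d\nu(\mathbf x)$ for ${\boldsymbol{\xi}}\in\mathbb Z^k$, and $\dim_{\ell^1}(\nu)=\sup\{s\geqslant0:\sum_{\|{\boldsymbol{\xi}}\|_\infty\leqslant Q}|\hat\nu({\boldsymbol{\xi}})|\ll Q^{k-s}\ (Q\geqslant1)\}$. For $\psi:\mathbb N\to[0,1)$ and $\mathbf y\in\mathbb R^k$: $W_k(\psi,\mathbf y)$ is the set of $\mathbf x\in[0,1)^k$ with $\max_j\|nx_j-y_j\|<\psi(n)$ for infinitely many $n\in\mathbb N$; $W_k^\times(\psi,\mathbf y)$ is the set of $\mathbf x\in[0,1)^k$ with $\prod_{j=1}^k\|nx_j-y_j\|<\psi(n)$ for infinitely many $n\in\mathbb N$. A probability measure $\mu$ on $[0,1]^k$ is inhomogeneous divergent Khinchin if for every non-increasing $\psi:\mathbb N\to[0,1)$ with $\sum_n\psi(n)^k=\infty$ we have $\mu(W_k(\psi,\mathbf y))=1$ for all $\mathbf y\in\mathbb R^k$; it is inhomogeneous divergent Gallagher if for every non-increasing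 $\psi:\mathbb N\to[0,1)$ with $\sum_n\psi(n)(\log n)^{k-1}=\infty$ we have $\mu(W^\times_k(\psi,\mathbf y))=1$ for all $\mathbf y\in\mathbb R^k$. *)

theory Defs
  imports "HOL-Probability.Probability"
begin

definition dnint :: "real \<Rightarrow> real" where
  "dnint x = \<bar>x - of_int (round x)\<bar>"

definition unit_cube :: "(real ^ 'n) set" where
  "unit_cube = {x. \<forall>j. 0 \<le> x $ j \<and> x $ j \<le> 1}"

definition unit_cube_ho :: "(real ^ 'n) set" where
  "unit_cube_ho = {x. \<forall>j. 0 \<le> x $ j \<and> x $ j < 1}"

definition borel_prob_on_cube :: "(real ^ 'n::finite) measure \<Rightarrow> bool" where
  "borel_prob_on_cube \<mu> \<longleftrightarrow> prob_space \<mu> \<and> sets \<mu> = sets borel \<and> emeasure \<mu> unit_cube = 1"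

definition fourier_coeff :: "(real ^ 'n::finite) measure \<Rightarrow> int ^ 'n \<Rightarrow> complex" where
  "fourier_coeff \<nu> \<xi> = (LINT x|\<nu>. cis (- 2 * pi * (\<Sum>j\<in>UNIV. of_int (\<xi> $ j) * x $ j)))"

definition l1_dim :: "(real ^ 'n::finite) measure \<Rightarrow> real" where
  "l1_dim \<nu> = Sup {s. s \<ge> 0 \<and> (\<exists>C. \<forall>Q::real. Q \<ge> 1 \<longrightarrow>
      (\<Sum>\<xi>\<in>{\<xi>::int^'n. \<forall>j. real_of_int \<bar>\<xi> $ j\<bar> \<le> Q}. norm (fourier_coeff \<nu> \<xi>))
        \<le> C * Q powr (real CARD('n) - s))}"

text \<open>psi : N -> [0,1) (N = positive integers; the value at 0 is irrelevant).\<close>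
definition admissible_psi :: "(nat \<Rightarrow> real) \<Rightarrow> bool" where
  "admissible_psi \<psi> \<longleftrightarrow> (\<forall>n\<ge>1. 0 \<le> \<psi> n \<and> \<psi> n < 1) \<and>
     (\<forall>m n. 1 \<le> m \<longrightarrow> m \<le> n \<longrightarrow> \<psi> n \<le> \<psi> m)"

definition W_simul :: "(nat \<Rightarrow> real) \<Rightarrow> real ^ 'n::finite \<Rightarrow> (real ^ 'n) set" where
  "W_simul \<psi> y = {x \<in> unit_cube_ho.
     infinite {n::nat. n \<ge> 1 \<and> Max (range (\<lambda>j. dnint (real n * x $ j - y $ j))) < \<psi> n}}"

definition W_mult :: "(nat \<Rightarrow> real) \<Rightarrow> real ^ 'n::finite \<Rightarrow> (real ^ 'n) set" where
  "W_mult \<psi> y = {x \<in> unit_cube_ho.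
     infinite {n::nat. n \<ge> 1 \<and> (\<Prod>j\<in>UNIV. dnint (real n * x $ j - y $ j)) < \<psi> n}}"

definition inhom_div_Khinchin :: "(real ^ 'n::finite) measure \<Rightarrow> bool" where
  "inhom_div_Khinchin \<mu> \<longleftrightarrow> (\<forall>\<psi>. admissible_psi \<psi> \<longrightarrow>
     \<not> summable (\<lambda>n. \<psi> (Suc n) ^ CARD('n)) \<longrightarrow>
     (\<forall>y::real^'n. W_simul \<psi> y \<in> sets \<mu> \<and> emeasure \<mu> (W_simul \<psi> y) = 1))"

definition inhom_div_Gallagher :: "(real ^ 'n::finite) measure \<Rightarrow> bool" where
  "inhom_div_Gallagher \<mu> \<longleftrightarrow> (\<forall>\<psi>. admissible_psi \<psi> \<longrightarrow>
     \<not> summable (\<lambda>n. \<psi> (Suc n) * ln (real (Suc n)) ^ (CARD('n) - 1)) \<longrightarrow>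
     (\<forall>y::real^'n. W_mult \<psi> y \<in> sets \<mu> \<and> emeasure \<mu> (W_mult \<psi> y) = 1))"

end

theory Submission
  imports Defs "HOL-Real_Asymp.Real_Asymp"
begin

text \<open>
  Restrict $n$ to dyadic blocks $[2^i, 2^{i+1})$ and replace the target at height $n$ by finitely many
  boxes, all of whose sides are $2^{-i/k + O(\varepsilon i)}$: one cube in the Khinchin case, and about
  $(\varepsilon i)^{k-1}$ dyadic boxes below the hyperbola in the Gallagher case, which still carry a
  positive proportion of its volume. Each box is minorised, up to a negligible error, by a trigonometric
  polynomial of degree $2^{i/k + O(\varepsilon i)}$ with the right mean.

  The variance of the smoothed hit count with respect to $\mu$ is a sum of Fourier coefficients
  $\hat\mu(m\eta - n\xi)$. The terms with $m\eta = n\xi$ are controlled by the expected number of hits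
  (Cauchy--Schwarz and a gcd sum). For $\zeta \ne 0$ the number of solutions of $m\eta - n\xi = \zeta$ is
  at most $2^{i(1 + 1/k) + O(\varepsilon i)}$ by the divisor bound, and the hypothesis on the $\ell^1$
  dimension is exactly what makes the corresponding terms save a power. So the variance is $O(1 + E)$ where
  $E$ is the (divergent) expectation, and Chebyshev's inequality gives infinitely many hits almost surely.
\<close>

section \<open>Band-limited approximation of boxes\<close>

text \<open>Where (k - 1)/(k + 1) comes from: suppose the coefficients of \<mu> up to height Q sum
  to O(Q^\<sigma>). At level i two coefficients of size 2^(-i) meet the solution count and
  frequencies up to Q = 2^(i(1 + 1/k)), so the off-diagonal part is about 2^(i(-1 + 1/k + (1 +
  1/k)\<sigma>)). This decays exactly when \<sigma> < (k - 1)/(k + 1). Much shorter sides would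
  raise the degree and destroy this balance, hence boxes that are nearly cubical in the exponent
  even for the hyperbolic target. A variance linear in E, rather than the E^2 of quasi-independence
  on average, gives measure 1 outright, without a zero-one law. The expectation is taken under
  Lebesgue measure, and \<mu> enters only through absolute values of its coefficients, which makes
  every estimate uniform in the shift y. Two modifications keep the divergence: \<psi> is lowered so
  that each block expects boundedly many hits, and levels where \<psi> is too small are dropped, at
  a summable cost.\<close>

definition ee :: "real \<Rightarrow> complex" where
  "ee x = cis (2 * pi * x)"

lemma ee_0 [simp]: "ee 0 = 1"
  by (simp add: ee_def)

lemma ee_add: "ee (x + y) = ee x * ee y"
  by (simp add: ee_def cis_mult ring_distribs)

lemma norm_ee [simp]: "norm (ee x) = 1"
  by (simp add: ee_def)

lemma cnj_ee: "cnj (ee x) = ee (- x)"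
  by (simp add: ee_def cis_cnj)

lemma ee_of_int [simp]: "ee (of_int n) = 1"
  by (simp add: ee_def cis_multiple_2pi)

lemma ee_power: "ee x ^ n = ee (real n * x)"
  using Complex.DeMoivre[of "2 * pi * x" n] by (simp add: ee_def mult.assoc mult.left_commute)

lemma ee_minus_of_int [simp]: "ee (x - of_int n) = ee x"
  using ee_add[of "x - of_int n" "of_int n"] by simp

lemma ee_sum: "finite A \<Longrightarrow> ee (\<Sum>a\<in>A. f a) = (\<Prod>a\<in>A. ee (f a))"
  by (induction rule: finite_induct) (auto simp: ee_add)

section \<open>Distance to the nearest integer and geometric sums\<close>

lemma dnint_nonneg [simp]: "0 \<le> dnint x"
  by (simp add: dnint_def)

lemma dnint_le_half: "dnint x \<le> 1 / 2"
  using of_int_round_ge[of x] of_int_round_le[of x] unfolding dnint_def by linarith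

lemma dnint_le_add: "dnint x \<le> dnint (x + y) + \<bar>y\<bar>"
  using round_diff_minimal[of x "round (x + y)"] unfolding dnint_def by linarith

lemma dnint_small:
  assumes "\<bar>x\<bar> \<le> 1 / 2"
  shows "dnint x = \<bar>x\<bar>"
proof -
  have "\<bar>x\<bar> \<le> \<bar>x - of_int (round x)\<bar>"
  proof (cases "round x = 0")
    case False
    then have "1 \<le> \<bar>real_of_int (round x)\<bar>"
      by linarith
    then show ?thesis using assms by linarith
  qed simp
  moreover have "\<bar>x - of_int (round x)\<bar> \<le> \<bar>x\<bar>"
    using round_diff_minimal[of x 0] by simp
  ultimately show ?thesis by (simp add: dnint_def)
qed

lemma sin_pi_ge:
  assumes "0 \<le> x" "x \<le> 1 / 2"
  shows "2 * x \<le> sin (pi * x)"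
proof -
  have conc: "concave_on {0..pi} sin"
    by (rule f''_le0_imp_concave[where f' = cos and f'' = "\<lambda>x. - sin x"])
       (auto intro!: derivative_eq_intros sin_ge_zero)
  have "(1 - 2 * x) * sin 0 + 2 * x * sin (pi / 2) \<le> sin ((1 - 2 * x) *\<^sub>R 0 + (2 * x) *\<^sub>R (pi / 2))"
    by (rule concave_onD[OF conc]) (use assms in auto)
  then show ?thesis by (simp add: mult_ac)
qed

text \<open>For |r| \<le> 1/2 the chord \<open>norm (1 - ee r)\<close> is 2 |sin(pi r)|, and
  concavity of the sine puts it above 4 |r|.\<close>

lemma norm_one_minus_ee: "4 * dnint x \<le> norm (1 - ee x)"
proof -
  define r where "r = x - of_int (round x)"
  have r: "\<bar>r\<bar> = dnint x" by (simp add: r_def dnint_def)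
  have "norm (1 - ee r) ^ 2 = (2 * sin (pi * r)) ^ 2"
  proof -
    have "norm (1 - ee r) ^ 2 = (1 - cos (2 * (pi * r)))\<^sup>2 + (sin (2 * (pi * r)))\<^sup>2"
      by (simp add: cmod_power2 ee_def mult_ac)
    also have "\<dots> = 2 - 2 * cos (2 * (pi * r))"
      using sin_cos_squared_add[of "2 * (pi * r)"] by (simp add: power2_diff)
    also have "\<dots> = (2 * sin (pi * r)) ^ 2"
      unfolding cos_double_sin by (simp add: power2_eq_square)
    finally show ?thesis .
  qed
  then have "norm (1 - ee r) = \<bar>2 * sin (pi * r)\<bar>"
    by (metis abs_norm_cancel power2_eq_iff_nonneg abs_ge_zero power2_abs)
  also have "\<dots> = 2 * \<bar>sin (pi * \<bar>r\<bar>)\<bar>"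
    by (cases "r \<ge> 0") (auto simp: abs_mult)
  also have "\<dots> \<ge> 4 * dnint x"
    using sin_pi_ge[of "\<bar>r\<bar>"] r dnint_le_half[of x] by auto
  finally show ?thesis by (simp add: r_def)
qed

lemma norm_sum_ee_le:
  assumes "0 < dnint \<theta>"
  shows "norm (\<Sum>t<T. ee (real t * \<theta>)) \<le> 1 / (2 * dnint \<theta>)"
proof -
  define S where "S = (\<Sum>t<T. ee (real t * \<theta>))"
  have "(1 - ee \<theta>) * S = 1 - ee \<theta> ^ T"
    unfolding S_def ee_power[symmetric] by (simp add: one_diff_power_eq)
  then have "norm (1 - ee \<theta>) * norm S = norm (1 - ee \<theta> ^ T)"
    by (metis norm_mult)
  also have "\<dots> \<le> 2"
    by (rule order_trans[OF norm_triangle_ineq4]) (simp add: norm_power)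
  finally have "norm (1 - ee \<theta>) * norm S \<le> 2" .
  moreover have "4 * dnint \<theta> * norm S \<le> norm (1 - ee \<theta>) * norm S"
    by (intro mult_right_mono norm_one_minus_ee) auto
  ultimately have "4 * dnint \<theta> * norm S \<le> 2" by linarith
  then show ?thesis using assms by (simp add: S_def field_simps)
qed

section \<open>Powers of the Fejer kernel\<close>

text \<open>Vanishing beyond \<open>p*M\<close> is carried through the induction because
  \<open>polynomial_product\<close> asks for it. Nonnegative coefficients here make the Fourier
  coefficients of the kernel below nonnegative as well.\<close>

lemma geometric_power_coeffs:
  "\<exists>\<rho>::nat \<Rightarrow> real. (\<forall>v. 0 \<le> \<rho> v) \<and> (\<forall>v>p*M. \<rho> v = 0) \<and>
     (\<forall>z::complex. (\<Sum>m<M. z ^ m) ^ p = (\<Sum>v\<le>p*M. of_real (\<rho> v) * z ^ v))"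
proof (induction p)
  case 0
  show ?case by (rule exI[of _ "\<lambda>v. if v = 0 then 1 else 0"]) auto
next
  case (Suc p)
  then obtain \<rho> :: "nat \<Rightarrow> real" where \<rho>: "\<And>v. 0 \<le> \<rho> v" "\<And>v. v > p*M \<Longrightarrow> \<rho> v = 0"
    "\<And>z::complex. (\<Sum>m<M. z ^ m) ^ p = (\<Sum>v\<le>p*M. of_real (\<rho> v) * z ^ v)" by auto
  define b :: "nat \<Rightarrow> real" where "b m = (if m < M then 1 else 0)" for m
  define \<tau> where "\<tau> r = (\<Sum>k\<le>r. \<rho> k * b (r - k))" for r
  have nn: "0 \<le> \<tau> r" for r
    unfolding \<tau>_def b_def by (intro sum_nonneg) (auto simp: \<rho>)
  have z0: "\<tau> r = 0" if "r > Suc p * M" for r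
    unfolding \<tau>_def
  proof (rule sum.neutral, rule ballI)
    fix k assume "k \<in> {..r}"
    then show "\<rho> k * b (r - k) = 0"
      using that \<rho>(2)[of k] by (cases "k > p * M") (auto simp: b_def)
  qed
  have eq: "(\<Sum>m<M. z ^ m) ^ Suc p = (\<Sum>v\<le>Suc p*M. of_real (\<tau> v) * z ^ v)" for z :: complex
  proof -
    have "(\<Sum>m<M. z ^ m) = (\<Sum>m\<le>M. of_real (b m) * z ^ m)"
      by (rule sum.mono_neutral_cong_left) (auto simp: b_def)
    then have "(\<Sum>m<M. z ^ m) ^ Suc p
        = (\<Sum>v\<le>p*M. of_real (\<rho> v) * z ^ v) * (\<Sum>m\<le>M. of_real (b m) * z ^ m)"
      using \<rho>(3)[of z] by (simp add: mult.commute)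
    also have "\<dots> = (\<Sum>r\<le>p*M + M. (\<Sum>k\<le>r. of_real (\<rho> k) * of_real (b (r - k))) * z ^ r)"
      by (rule polynomial_product) (auto simp: \<rho>(2) b_def)
    finally show ?thesis
      by (simp add: \<tau>_def add.commute)
  qed
  show ?case
    by (rule exI[of _ \<tau>]) (use nn z0 eq in blast)
qed

text \<open>The kernel is |D|^(2p) for a geometric sum D of length \<open>M\<close>, normalised to
  mean 1. Away from the integers D is bounded independently of \<open>M\<close>, so the power 2p
  turns a distance slightly larger than 1/M into a saving of any prescribed order; the price is the
  degree p M and a peak of at most \<open>L + 1\<close>.\<close>

lemma fejer_power_kernel:
  fixes p M :: nat
  assumes "M \<ge> 1"
  defines "L \<equiv> p * M"
  obtains r :: "int \<Rightarrow> real" and J :: "real \<Rightarrow> real" where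
    "r 0 = 1" "\<And>\<xi>. 0 \<le> r \<xi>" "\<And>\<xi>. r \<xi> \<le> 1"
    "\<And>y. of_real (J y) = (\<Sum>\<xi>\<in>{-int L..int L}. of_real (r \<xi>) * ee (of_int \<xi> * y))"
    "\<And>y. 0 \<le> J y" "\<And>y. J y \<le> real (L + 1)"
    "\<And>y. 0 < dnint y \<Longrightarrow> J y \<le> real (L + 1) / (2 * real M * dnint y) ^ (2 * p)"
proof -
  obtain \<rho> :: "nat \<Rightarrow> real" where \<rho>: "\<And>v. 0 \<le> \<rho> v"
    "\<And>z::complex. (\<Sum>m<M. z ^ m) ^ p = (\<Sum>v\<le>L. of_real (\<rho> v) * z ^ v)"
    using geometric_power_coeffs[of p M] unfolding L_def by blast
  define I where "I = {..L} \<times> {..L}"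
  define w where "w = (\<lambda>t::nat\<times>nat. int (fst t) - int (snd t))"
  define R where "R \<xi> = (\<Sum>t\<in>{t\<in>I. w t = \<xi>}. \<rho> (fst t) * \<rho> (snd t))" for \<xi>
  define q where "q y = (norm (\<Sum>m<M. ee y ^ m) ^ p)\<^sup>2" for y
  have finI [simp]: "finite I" by (simp add: I_def)
  have R0: "R 0 = (\<Sum>v\<le>L. (\<rho> v)\<^sup>2)"
  proof -
    have "{t\<in>I. w t = 0} = (\<lambda>v. (v, v)) ` {..L}" by (auto simp: I_def w_def)
    then show ?thesis
      unfolding R_def by (simp add: sum.reindex inj_on_def power2_eq_square)
  qed
  have Rnn: "0 \<le> R \<xi>" for \<xi> unfolding R_def by (intro sum_nonneg) (auto simp: \<rho>)
  \<comment> \<open>Each fibre of \<open>w\<close> is a graph over either coordinate, so AM-GM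
    bounds its sum by the full sum of squares \<open>R 0\<close>.\<close>
  have Rle: "R \<xi> \<le> R 0" for \<xi>
  proof -
    let ?S = "{t\<in>I. w t = \<xi>}"
    have i1: "inj_on fst ?S" and i2: "inj_on snd ?S" by (auto simp: inj_on_def w_def)
    have im1: "fst ` ?S \<subseteq> {..L}" and im2: "snd ` ?S \<subseteq> {..L}" by (auto simp: I_def)
    have s1: "(\<Sum>t\<in>?S. (\<rho> (fst t))\<^sup>2) \<le> R 0"
      unfolding R0 using sum.reindex[OF i1, of "\<lambda>v. (\<rho> v)\<^sup>2"]
        sum_mono2[OF _ im1, of "\<lambda>v. (\<rho> v)\<^sup>2"] by (simp add: o_def)
    have s2: "(\<Sum>t\<in>?S. (\<rho> (snd t))\<^sup>2) \<le> R 0"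
      unfolding R0 using sum.reindex[OF i2, of "\<lambda>v. (\<rho> v)\<^sup>2"]
        sum_mono2[OF _ im2, of "\<lambda>v. (\<rho> v)\<^sup>2"] by (simp add: o_def)
    have "2 * R \<xi> = (\<Sum>t\<in>?S. 2 * (\<rho> (fst t) * \<rho> (snd t)))"
      unfolding R_def by (simp add: sum_distrib_left)
    also have "\<dots> \<le> (\<Sum>t\<in>?S. (\<rho> (fst t))\<^sup>2 + (\<rho> (snd t))\<^sup>2)"
      by (intro sum_mono) (use sum_squares_bound in \<open>simp add: mult.assoc\<close>)
    also have "\<dots> \<le> 2 * R 0" using s1 s2 by (simp add: sum.distrib)
    finally show ?thesis by simp
  qed
  have qR: "of_real (q y) = (\<Sum>\<xi>\<in>{-int L..int L}. of_real (R \<xi>) * ee (of_int \<xi> * y))" for y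
  proof -
    define P where "P = (\<Sum>v\<le>L. of_real (\<rho> v) * ee y ^ v)"
    have "of_real (q y) = P * cnj P"
      unfolding q_def complex_norm_square[symmetric] P_def \<rho>(2)[symmetric]
      by (simp add: norm_power)
    also have "\<dots> = (\<Sum>v\<le>L. \<Sum>u\<le>L. of_real (\<rho> v * \<rho> u) * ee (of_int (int v - int u) * y))"
      unfolding P_def cnj_sum sum_product
      by (intro sum.cong refl) (simp add: ee_power cnj_ee ring_distribs ee_add flip: ee_add)
    also have "\<dots> = (\<Sum>t\<in>I. of_real (\<rho> (fst t) * \<rho> (snd t)) * ee (of_int (w t) * y))"
      unfolding I_def w_def by (simp add: sum.cartesian_product case_prod_beta)
    also have "\<dots> = (\<Sum>\<xi>\<in>{-int L..int L}. \<Sum>t\<in>{t\<in>I. w t = \<xi>}.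
        of_real (\<rho> (fst t) * \<rho> (snd t)) * ee (of_int (w t) * y))"
      by (rule sum.group[symmetric]) (auto simp: I_def w_def)
    also have "\<dots> = (\<Sum>\<xi>\<in>{-int L..int L}. of_real (R \<xi>) * ee (of_int \<xi> * y))"
      unfolding R_def by (intro sum.cong refl) (simp add: sum_distrib_right)
    finally show ?thesis .
  qed
  have Mp: "(\<Sum>v\<le>L. \<rho> v) = real M ^ p"
  proof -
    have "complex_of_real (real M ^ p) = of_real (\<Sum>v\<le>L. \<rho> v)"
      using \<rho>(2)[of 1] by simp
    then show ?thesis by (metis of_real_eq_iff)
  qed
  \<comment> \<open>Lower bound for the normalising constant by Cauchy-Schwarz: the
    \<open>L + 1\<close> coefficients add up to M^p, the value at z = 1.\<close>
  have R0ge: "(real M ^ p)\<^sup>2 \<le> real (L + 1) * R 0"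
    using Cauchy_Schwarz_ineq_sum[of "\<lambda>_. 1" \<rho> "{..L}"] Mp by (simp add: R0)
  have Mpos: "0 < (real M ^ p)\<^sup>2" using assms by simp
  have R0pos: "0 < R 0"
    using R0ge Mpos by (smt (verit, best) mult_nonneg_nonpos of_nat_0_le_iff)
  show ?thesis
  proof (rule that[of "\<lambda>\<xi>. R \<xi> / R 0" "\<lambda>y. q y / R 0"])
    show "of_real (q y / R 0) = (\<Sum>\<xi>\<in>{-int L..int L}. of_real (R \<xi> / R 0) * ee (of_int \<xi> * y))" for y
      using qR[of y] by (simp add: sum_divide_distrib)
    have key: "q y / R 0 \<le> real (L + 1) * c" if "q y \<le> c * (real M ^ p)\<^sup>2" "0 \<le> c" for c y
    proof -
      have "q y \<le> c * (real (L + 1) * R 0)"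
        by (rule order_trans[OF that(1)]) (intro mult_left_mono R0ge that)
      then show ?thesis using R0pos by (simp add: field_simps)
    qed
    show "q y / R 0 \<le> real (L + 1)" for y
    proof -
      have "norm (\<Sum>m<M. ee y ^ m) \<le> real M"
        by (rule order_trans[OF sum_norm_le[where g = "\<lambda>_. 1"]]) (auto simp: norm_power)
      then have "q y \<le> (real M ^ p)\<^sup>2"
        unfolding q_def by (intro power_mono) auto
      then show ?thesis using key[of y 1] by simp
    qed
    show "q y / R 0 \<le> real (L + 1) / (2 * real M * dnint y) ^ (2 * p)" if "0 < dnint y" for y
    proof -
      have "norm (\<Sum>m<M. ee y ^ m) \<le> 1 / (2 * dnint y)"
        unfolding ee_power by (rule norm_sum_ee_le[OF that])
      then have "q y \<le> ((1 / (2 * dnint y)) ^ p)\<^sup>2"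
        unfolding q_def by (intro power_mono) auto
      also have "\<dots> = (1 / (2 * real M * dnint y) ^ (2 * p)) * (real M ^ p)\<^sup>2"
        using assms that by (simp add: power_mult_distrib power_divide power_even_eq[symmetric] power_mult[symmetric] mult.commute)
      finally show ?thesis using key[of y "1 / (2 * real M * dnint y) ^ (2 * p)"] that by simp
    qed
  qed (use Rnn Rle R0pos in \<open>auto simp: q_def\<close>)
qed

text \<open>
  Averaging a power of the Fejer kernel over the shifts $(t - t')h$ makes the coefficients decay like those
  of a tent function of width $\alpha$; this decay, unlike the cut-off at $L$, is uniform in $\alpha$.
\<close>

lemma box_kernel:
  fixes p M :: nat and \<alpha> :: real
  assumes "M \<ge> 1" "0 < \<alpha>" "\<alpha> \<le> 1"
  defines "L \<equiv> p * M"
  shows "\<exists>(c :: int \<Rightarrow> real) (b :: real \<Rightarrow> real). c 0 = \<alpha> \<and> (\<forall>\<xi>. 0 \<le> c \<xi>) \<and>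
    (\<forall>\<xi>\<in>{-int L..int L}. c \<xi> \<le> 4 * \<alpha> / (1 + \<alpha> * \<bar>of_int \<xi>\<bar>)\<^sup>2) \<and>
    (\<forall>x. of_real (b x) = (\<Sum>\<xi>\<in>{-int L..int L}. of_real (c \<xi>) * ee (of_int \<xi> * x))) \<and>
    (\<forall>x. 0 \<le> b x) \<and> (\<forall>x. b x \<le> \<alpha> * real (L + 1)) \<and>
    (\<forall>x. \<alpha> \<le> dnint x \<longrightarrow> b x \<le> \<alpha> * real (L + 1) / (real M * \<alpha>) ^ (2 * p))"
proof -
  obtain r :: "int \<Rightarrow> real" and J :: "real \<Rightarrow> real" where r:
    "r 0 = 1" "\<And>\<xi>. 0 \<le> r \<xi>" "\<And>\<xi>. r \<xi> \<le> 1"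
    "\<And>y. of_real (J y) = (\<Sum>\<xi>\<in>{-int L..int L}. of_real (r \<xi>) * ee (of_int \<xi> * y))"
    and J: "\<And>y. 0 \<le> J y" "\<And>y. J y \<le> real (L + 1)"
    "\<And>y. 0 < dnint y \<Longrightarrow> J y \<le> real (L + 1) / (2 * real M * dnint y) ^ (2 * p)"
    using fejer_power_kernel[of M p, folded L_def] assms(1) by blast
  define T where "T = L + 1"
  \<comment> \<open>With this step all shifts (t - t')h stay below \<alpha>/2, so a point at
    distance \<alpha> from the integers keeps distance \<alpha>/2. Also |\<xi>| h \<le> 1/2 for
    |\<xi>| \<le> L, so \<open>dnint (of_int \<xi> * h)\<close> does not wrap around.\<close>
  define h where "h = \<alpha> / (2 * real T)"
  define S where "S \<xi> = (\<Sum>t<T. ee (real t * (of_int \<xi> * h)))" for \<xi> :: int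
  \<comment> \<open>Averaging over the differences t - t' multiplies a coefficient by |S/T|^2, which
    keeps it real and nonnegative.\<close>
  define c where "c \<xi> = \<alpha> * r \<xi> * (norm (S \<xi>) / real T)\<^sup>2" for \<xi>
  define b where "b x = \<alpha> / (real T)\<^sup>2 * (\<Sum>t<T. \<Sum>t'<T. J (x + (real t - real t') * h))" for x
  have T: "0 < real T" by (simp add: T_def)
  have h: "0 < h" using assms T by (simp add: h_def)
  have dbl: "(\<Sum>t<T. \<Sum>t'<T. J (x + (real t - real t') * h)) \<le> (real T)\<^sup>2 * B"
    if "\<And>t t'. t < T \<Longrightarrow> t' < T \<Longrightarrow> J (x + (real t - real t') * h) \<le> B" for x B
  proof -
    have "(\<Sum>t<T. \<Sum>t'<T. J (x + (real t - real t') * h)) \<le> (\<Sum>t<T. \<Sum>t'<T. B)"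
      by (intro sum_mono that) auto
    then show ?thesis by (simp add: power2_eq_square)
  qed
  have bB: "b x \<le> \<alpha> * B"
    if "\<And>t t'. t < T \<Longrightarrow> t' < T \<Longrightarrow> J (x + (real t - real t') * h) \<le> B" for x B
  proof -
    have "b x \<le> \<alpha> / (real T)\<^sup>2 * ((real T)\<^sup>2 * B)"
      unfolding b_def using assms by (intro mult_left_mono dbl that) auto
    then show ?thesis using T by simp
  qed
  have c0: "c 0 = \<alpha>" using T by (simp add: c_def S_def r)
  have cnn: "0 \<le> c \<xi>" for \<xi> using assms r by (simp add: c_def)
  have cle: "c \<xi> \<le> 4 * \<alpha> / (1 + \<alpha> * \<bar>of_int \<xi>\<bar>)\<^sup>2" if "\<xi> \<in> {-int L..int L}" for \<xi>
  proof -
    define u where "u = \<alpha> * \<bar>real_of_int \<xi>\<bar>"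
    have u0: "0 \<le> u" using assms by (simp add: u_def)
    have S1: "norm (S \<xi>) / real T \<le> 1"
      unfolding S_def using T by (simp add: divide_le_eq) (rule order_trans[OF norm_sum], simp)
    have S2: "norm (S \<xi>) / real T * u \<le> 1"
    proof (cases "\<xi> = 0")
      case False
      have ab: "\<bar>real_of_int \<xi>\<bar> \<le> real L" using that by (auto simp: abs_le_iff) 
      have "\<bar>of_int \<xi> * h\<bar> = \<alpha> * \<bar>real_of_int \<xi>\<bar> / (2 * real T)"
        using assms by (simp add: h_def abs_mult)
      also have "\<dots> \<le> 1 * real L / (2 * real T)"
        using assms ab by (intro divide_right_mono mult_mono) auto
      also have "\<dots> \<le> 1 / 2" by (simp add: T_def field_simps)
      finally have d: "dnint (of_int \<xi> * h) = \<bar>of_int \<xi> * h\<bar>" by (rule dnint_small)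
      then have "norm (S \<xi>) \<le> 1 / (2 * \<bar>of_int \<xi> * h\<bar>)"
        unfolding S_def using norm_sum_ee_le[of "of_int \<xi> * h" T] False h by simp
      also have "\<dots> = real T / u"
        using assms by (simp add: h_def u_def abs_mult)
      finally show ?thesis using False assms T by (simp add: u_def field_simps)
    qed (simp add: u_def)
    \<comment> \<open>Adding the trivial bound and the geometric-sum bound avoids a case distinction
      on the size of u; squaring the 2 gives the constant 4.\<close>
    have "norm (S \<xi>) / real T * (1 + u) \<le> 2" using S1 S2 by (simp only: distrib_left)
    then have "(norm (S \<xi>) / real T * (1 + u))\<^sup>2 \<le> 2\<^sup>2"
      using u0 T by (intro power_mono) auto
    then have q: "(norm (S \<xi>) / real T)\<^sup>2 \<le> 4 / (1 + u)\<^sup>2"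
      using u0 by (subst pos_le_divide_eq) (auto simp only: power_mult_distrib, auto)
    have "c \<xi> \<le> \<alpha> * 1 * (4 / (1 + u)\<^sup>2)"
      unfolding c_def using assms r q by (intro mult_mono) auto
    then show ?thesis by (simp add: u_def mult.commute)
  qed
  have exp: "of_real (b x) = (\<Sum>\<xi>\<in>{-int L..int L}. of_real (c \<xi>) * ee (of_int \<xi> * x))" for x
  proof -
    have "(\<Sum>t<T. \<Sum>t'<T. complex_of_real (J (x + (real t - real t') * h)))
      = (\<Sum>t<T. \<Sum>t'<T. \<Sum>\<xi>\<in>{-int L..int L}.
           of_real (r \<xi>) * ee (of_int \<xi> * x) * (ee (real t * (of_int \<xi> * h)) * cnj (ee (real t' * (of_int \<xi> * h)))))"
      unfolding r(4) cnj_ee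
      by (intro sum.cong refl) (simp add: algebra_simps flip: ee_add)
    also have "\<dots> = (\<Sum>\<xi>\<in>{-int L..int L}. \<Sum>t<T. \<Sum>t'<T.
           of_real (r \<xi>) * ee (of_int \<xi> * x) * (ee (real t * (of_int \<xi> * h)) * cnj (ee (real t' * (of_int \<xi> * h)))))"
      by (subst (2) sum.swap, subst sum.swap) (rule refl)
    also have "\<dots> = (\<Sum>\<xi>\<in>{-int L..int L}. of_real (r \<xi>) * ee (of_int \<xi> * x) * (S \<xi> * cnj (S \<xi>)))"
      unfolding S_def cnj_sum sum_product by (simp add: sum_distrib_left)
    finally have eq: "(\<Sum>t<T. \<Sum>t'<T. complex_of_real (J (x + (real t - real t') * h)))
      = (\<Sum>\<xi>\<in>{-int L..int L}. of_real (r \<xi>) * ee (of_int \<xi> * x) * of_real ((norm (S \<xi>))\<^sup>2))"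
      unfolding complex_norm_square .
    have "of_real (b x) = of_real (\<alpha> / (real T)\<^sup>2) * (\<Sum>t<T. \<Sum>t'<T. complex_of_real (J (x + (real t - real t') * h)))"
      by (simp add: b_def)
    also have "\<dots> = (\<Sum>\<xi>\<in>{-int L..int L}. of_real (c \<xi>) * ee (of_int \<xi> * x))"
      unfolding eq sum_distrib_left
      by (intro sum.cong refl) (simp add: c_def power_divide)
    finally show ?thesis .
  qed
  have tail: "b x \<le> \<alpha> * real (L + 1) / (real M * \<alpha>) ^ (2 * p)" if "\<alpha> \<le> dnint x" for x
  proof -
    have "J (x + (real t - real t') * h) \<le> real (L + 1) / (real M * \<alpha>) ^ (2 * p)"
      if "t < T" "t' < T" for t t'
    proof -
      define d where "d = dnint (x + (real t - real t') * h)"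
      have "\<bar>(real t - real t') * h\<bar> \<le> real T * h"
        using that h by (auto simp: abs_mult intro!: mult_right_mono)
      also have "\<dots> = \<alpha> / 2" using T by (simp add: h_def)
      finally have "\<alpha> / 2 \<le> d"
        using dnint_le_add[of x "(real t - real t') * h"] \<open>\<alpha> \<le> dnint x\<close> by (simp add: d_def)
      then have "real M * \<alpha> \<le> 2 * real M * d" using assms by simp
      moreover have "0 < real M * \<alpha>" using assms by simp
      moreover have "J (x + (real t - real t') * h) \<le> real (L + 1) / (2 * real M * d) ^ (2 * p)"
        using J(3)[of "x + (real t - real t') * h"] \<open>\<alpha> / 2 \<le> d\<close> assms by (simp add: d_def)
      ultimately show ?thesis
        by (smt (verit, best) divide_left_mono mult_pos_pos of_nat_0_le_iff power_mono zero_less_power)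
    qed
    from bB[OF this] show ?thesis by simp
  qed
  have b0: "0 \<le> b x" for x
    unfolding b_def using assms J(1) by (intro mult_nonneg_nonneg sum_nonneg) auto
  have bL: "b x \<le> \<alpha> * real (L + 1)" for x by (rule bB) (rule J(2))
  show ?thesis
    by (rule exI[of _ c], rule exI[of _ b]) (use c0 cnn cle exp tail b0 bL in blast)
qed

section \<open>Counting solutions\<close>

text \<open>The divisor count over n^\<epsilon> is the product of (a + 1)/q^(\<epsilon>a) over the
  prime powers q^a exactly dividing n. Large primes contribute at most 1 and each of the finitely
  many small ones at most \<open>B\<close>; the induction therefore splits off one full prime power
  at a time and only tracks the number of small primes.\<close>

lemma divisor_count_bound:
  assumes "0 < \<epsilon>"
  shows "\<exists>C\<ge>1. \<forall>n\<ge>1. real (card {d. d dvd (n::nat)}) \<le> C * real n powr \<epsilon>"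
proof -
  \<comment> \<open>Beyond \<open>P\<close> one has q^\<epsilon> \<ge> 2, hence q^(\<epsilon>a)
    \<ge> 2^a \<ge> a + 1. Below it, \<open>B\<close> makes up for the linear bound e^x \<ge> 1 +
    x.\<close>
  define P where "P = nat \<lceil>2 powr (1 / \<epsilon>)\<rceil>"
  define B where "B = 1 + 1 / (\<epsilon> * ln 2)"
  have B1: "1 \<le> B" using assms by (simp add: B_def)
  have small: "real (a + 1) \<le> B * real q powr (\<epsilon> * real a)" if "2 \<le> q" for a q :: nat
  proof -
    have l2: "ln 2 \<le> ln (real q)" using that by simp
    have "real (a + 1) \<le> B * (1 + \<epsilon> * real a * ln 2)"
    proof -
      have "B * (1 + \<epsilon> * real a * ln 2) = 1 + \<epsilon> * real a * ln 2 + 1 / (\<epsilon> * ln 2) + real a"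
        using assms by (simp add: B_def field_simps)
      then show ?thesis using assms by simp
    qed
    also have "\<dots> \<le> B * (1 + \<epsilon> * real a * ln (real q))"
      using B1 assms l2 by (intro mult_left_mono add_left_mono mult_left_mono) auto
    also have "\<dots> \<le> B * exp (\<epsilon> * real a * ln (real q))"
      using B1 by (intro mult_left_mono exp_ge_add_one_self) auto
    also have "\<dots> = B * real q powr (\<epsilon> * real a)"
      using that by (simp add: powr_def)
    finally show ?thesis .
  qed
  have large: "real (a + 1) \<le> real q powr (\<epsilon> * real a)" if "q > P" for a q :: nat
  proof -
    have "2 powr (1 / \<epsilon>) \<le> real q" using that unfolding P_def by linarith
    then have "(2 powr (1 / \<epsilon>)) powr (\<epsilon> * real a) \<le> real q powr (\<epsilon> * real a)"
      using assms by (intro powr_mono2) auto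
    then have "2 ^ a \<le> real q powr (\<epsilon> * real a)"
      using assms by (simp add: powr_powr powr_realpow)
    moreover have "real (a + 1) \<le> 2 ^ a"
      by (metis Suc_eq_plus1 Suc_leI less_exp of_nat_le_iff of_nat_numeral of_nat_power)
    ultimately show ?thesis by linarith
  qed
  define w where "w n = (if n \<in> {..P} then B else 1)" for n :: nat
  have "real (card {d. d dvd n}) \<le> B ^ card (prime_factors n \<inter> {..P}) * real n powr \<epsilon>"
    if "n \<ge> 1" for n :: nat
    using that
  proof (induction n rule: less_induct)
    case (less n)
    show ?case
    proof (cases "n = 1")
      case False
      then obtain q where q: "prime q" "q dvd n" using prime_factor_nat by blast
      define a where "a = multiplicity q n"
      obtain m where m: "n = q ^ a * m" "\<not> q dvd m"
        using multiplicity_decompose'[of n q] q less.prems unfolding a_def by (metis not_prime_unit not_one_le_zero)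
      have a0: "a > 0" using q m by (metis gr0I mult_1 power_0)
      have m0: "m \<ge> 1" using m less.prems by (cases m) auto
      have q2: "2 \<le> q" using q prime_ge_2_nat by blast
      have "1 < q ^ a" using a0 q2 by (intro one_less_power) auto
      then have mn: "m < n" using m m0 by simp
      have sub: "{d. d dvd n} \<subseteq> (\<lambda>(i, e). q ^ i * e) ` ({..a} \<times> {e. e dvd m})"
      proof
        fix d assume "d \<in> {d. d dvd n}"
        then have "d dvd q ^ a * m" using m by simp
        then obtain b c where "d = b * c" "b dvd q ^ a" "c dvd m"
          using division_decomp by blast
        moreover obtain i where "i \<le> a" "b = q ^ i"
          using \<open>b dvd q ^ a\<close> divides_primepow_nat[OF q(1)] by blast
        ultimately show "d \<in> (\<lambda>(i, e). q ^ i * e) ` ({..a} \<times> {e. e dvd m})" by force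
      qed
      have fin: "finite {e. e dvd m}" using m0 by simp
      have "card {d. d dvd n} \<le> (a + 1) * card {e. e dvd m}"
        using surj_card_le[OF _ sub] fin by (simp add: card_cartesian_product)
      then have "real (card {d. d dvd n}) \<le> real (a + 1) * real (card {e. e dvd m})"
        by (metis of_nat_le_iff of_nat_mult)
      also have "\<dots> \<le> (w q * real q powr (\<epsilon> * real a)) * (B ^ card (prime_factors m \<inter> {..P}) * real m powr \<epsilon>)"
        using small[OF q2, of a] large[of q a] B1
        by (intro mult_mono less.IH mn m0) (auto simp: w_def)
      also have "\<dots> = (w q * B ^ card (prime_factors m \<inter> {..P})) * (real q powr (\<epsilon> * real a) * real m powr \<epsilon>)"
        by simp
      also have "w q * B ^ card (prime_factors m \<inter> {..P}) = B ^ card (prime_factors n \<inter> {..P})"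
      proof -
        have pf: "prime_factors n = insert q (prime_factors m)"
          using m a0 q m0 less.prems
          by (auto simp: in_prime_factors_iff prime_dvd_mult_iff prime_dvd_power_iff primes_dvd_imp_eq)
        have "q \<notin> prime_factors m" using m by auto
        then show ?thesis unfolding pf w_def by (cases "q \<le> P") auto
      qed
      also have "real q powr (\<epsilon> * real a) * real m powr \<epsilon> = real n powr \<epsilon>"
        using q2 by (simp add: m powr_mult powr_powr mult.commute flip: powr_realpow)
      finally show ?thesis .
    qed auto
  qed
  moreover have "B ^ card (prime_factors n \<inter> {..P}) \<le> B ^ (P + 1)" for n
    using B1 card_mono[of "{..P}" "prime_factors n \<inter> {..P}"] by (intro power_increasing) auto
  ultimately have "\<forall>n\<ge>1. real (card {d. d dvd (n::nat)}) \<le> B ^ (P + 1) * real n powr \<epsilon>"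
    by (meson mult_right_mono order_trans powr_ge_zero)
  then show ?thesis using one_le_power[OF B1, of "P + 1"] by blast
qed

section \<open>Dyadic blocks, frequency boxes and the gcd sum\<close>

definition block :: "nat \<Rightarrow> nat set" where
  "block N = {N..<2 * N}"

text \<open>Frequencies are plain functions rather than vectors \<open>int ^ 'n\<close>, so that a
  box is a \<open>PiE\<close> set and products of one-dimensional sums expand over it by
  \<open>prod_sum_PiE\<close>.\<close>

definition freq_box :: "nat \<Rightarrow> ('n \<Rightarrow> int) set" where
  "freq_box D = {\<xi>. \<forall>l. \<bar>\<xi> l\<bar> \<le> int D}"

lemma freq_box_iff: "\<xi> \<in> freq_box D \<longleftrightarrow> (\<forall>l. \<xi> l \<in> {- int D..int D})"
  unfolding freq_box_def mem_Collect_eq by (intro all_cong1) auto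

lemma freq_box_PiE: "freq_box D = (\<Pi>\<^sub>E l\<in>UNIV. {- int D..int D})"
  by (auto simp: freq_box_iff PiE_def Pi_def)

lemma finite_freq_box [simp]: "finite (freq_box D :: ('n::finite \<Rightarrow> int) set)"
  unfolding freq_box_PiE by (intro finite_PiE) auto

lemma finite_block [simp]: "finite (block N)"
  by (simp add: block_def)

lemma card_block [simp]: "card (block N) = N"
  by (simp add: block_def)

lemma real_card_UN_le:
  assumes "finite I" "\<And>i. i \<in> I \<Longrightarrow> real (card (A i)) \<le> V" "real (card I) \<le> W" "0 \<le> V"
  shows "real (card (\<Union>i\<in>I. A i)) \<le> W * V"
proof -
  have "real (card (\<Union>i\<in>I. A i)) \<le> real (\<Sum>i\<in>I. card (A i))"
    using card_UN_le[OF assms(1), of A] by linarith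
  also have "\<dots> = (\<Sum>i\<in>I. real (card (A i)))" by simp
  also have "\<dots> \<le> real (card I) * V"
    using sum_mono[OF assms(2), of I "\<lambda>i. i"] by simp
  also have "\<dots> \<le> W * V" using assms by (intro mult_right_mono) auto
  finally show ?thesis .
qed

text \<open>Pairwise congruence is assumed instead of a named residue class, since the congruences
  below come without an explicit solution.\<close>

lemma card_congruent_le:
  fixes A :: "int set" and q K :: nat
  assumes A: "A \<subseteq> {a..a + int K}" and q: "0 < q"
    and cong: "\<And>x y. x \<in> A \<Longrightarrow> y \<in> A \<Longrightarrow> int q dvd x - y"
  shows "real (card A) \<le> 1 + real K / real q"
proof (cases "A = {}")
  case False
  have fin: "finite A" using A finite_subset by blast
  define m where "m = Min A"
  have m: "m \<in> A" "\<And>x. x \<in> A \<Longrightarrow> m \<le> x" using fin False by (auto simp: m_def)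
  have "inj_on (\<lambda>x. (x - m) div int q) A"
  proof (rule inj_onI)
    fix x y assume *: "x \<in> A" "y \<in> A" "(x - m) div int q = (y - m) div int q"
    have "x - m = y - m"
      using cong[OF *(1) m(1)] cong[OF *(2) m(1)] *(3) by (metis dvd_div_mult_self)
    then show "x = y" by simp
  qed
  moreover have "(\<lambda>x. (x - m) div int q) ` A \<subseteq> {0..int (K div q)}"
  proof
    fix z assume "z \<in> (\<lambda>x. (x - m) div int q) ` A"
    then obtain x where x: "x \<in> A" "z = (x - m) div int q" by blast
    have "a \<le> m" "x \<le> a + int K" using x m(1) A by auto
    then have "x - m \<le> int K" by linarith
    then have "(x - m) div int q \<le> int K div int q" using q by (intro zdiv_mono1) auto
    then show "z \<in> {0..int (K div q)}"
      using x m q by (auto simp: zdiv_int pos_imp_zdiv_nonneg_iff)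
  qed
  ultimately have "card A \<le> card {0..int (K div q)}"
    by (intro card_inj_on_le) auto
  then have "real (card A) \<le> 1 + real (K div q)" by simp
  also have "\<dots> \<le> 1 + real K / real q" using of_nat_div_le_of_nat[of K q] by simp
  finally show ?thesis .
qed (use q in simp)

text \<open>No additive 1 survives: a multiple of d in the block forces d \<le> 2N, so that 1 \<le>
  2N/d.\<close>

lemma card_multiples_block:
  assumes "1 \<le> d"
  shows "real (card {n \<in> block N. d dvd n}) \<le> 3 * real N / real d"
proof (cases "{n \<in> block N. d dvd n} = {}")
  case False
  then obtain n where n: "n \<in> block N" "d dvd n" by blast
  then have "0 < n" "n < 2 * N" by (auto simp: block_def)
  then have d: "real d \<le> 2 * real N" using n dvd_imp_le[of d n] by linarith
  have "real (card (int ` {n \<in> block N. d dvd n})) \<le> 1 + real N / real d"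
    by (rule card_congruent_le[of _ "int N"]) (use assms in \<open>auto simp: block_def\<close>)
  also have "card (int ` {n \<in> block N. d dvd n}) = card {n \<in> block N. d dvd n}"
    by (rule card_image) auto
  finally show ?thesis using assms d by (simp add: field_simps)
next
  case True
  show ?thesis unfolding True by simp
qed

text \<open>The square of the gcd is at most the sum of d^2 over all common divisors d. After
  swapping, every d contributes at most 9 N' N, whatever its size, and d runs only up to 2N'. Hence
  the asymmetric bound, which is a gain when N' is the shorter block.\<close>

lemma sum_gcd_square_le:
  "(\<Sum>n\<in>block N'. \<Sum>m\<in>block N. real (gcd n m) ^ 2) \<le> 18 * real N' ^ 2 * real N"
proof -
  have "(\<Sum>n\<in>block N'. \<Sum>m\<in>block N. real (gcd n m) ^ 2)
     \<le> (\<Sum>n\<in>block N'. \<Sum>m\<in>block N. \<Sum>d\<in>{1..2*N'}. if d dvd n \<and> d dvd m then real d ^ 2 else 0)"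
  proof (intro sum_mono)
    fix n m assume n: "n \<in> block N'" and m: "m \<in> block N"
    have g: "gcd n m \<in> {1..2*N'}"
    proof -
      have "0 < n" "n < 2 * N'" using n by (auto simp: block_def)
      then have "gcd n m \<le> n" "gcd n m \<noteq> 0" using gcd_le1_nat[of n m] by auto
      then show ?thesis using \<open>n < 2 * N'\<close> by (simp add: Suc_le_eq)
    qed
    show "real (gcd n m) ^ 2 \<le> (\<Sum>d\<in>{1..2*N'}. if d dvd n \<and> d dvd m then real d ^ 2 else 0)"
      by (rule order_trans[OF _ member_le_sum[OF g]]) auto
  qed
  also have "\<dots> = (\<Sum>n\<in>block N'. \<Sum>d\<in>{1..2*N'}. \<Sum>m\<in>block N. if d dvd n \<and> d dvd m then real d ^ 2 else 0)"
    by (subst (2) sum.swap) (rule refl)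
  also have "\<dots> = (\<Sum>d\<in>{1..2*N'}. \<Sum>n\<in>block N'. \<Sum>m\<in>block N. if d dvd n \<and> d dvd m then real d ^ 2 else 0)"
    by (rule sum.swap)
  also have "\<dots> = (\<Sum>d\<in>{1..2*N'}. real d ^ 2 * (real (card {n\<in>block N'. d dvd n}) * real (card {m\<in>block N. d dvd m})))"
  proof (intro sum.cong refl)
    fix d
    have "(\<Sum>n\<in>block N'. \<Sum>m\<in>block N. if d dvd n \<and> d dvd m then real d ^ 2 else 0)
      = (\<Sum>n\<in>block N'. \<Sum>m\<in>block N. real d ^ 2 * ((if d dvd n then 1 else 0) * (if d dvd m then 1 else 0)))"
      by (intro sum.cong refl) auto
    also have "\<dots> = real d ^ 2 * ((\<Sum>n\<in>block N'. if d dvd n then 1 else 0) * (\<Sum>m\<in>block N. if d dvd m then 1 else 0))"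
      unfolding sum_product by (simp only: sum_distrib_left)
    also have "\<dots> = real d ^ 2 * (real (card {n\<in>block N'. d dvd n}) * real (card {m\<in>block N. d dvd m}))"
      by (simp add: sum.If_cases Int_def)
    finally show "(\<Sum>n\<in>block N'. \<Sum>m\<in>block N. if d dvd n \<and> d dvd m then real d ^ 2 else 0)
      = real d ^ 2 * (real (card {n\<in>block N'. d dvd n}) * real (card {m\<in>block N. d dvd m}))" .
  qed
  also have "\<dots> \<le> (\<Sum>d\<in>{1..2*N'}. real d ^ 2 * ((3 * real N' / real d) * (3 * real N / real d)))"
    by (intro sum_mono mult_left_mono mult_mono card_multiples_block) auto
  also have "\<dots> = (\<Sum>d\<in>{1..2*N'}. 9 * real N' * real N)"
    by (intro sum.cong refl) (auto simp: power2_eq_square)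
  also have "\<dots> = 18 * real N' ^ 2 * real N" by (simp add: power2_eq_square)
  finally show ?thesis .
qed

lemma finite_nat_divisors_int:
  assumes "u \<noteq> 0"
  shows "finite {d::nat. int d dvd u}"
proof (rule finite_subset)
  show "{d::nat. int d dvd u} \<subseteq> {..nat \<bar>u\<bar>}"
    using dvd_imp_le_int[OF assms] by (fastforce simp: le_nat_iff)
qed simp

lemma one_plus_power_le:
  assumes "0 \<le> (x::real)"
  shows "(1 + x) ^ j \<le> 2 ^ j * (1 + x ^ j)"
proof (cases "x \<le> 1")
  case True
  then have "(1 + x) ^ j \<le> 2 ^ j * 1" using assms by (simp add: power_mono)
  also have "\<dots> \<le> 2 ^ j * (1 + x ^ j)" using assms by simp
  finally show ?thesis .
next
  case False
  then have "(1 + x) ^ j \<le> (2 * x) ^ j" using assms by (intro power_mono) auto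
  also have "\<dots> \<le> 2 ^ j * (1 + x ^ j)" by (simp add: power_mult_distrib)
  finally show ?thesis .
qed

section \<open>Representations of a given difference of frequencies\<close>

text \<open>The product of the choices: k for a coordinate l with \<eta>_l nonzero, T for the gcd d,
  3N/d for n and 3D for \<xi>_l (together the 9), T for m, and a count of the other k - 1
  coordinates into which the factor N/d has been absorbed.\<close>

definition offdiag_bound :: "nat \<Rightarrow> real \<Rightarrow> real \<Rightarrow> real \<Rightarrow> real" where
  "offdiag_bound k T D N = real k * (T * (9 * 2 ^ (k - 1) * D * (N + (4 * D) ^ (k - 1)) * T))"

text \<open>For solutions of m\<eta> = n\<xi> with a vanishing coordinate. Each zero coordinate
  would lose a factor 1/q in the coefficient sums over multiples of q, so these are counted instead
  of being treated by Cauchy-Schwarz; as at most k - 1 coordinates are free, the plain count is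
  small enough.\<close>

definition axis_bound :: "nat \<Rightarrow> real \<Rightarrow> real \<Rightarrow> real \<Rightarrow> real" where
  "axis_bound k T D N = real k * (N * ((3 * D) ^ (k - 1) * T))"

text \<open>
  The gcd of $n$ and $m$ divides a nonzero coordinate of $\zeta$. Given it, $n$ and one coordinate of $\xi$,
  the divisor bound leaves few choices for $m$, and then every other coordinate of $\xi$ is determined
  modulo $m / \gcd(n, m)$.
\<close>

lemma count_offdiag:
  fixes \<zeta> :: "'n::finite \<Rightarrow> int" and N' N D :: nat and T :: real
  assumes N: "1 \<le> N'" "N' \<le> N" and D: "1 \<le> D" and k2: "2 \<le> CARD('n)"
    and \<zeta>: "\<exists>l. \<zeta> l \<noteq> 0"
    and T: "\<And>u::int. u \<noteq> 0 \<Longrightarrow> \<bar>u\<bar> \<le> U \<Longrightarrow> real (card {d::nat. int d dvd u}) \<le> T"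
    and U: "\<And>l. \<bar>\<zeta> l\<bar> + 2 * int N' * int D \<le> U"
  shows "real (card {(n, m, \<xi>). n \<in> block N' \<and> m \<in> block N \<and> \<xi> \<in> freq_box D \<and>
      (\<exists>\<eta>. (\<exists>l. \<eta> l \<noteq> 0) \<and> (\<forall>l. int m * \<eta> l = \<zeta> l + int n * \<xi> l))})
    \<le> offdiag_bound CARD('n) T (real D) (real N')"
proof -
  define j where "j = CARD('n) - 1"
  have j1: "1 \<le> j" using k2 by (simp add: j_def)
  \<comment> \<open>This coordinate is fixed for all solutions and controls the gcd; the coordinate
    \<open>l\<close> with \<eta>_l nonzero varies with the solution and controls
    \<open>m\<close>.\<close>
  obtain l' where l': "\<zeta> l' \<noteq> 0" using \<zeta> by blast
  have U': "\<bar>\<zeta> l + int n * x\<bar> \<le> U" if "n \<in> block N'" "\<bar>x\<bar> \<le> int D" for l n x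
  proof -
    have "\<bar>int n * x\<bar> \<le> (2 * int N') * int D"
      unfolding abs_mult using that by (intro mult_mono) (auto simp: block_def)
    then show ?thesis using U[of l] by linarith
  qed
  have lU: "\<bar>\<zeta> l'\<bar> \<le> U"
    using U[of l'] by (smt (verit, best) mult_nonneg_nonneg of_nat_0_le_iff)
  have T0: "0 \<le> T"
    by (rule order_trans[OF _ T[OF l' lU]]) simp
  define Dv where "Dv = {d::nat. int d dvd \<zeta> l'} - {0}"
  have finDv0: "finite {d::nat. int d dvd \<zeta> l'}"
    by (rule finite_nat_divisors_int[OF l'])
  have finDv: "finite Dv" using finDv0 by (simp add: Dv_def)
  have "real (card {d::nat. int d dvd \<zeta> l'}) \<le> T" by (rule T[OF l' lU])
  moreover have "card Dv \<le> card {d::nat. int d dvd \<zeta> l'}"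
    unfolding Dv_def by (intro card_mono finDv0) auto
  ultimately have cDv: "real (card Dv) \<le> T" by linarith
  define Nd where "Nd d = {n \<in> block N'. d dvd n}" for d
  \<comment> \<open>The nonvanishing of \<zeta>_l + n x, inherited from \<eta>_l, is what lets the
    divisor bound limit m.\<close>
  define Ms where "Ms l d n x = {m \<in> block N. gcd n m = d \<and> int m dvd \<zeta> l + int n * x \<and> \<zeta> l + int n * x \<noteq> 0}"
    for l d n x
  define R where "R n m i = {x \<in> {- int D..int D}. int m dvd \<zeta> i + int n * x}" for n m i
  define F where "F l n x m = (\<lambda>\<xi>. (n, m, \<xi>)) ` (\<Pi>\<^sub>E i\<in>UNIV. if i = l then {x} else R n m i)"
    for l n x m
  define G where "G l d = (\<Union>n\<in>Nd d. \<Union>x\<in>{- int D..int D}. \<Union>m\<in>Ms l d n x. F l n x m)" for l d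
  let ?S = "{(n, m, \<xi>). n \<in> block N' \<and> m \<in> block N \<and> \<xi> \<in> freq_box D \<and>
      (\<exists>\<eta>. (\<exists>l. \<eta> l \<noteq> 0) \<and> (\<forall>l. int m * \<eta> l = \<zeta> l + int n * \<xi> l))}"
  have sub: "?S \<subseteq> (\<Union>l\<in>UNIV. \<Union>d\<in>Dv. G l d)"
  proof
    fix t assume "t \<in> ?S"
    then obtain n m \<xi> \<eta> l where t: "t = (n, m, \<xi>)" and n: "n \<in> block N'" and m: "m \<in> block N"
      and \<xi>: "\<xi> \<in> freq_box D" and \<eta>: "\<eta> l \<noteq> 0" "\<And>l. int m * \<eta> l = \<zeta> l + int n * \<xi> l"
      by blast
    have m0: "0 < m" "0 < n" using m n N by (auto simp: block_def)
    have dv: "int m dvd \<zeta> i + int n * \<xi> i" for i using \<eta>(2)[of i] by (metis dvd_triv_left)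
    have nz: "\<zeta> l + int n * \<xi> l \<noteq> 0" using \<eta>(1) m0 by (simp flip: \<eta>(2))
    define d where "d = gcd n m"
    have "int d dvd \<zeta> l' + int n * \<xi> l'" "int d dvd int n"
      using dv[of l'] by (auto simp: d_def intro: dvd_trans)
    then have "int d dvd \<zeta> l'" by (metis dvd_add_left_iff dvd_mult2)
    moreover have "d \<noteq> 0" using m0 by (simp add: d_def)
    ultimately have dDv: "d \<in> Dv" by (simp add: Dv_def)
    have "t \<in> F l n (\<xi> l) m"
      using \<xi> dv unfolding F_def R_def t
      by (intro image_eqI[of _ _ \<xi>]) (auto simp: freq_box_iff)
    moreover have "m \<in> Ms l d n (\<xi> l)" using m dv nz by (simp add: Ms_def d_def)
    moreover have "\<xi> l \<in> {- int D..int D}" using \<xi> by (auto simp: freq_box_iff)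
    moreover have "n \<in> Nd d" using n by (simp add: Nd_def d_def)
    ultimately have "t \<in> G l d" unfolding G_def by blast
    then show "t \<in> (\<Union>l\<in>UNIV. \<Union>d\<in>Dv. G l d)" using dDv by blast
  qed
  have F: "real (card (F l n x m)) \<le> (1 + 2 * real D * real d / real N') ^ j" and finF: "finite (F l n x m)"
    if "n \<in> Nd d" "m \<in> Ms l d n x" for l d n x m
  proof -
    have finR: "finite (R n m i)" for i
      unfolding R_def by (rule finite_subset[of _ "{- int D..int D}"]) auto
    show "finite (F l n x m)" unfolding F_def using finR by (intro finite_imageI finite_PiE) auto
    have g: "gcd n m = d" and mN: "N \<le> m" "0 < m" using that N by (auto simp: Ms_def block_def)
    have d0: "0 < d" using g mN by auto
    define q where "q = m div d"
    have mq: "m = d * q" using g by (auto simp: q_def)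
    have q0: "0 < q" using mq mN by (cases q) auto
    have R: "real (card (R n m i)) \<le> 1 + 2 * real D * real d / real N'" for i
    proof -
      have "real (card (R n m i)) \<le> 1 + real (2 * D) / real q"
      proof (rule card_congruent_le[of _ "- int D"])
        fix x y assume "x \<in> R n m i" "y \<in> R n m i"
        then have "int m dvd (\<zeta> i + int n * x) - (\<zeta> i + int n * y)"
          unfolding R_def by (intro dvd_diff) auto
        then have "int m dvd int n * (x - y)" by (simp add: algebra_simps)
        moreover obtain n' where n': "n = d * n'" using g by (metis dvdE gcd_dvd1)
        ultimately have "int q dvd int n' * (x - y)" using mq d0 by (simp add: mult.assoc)
        moreover have "coprime (int q) (int n')"
        proof -
          have "d * gcd n' q = d" using g n' mq by (simp add: gcd_mult_distrib_nat)
          then show ?thesis using d0 by (simp add: coprime_iff_gcd_eq_1 gcd.commute)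
        qed
        ultimately show "int q dvd x - y" by (simp add: coprime_dvd_mult_right_iff)
      qed (use q0 in \<open>auto simp: R_def\<close>)
      also have "real (2 * D) / real q = 2 * real D * real d / real m"
        using mq d0 q0 by (simp add: field_simps)
      also have "\<dots> \<le> 2 * real D * real d / real N'"
        using N mN by (intro divide_left_mono) auto
      finally show ?thesis by simp
    qed
    have "card (F l n x m) = card (\<Pi>\<^sub>E i\<in>UNIV. if i = l then {x} else R n m i)"
      unfolding F_def by (rule card_image) (auto simp: inj_on_def)
    also have "\<dots> = (\<Prod>i\<in>UNIV. card (if i = l then {x} else R n m i))"
      by (rule card_PiE) auto
    also have "\<dots> = (\<Prod>i\<in>UNIV - {l}. card (R n m i))"
      by (subst prod.remove[of _ l]) (auto intro!: prod.cong)
    finally have "real (card (F l n x m)) = (\<Prod>i\<in>UNIV - {l}. real (card (R n m i)))" by simp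
    also have "\<dots> \<le> (\<Prod>i\<in>UNIV - {l}. 1 + 2 * real D * real d / real N')"
      by (intro prod_mono) (use R in auto)
    also have "\<dots> = (1 + 2 * real D * real d / real N') ^ j"
      by (simp add: j_def)
    finally show "real (card (F l n x m)) \<le> (1 + 2 * real D * real d / real N') ^ j" .
  qed
  have G: "real (card (G l d)) \<le> 9 * 2 ^ j * real D * (real N' + (4 * real D) ^ j) * T" if d: "d \<in> Dv" for l d
  proof -
    define V where "V = (1 + 2 * real D * real d / real N') ^ j"
    have V0: "0 \<le> V" by (simp add: V_def)
    have d0: "1 \<le> d" using d by (simp add: Dv_def Suc_le_eq)
    show ?thesis
    proof (cases "Nd d = {}")
      case False
      then obtain n where "n \<in> block N'" "d dvd n" by (auto simp: Nd_def)
      then have d2: "real d \<le> 2 * real N'" using N dvd_imp_le[of d n] by (auto simp: block_def)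
      define y where "y = 2 * real D * real d / real N'"
      obtain i where i: "j = Suc i" using j1 by (cases j) auto
      \<comment> \<open>The number N'/d of choices for n cancels one of the j factors d/N', and each
        of the others is at most 2. There is a factor to cancel because k \<ge> 2.\<close>
      have "y ^ j * (real N' / real d) = (2 * real D) ^ j * (real d / real N') ^ i"
      proof -
        define z where "z = real d / real N'"
        have "z \<noteq> 0" "y = 2 * real D * z" "real N' / real d = 1 / z"
          using d0 N by (auto simp: y_def z_def)
        then show ?thesis by (simp add: i power_mult_distrib z_def[symmetric])
      qed
      also have "\<dots> \<le> (2 * real D) ^ j * 2 ^ i"
        using d2 N by (intro mult_left_mono power_mono) (auto simp: field_simps)
      also have "\<dots> \<le> (2 * real D) ^ j * 2 ^ j"
        by (intro mult_left_mono power_increasing) (auto simp: i)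
      also have "\<dots> = (4 * real D) ^ j" by (subst power_mult_distrib[symmetric]) simp
      finally have yj: "y ^ j * (real N' / real d) \<le> (4 * real D) ^ j" .
      have "(real N' / real d) * V \<le> (real N' / real d) * (2 ^ j * (1 + y ^ j))"
        unfolding V_def y_def by (intro mult_left_mono one_plus_power_le) auto
      also have "\<dots> = 2 ^ j * (real N' / real d + y ^ j * (real N' / real d))"
        by (simp add: algebra_simps)
      also have "\<dots> \<le> 2 ^ j * (real N' + (4 * real D) ^ j)"
      proof -
        have "real N' / real d \<le> real N' / 1" using d0 by (intro divide_left_mono) auto
        then show ?thesis using yj by (intro mult_left_mono add_mono) auto
      qed
      finally have main: "(real N' / real d) * V \<le> 2 ^ j * (real N' + (4 * real D) ^ j)" .
      have "real (card (G l d)) \<le> (3 * real N' / real d) * ((3 * real D) * (T * V))"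
        unfolding G_def
      proof (intro real_card_UN_le)
        fix n x assume n: "n \<in> Nd d" and x: "x \<in> {- int D..int D}"
        show "real (card (Ms l d n x)) \<le> T"
        proof (cases "Ms l d n x = {}")
          case False
          then have nz: "\<zeta> l + int n * x \<noteq> 0" by (auto simp: Ms_def)
          have fin: "finite {d::nat. int d dvd \<zeta> l + int n * x}"
          by (rule finite_nat_divisors_int[OF nz])
          have "card (Ms l d n x) \<le> card {d::nat. int d dvd \<zeta> l + int n * x}"
            by (intro card_mono fin) (auto simp: Ms_def)
          moreover have "real (card {d::nat. int d dvd \<zeta> l + int n * x}) \<le> T"
            using n x by (intro T nz U') (auto simp: Nd_def)
          ultimately show ?thesis by linarith
        qed (use T0 in simp)
        show "finite (Ms l d n x)" by (simp add: Ms_def)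
        show "real (card (F l n x m)) \<le> V" if "m \<in> Ms l d n x" for m
          unfolding V_def by (rule F[OF n that])
      next
        show "real (card (Nd d)) \<le> 3 * real N' / real d"
          unfolding Nd_def by (rule card_multiples_block[OF d0])
        show "real (card {- int D..int D}) \<le> 3 * real D" using D by simp
      qed (use T0 V0 D in \<open>auto simp: Nd_def\<close>)
      also have "\<dots> = (9 * real D * T) * ((real N' / real d) * V)" by simp
      also have "\<dots> \<le> (9 * real D * T) * (2 ^ j * (real N' + (4 * real D) ^ j))"
        using main T0 by (intro mult_left_mono) auto
      finally show ?thesis by (simp only: mult_ac)
    qed (use T0 in \<open>simp add: G_def\<close>)
  qed
  have "finite (\<Union>l\<in>(UNIV::'n set). \<Union>d\<in>Dv. G l d)"
    unfolding G_def using finDv finF by (intro finite_UN_I) (auto simp: Nd_def Ms_def)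
  then have "real (card ?S) \<le> real (card (\<Union>l\<in>(UNIV::'n set). \<Union>d\<in>Dv. G l d))"
    using sub by (simp add: card_mono)
  also have "\<dots> \<le> real CARD('n) * (T * (9 * 2 ^ j * real D * (real N' + (4 * real D) ^ j) * T))"
    by (intro real_card_UN_le cDv finDv G) (use T0 in auto)
  finally show ?thesis by (simp only: j_def offdiag_bound_def)
qed

text \<open>Eliminating \<eta> leaves the condition that m divides every n\<xi>_l; a single nonzero
  \<xi>_l then leaves at most T values of m.\<close>

lemma count_axis:
  fixes N' N D :: nat and T :: real
  assumes T: "\<And>u::int. u \<noteq> 0 \<Longrightarrow> \<bar>u\<bar> \<le> 2 * int N' * int D \<Longrightarrow> real (card {d::nat. int d dvd u}) \<le> T"
    and D: "1 \<le> D" and T0: "0 \<le> T"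
  shows "real (card {(n, m, \<xi> :: 'n::finite \<Rightarrow> int). n \<in> block N' \<and> m \<in> block N \<and> \<xi> \<in> freq_box D \<and>
      (\<exists>l. \<xi> l = 0) \<and> (\<exists>l. \<xi> l \<noteq> 0) \<and> (\<forall>l. int m dvd int n * \<xi> l)})
    \<le> axis_bound CARD('n) T (real D) (real N')"
proof -
  define X where "X l = (\<Pi>\<^sub>E i\<in>(UNIV::'n set). if i = l then {0} else {- int D..int D})" for l
  define Ms where "Ms n \<xi> = {m \<in> block N. \<forall>l. int m dvd int n * \<xi> l}" for n and \<xi> :: "'n \<Rightarrow> int"
  define G where "G l = (\<Union>n\<in>block N'. \<Union>\<xi>\<in>X l - {\<lambda>_. 0}. (\<lambda>m. (n, m, \<xi>)) ` Ms n \<xi>)" for l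
  let ?S = "{(n, m, \<xi> :: 'n \<Rightarrow> int). n \<in> block N' \<and> m \<in> block N \<and> \<xi> \<in> freq_box D \<and>
      (\<exists>l. \<xi> l = 0) \<and> (\<exists>l. \<xi> l \<noteq> 0) \<and> (\<forall>l. int m dvd int n * \<xi> l)}"
  have finX: "finite (X l)" for l unfolding X_def by (intro finite_PiE) auto
  have finMs: "finite (Ms n \<xi>)" for n \<xi>
    unfolding Ms_def by (rule finite_subset[OF _ finite_block]) auto
  have cX: "real (card (X l - {\<lambda>_. 0})) \<le> (3 * real D) ^ (CARD('n) - 1)" for l
  proof -
    have "card (X l) = (\<Prod>i\<in>UNIV. card (if i = l then {0} else {- int D..int D}))"
      unfolding X_def by (rule card_PiE) auto
    also have "\<dots> = (\<Prod>i\<in>UNIV - {l}. card {- int D..int D})"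
      by (subst prod.remove[of _ l]) (auto intro!: prod.cong)
    finally have "real (card (X l)) = real (card {- int D..int D}) ^ (CARD('n) - 1)" by simp
    also have "\<dots> \<le> (3 * real D) ^ (CARD('n) - 1)" using D by (intro power_mono) auto
    finally have "real (card (X l)) \<le> (3 * real D) ^ (CARD('n) - 1)" .
    moreover have "card (X l - {\<lambda>_. 0}) \<le> card (X l)" by (intro card_mono finX) auto
    ultimately show ?thesis by linarith
  qed
  have sub: "?S \<subseteq> (\<Union>l\<in>UNIV. G l)"
  proof
    fix t assume "t \<in> ?S"
    then obtain n m \<xi> l l' where t: "t = (n, m, \<xi>)" "n \<in> block N'" "m \<in> block N"
      "\<xi> \<in> freq_box D" "\<xi> l = 0" "\<xi> l' \<noteq> 0" "\<forall>l. int m dvd int n * \<xi> l" by blast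
    have "\<xi> \<in> X l - {\<lambda>_. 0}"
      using t by (auto simp: X_def freq_box_iff)
    moreover have "m \<in> Ms n \<xi>" using t by (simp add: Ms_def)
    ultimately show "t \<in> (\<Union>l\<in>UNIV. G l)" unfolding G_def using t by blast
  qed
  have cMs: "real (card ((\<lambda>m. (n, m, \<xi>)) ` Ms n \<xi>)) \<le> T"
    if n: "n \<in> block N'" and \<xi>: "\<xi> \<in> X l - {\<lambda>_. 0}" for n \<xi> l
  proof -
    obtain l' where l': "\<xi> l' \<noteq> 0" using \<xi> by auto
    have ab: "\<bar>\<xi> l'\<bar> \<le> int D"
    proof -
      have "\<xi> l' \<in> (if l' = l then {0} else {- int D..int D})"
        using \<xi> unfolding X_def by (auto dest: PiE_mem[of _ _ _ l'])
      then show ?thesis using l' by (auto split: if_splits)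
    qed
    have n0: "0 < n" using n by (cases N') (auto simp: block_def)
    have nz: "int n * \<xi> l' \<noteq> 0" using n0 l' by simp
    have le: "\<bar>int n * \<xi> l'\<bar> \<le> 2 * int N' * int D"
      unfolding abs_mult using n ab by (intro mult_mono) (auto simp: block_def)
    have fin: "finite {d::nat. int d dvd int n * \<xi> l'}"
      by (rule finite_nat_divisors_int[OF nz])
    have "card ((\<lambda>m. (n, m, \<xi>)) ` Ms n \<xi>) \<le> card (Ms n \<xi>)"
      by (rule card_image_le[OF finMs])
    also have "\<dots> \<le> card {d::nat. int d dvd int n * \<xi> l'}"
      by (intro card_mono fin) (auto simp: Ms_def)
    finally show ?thesis using T[OF nz le] by linarith
  qed
  have "finite (\<Union>l\<in>(UNIV::'n set). G l)"
    unfolding G_def using finX finMs by (intro finite_UN_I finite_imageI) auto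
  then have "real (card ?S) \<le> real (card (\<Union>l\<in>(UNIV::'n set). G l))"
    using sub by (simp add: card_mono)
  also have "\<dots> \<le> real CARD('n) * (real N' * ((3 * real D) ^ (CARD('n) - 1) * T))"
    unfolding G_def using T0 by (intro real_card_UN_le cX cMs) (auto simp: finX)
  finally show ?thesis by (simp only: axis_bound_def)
qed

section \<open>Coefficient sums over multiples of q\<close>

text \<open>Comparison with a telescoping sum: 1/(x + b)^2 \<le> (1/b)(1/x - 1/(x + b)). The bound
  is independent of \<open>V\<close>, hence later of the degree of the kernels.\<close>

lemma sum_inverse_square_linear_le:
  fixes b :: real
  assumes "0 < b"
  shows "(\<Sum>v\<in>{1..V::nat}. 1 / (1 + b * real v)\<^sup>2) \<le> 1 / b"
proof -
  have "(\<Sum>v\<in>{1..V::nat}. 1 / (1 + b * real v)\<^sup>2) \<le> 1 / b - 1 / (b * (1 + b * real V))"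
  proof (induction V)
    case (Suc V)
    define x where "x = 1 + b * real V"
    have x: "0 < x" "1 + b * real (Suc V) = x + b" using assms by (auto simp: x_def algebra_simps add_pos_nonneg)
    have "1 / (x + b)\<^sup>2 \<le> 1 / (x * (x + b))"
      using x assms by (intro divide_left_mono) (auto simp: power2_eq_square intro!: mult_right_mono)
    also have "\<dots> = 1 / (b * x) - 1 / (b * (x + b))"
    proof -
      have "x \<noteq> 0" "b \<noteq> 0" "x + b \<noteq> 0" using x(1) assms by auto
      have "1 / (b * x) = (x + b) / (b * x * (x + b))" "1 / (b * (x + b)) = x / (b * x * (x + b))"
        using \<open>x \<noteq> 0\<close> \<open>x + b \<noteq> 0\<close> by simp_all
      then have "1 / (b * x) - 1 / (b * (x + b)) = (x + b - x) / (b * x * (x + b))"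
        by (simp only: diff_divide_distrib)
      then show ?thesis using \<open>b \<noteq> 0\<close> by simp
    qed
    finally show ?case using Suc.IH x by (simp add: x_def[symmetric])
  qed simp
  also have "\<dots> \<le> 1 / b" using assms by simp
  finally show ?thesis .
qed

lemma sum_inverse_square_multiples_le:
  fixes \<beta> :: real and q D :: nat
  assumes "0 < \<beta>" "1 \<le> q"
  shows "(\<Sum>u\<in>{u\<in>{- int D..int D}. u \<noteq> 0 \<and> int q dvd u}. 1 / (1 + \<beta> * \<bar>real_of_int u\<bar>)\<^sup>2) \<le> 2 / (\<beta> * real q)"
proof -
  let ?f = "\<lambda>u. 1 / (1 + \<beta> * \<bar>real_of_int u\<bar>)\<^sup>2"
  let ?P = "(\<lambda>v. int q * int v) ` {1..D}" and ?M = "(\<lambda>v. - (int q * int v)) ` {1..D}"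
  have bq: "0 < \<beta> * real q" using assms by simp
  have sub: "{u\<in>{- int D..int D}. u \<noteq> 0 \<and> int q dvd u} \<subseteq> ?P \<union> ?M"
  proof
    fix u assume u: "u \<in> {u\<in>{- int D..int D}. u \<noteq> 0 \<and> int q dvd u}"
    then obtain v where v: "u = int q * v" by blast
    have v0: "v \<noteq> 0" using u v by auto
    have "\<bar>v\<bar> * 1 \<le> \<bar>v\<bar> * int q" using assms by (intro mult_left_mono) auto
    also have "\<dots> = \<bar>u\<bar>" using v by (simp add: abs_mult)
    finally have le: "\<bar>v\<bar> \<le> int D" using u by auto
    show "u \<in> ?P \<union> ?M"
    proof (cases "v > 0")
      case True
      then have "u = int q * int (nat v)" "nat v \<in> {1..D}" using v le by auto
      then show ?thesis by blast
    next
      case False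
      then have "u = - (int q * int (nat (- v)))" "nat (- v) \<in> {1..D}" using v le v0 by auto
      then show ?thesis by blast
    qed
  qed
  have "sum ?f {u\<in>{- int D..int D}. u \<noteq> 0 \<and> int q dvd u} \<le> sum ?f (?P \<union> ?M)"
    by (rule sum_mono2[OF _ sub]) auto
  also have "\<dots> \<le> sum ?f ?P + sum ?f ?M"
    by (subst sum_Un) (auto intro!: sum_nonneg)
  also have "sum ?f ?P = (\<Sum>v\<in>{1..D}. 1 / (1 + (\<beta> * real q) * real v)\<^sup>2)"
    using assms by (subst sum.reindex) (auto simp: inj_on_def abs_mult mult.assoc)
  also have "sum ?f ?M = (\<Sum>v\<in>{1..D}. 1 / (1 + (\<beta> * real q) * real v)\<^sup>2)"
    using assms by (subst sum.reindex) (auto simp: inj_on_def abs_mult mult.assoc)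
  also have "(\<Sum>v\<in>{1..D}. 1 / (1 + (\<beta> * real q) * real v)\<^sup>2) + (\<Sum>v\<in>{1..D}. 1 / (1 + (\<beta> * real q) * real v)\<^sup>2)
      \<le> 2 / (\<beta> * real q)"
    using sum_inverse_square_linear_le[OF bq, of D] by simp
  finally show ?thesis by simp
qed

text \<open>One factor is bounded by its maximum and the other is summed; taking the maximum of the
  one with the smaller parameter produces \<open>min\<close>. This is the overlap of two concentric
  intervals of lengths \<alpha> and \<alpha>'. The gain 1/q relies on leaving out u = 0.\<close>

lemma kernel_product_sum_le:
  fixes \<alpha> \<alpha>' :: real and f g :: "int \<Rightarrow> real"
  assumes pos: "0 < \<alpha>" "0 < \<alpha>'" "1 \<le> q"
    and f: "\<And>u. u \<in> {- int D..int D} \<Longrightarrow> 0 \<le> f u \<and> f u \<le> 4 * \<alpha> / (1 + \<alpha> * \<bar>real_of_int u\<bar>)\<^sup>2"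
    and g: "\<And>u. u \<in> {- int D..int D} \<Longrightarrow> 0 \<le> g u \<and> g u \<le> 4 * \<alpha>' / (1 + \<alpha>' * \<bar>real_of_int u\<bar>)\<^sup>2"
  shows "(\<Sum>u\<in>{u\<in>{- int D..int D}. u \<noteq> 0 \<and> int q dvd u}. f u * g u) \<le> 32 * min \<alpha> \<alpha>' / real q"
proof -
  have key: "(\<Sum>u\<in>{u\<in>{- int D..int D}. u \<noteq> 0 \<and> int q dvd u}. f u * g u) \<le> 32 * \<beta>' / real q"
    if b: "0 < \<beta>" "0 < \<beta>'"
      and f: "\<And>u. u \<in> {- int D..int D} \<Longrightarrow> 0 \<le> f u \<and> f u \<le> 4 * \<beta> / (1 + \<beta> * \<bar>real_of_int u\<bar>)\<^sup>2"
      and g: "\<And>u. u \<in> {- int D..int D} \<Longrightarrow> 0 \<le> g u \<and> g u \<le> 4 * \<beta>' / (1 + \<beta>' * \<bar>real_of_int u\<bar>)\<^sup>2"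
    for \<beta> \<beta>' and f g :: "int \<Rightarrow> real"
  proof -
    have "(\<Sum>u\<in>{u\<in>{- int D..int D}. u \<noteq> 0 \<and> int q dvd u}. f u * g u)
       \<le> (\<Sum>u\<in>{u\<in>{- int D..int D}. u \<noteq> 0 \<and> int q dvd u}. (16 * \<beta> * \<beta>') * (1 / (1 + \<beta> * \<bar>real_of_int u\<bar>)\<^sup>2))"
    proof (rule sum_mono)
      fix u assume "u \<in> {u\<in>{- int D..int D}. u \<noteq> 0 \<and> int q dvd u}"
      then have u: "u \<in> {- int D..int D}" by blast
      have one: "1 \<le> (1 + \<beta>' * \<bar>real_of_int u\<bar>)\<^sup>2" using b by (simp add: one_le_power)
      have "4 * \<beta>' / (1 + \<beta>' * \<bar>real_of_int u\<bar>)\<^sup>2 \<le> 4 * \<beta>' / 1"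
        by (rule divide_left_mono) (use b one in linarith)+
      then have "g u \<le> 4 * \<beta>'" using g[OF u] by linarith
      then have "f u * g u \<le> (4 * \<beta> / (1 + \<beta> * \<bar>real_of_int u\<bar>)\<^sup>2) * (4 * \<beta>')"
        using f[OF u] g[OF u] b by (intro mult_mono) auto
      then show "f u * g u \<le> (16 * \<beta> * \<beta>') * (1 / (1 + \<beta> * \<bar>real_of_int u\<bar>)\<^sup>2)" by simp
    qed
    also have "\<dots> \<le> (16 * \<beta> * \<beta>') * (2 / (\<beta> * real q))"
      unfolding sum_distrib_left[symmetric] using b pos
      by (intro mult_left_mono sum_inverse_square_multiples_le) auto
    also have "\<dots> = 32 * \<beta>' / real q" using b by simp
    finally show ?thesis .
  qed
  show ?thesis
  proof (cases "\<alpha>' \<le> \<alpha>")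
    case True
    then show ?thesis using key[OF pos(1,2) f g] by (simp add: min_def)
  next
    case False
    then show ?thesis using key[OF pos(2,1) g f] by (simp add: min_def mult.commute)
  qed
qed

text \<open>Opening the square, a pair of boxes factors over the coordinates and contributes, up to
  a constant, the volume of its intersection times q^(-k). Here the interaction of different boxes
  enters, through their total overlap \<open>V\<close>.\<close>

lemma coeff_square_sum_le:
  fixes A :: "('n::finite \<Rightarrow> real) set" and \<kappa> :: "real \<Rightarrow> int \<Rightarrow> real"
  assumes fin: "finite A" and q: "1 \<le> q"
    and \<kappa>: "\<And>\<alpha> l u. \<alpha> \<in> A \<Longrightarrow> u \<in> {- int D..int D} \<Longrightarrow>
       0 \<le> \<kappa> (\<alpha> l) u \<and> \<kappa> (\<alpha> l) u \<le> 4 * \<alpha> l / (1 + \<alpha> l * \<bar>real_of_int u\<bar>)\<^sup>2"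
    and pos: "\<And>\<alpha> l. \<alpha> \<in> A \<Longrightarrow> 0 < \<alpha> l"
    and ov: "\<And>\<alpha>. \<alpha> \<in> A \<Longrightarrow> (\<Sum>\<alpha>'\<in>A. \<Prod>l\<in>UNIV. min (\<alpha> l) (\<alpha>' l)) \<le> V"
  shows "(\<Sum>\<xi>\<in>{\<xi>\<in>freq_box D. \<forall>l. \<xi> l \<noteq> 0 \<and> int q dvd \<xi> l}. (\<Sum>\<alpha>\<in>A. \<Prod>l\<in>UNIV. \<kappa> (\<alpha> l) (\<xi> l))\<^sup>2)
     \<le> 32 ^ CARD('n) * (real (card A) * V) / real q ^ CARD('n)"
proof -
  define U where "U = {u\<in>{- int D..int D}. u \<noteq> 0 \<and> int q dvd u}"
  have set_eq: "{\<xi>\<in>freq_box D. \<forall>l. \<xi> l \<noteq> 0 \<and> int q dvd \<xi> l} = (\<Pi>\<^sub>E l\<in>(UNIV::'n set). U)"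
    by (auto simp: freq_box_iff U_def PiE_def Pi_def)
  have finU: "finite U" unfolding U_def by (rule finite_subset[of _ "{- int D..int D}"]) auto
  have "(\<Sum>\<xi>\<in>(\<Pi>\<^sub>E l\<in>(UNIV::'n set). U). (\<Sum>\<alpha>\<in>A. \<Prod>l\<in>UNIV. \<kappa> (\<alpha> l) (\<xi> l))\<^sup>2)
    = (\<Sum>\<xi>\<in>(\<Pi>\<^sub>E l\<in>(UNIV::'n set). U). \<Sum>\<alpha>\<in>A. \<Sum>\<alpha>'\<in>A. \<Prod>l\<in>UNIV. \<kappa> (\<alpha> l) (\<xi> l) * \<kappa> (\<alpha>' l) (\<xi> l))"
    by (simp add: power2_eq_square sum_product prod.distrib)
  also have "\<dots> = (\<Sum>\<alpha>\<in>A. \<Sum>\<alpha>'\<in>A. \<Sum>\<xi>\<in>(\<Pi>\<^sub>E l\<in>(UNIV::'n set). U). \<Prod>l\<in>UNIV. \<kappa> (\<alpha> l) (\<xi> l) * \<kappa> (\<alpha>' l) (\<xi> l))"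
    by (subst sum.swap, subst (2) sum.swap) (rule refl)
  also have "\<dots> = (\<Sum>\<alpha>\<in>A. \<Sum>\<alpha>'\<in>A. \<Prod>l\<in>UNIV. \<Sum>u\<in>U. \<kappa> (\<alpha> l) u * \<kappa> (\<alpha>' l) u)"
    using finU by (intro sum.cong refl, subst prod_sum_PiE) auto
  also have "\<dots> \<le> (\<Sum>\<alpha>\<in>A. \<Sum>\<alpha>'\<in>A. \<Prod>l\<in>UNIV. 32 / real q * min (\<alpha> l) (\<alpha>' l))"
  proof (intro sum_mono prod_mono conjI)
    fix \<alpha> \<alpha>' l assume a: "\<alpha> \<in> A" "\<alpha>' \<in> A"
    show "0 \<le> (\<Sum>u\<in>U. \<kappa> (\<alpha> l) u * \<kappa> (\<alpha>' l) u)"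
      using a \<kappa> by (intro sum_nonneg mult_nonneg_nonneg) (auto simp: U_def)
    have "(\<Sum>u\<in>U. \<kappa> (\<alpha> l) u * \<kappa> (\<alpha>' l) u) \<le> 32 * min (\<alpha> l) (\<alpha>' l) / real q"
      unfolding U_def by (rule kernel_product_sum_le) (use a pos \<kappa> q in auto)
    then show "(\<Sum>u\<in>U. \<kappa> (\<alpha> l) u * \<kappa> (\<alpha>' l) u) \<le> 32 / real q * min (\<alpha> l) (\<alpha>' l)" by simp
  qed
  also have "\<dots> = (\<Sum>\<alpha>\<in>A. (32 / real q) ^ CARD('n) * (\<Sum>\<alpha>'\<in>A. \<Prod>l\<in>UNIV. min (\<alpha> l) (\<alpha>' l)))"
    unfolding prod.distrib by (simp add: sum_distrib_left)
  also have "\<dots> \<le> (\<Sum>\<alpha>\<in>A. (32 / real q) ^ CARD('n) * V)"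
    by (intro sum_mono mult_left_mono ov) auto
  also have "\<dots> = 32 ^ CARD('n) * (real (card A) * V) / real q ^ CARD('n)"
    by (simp add: power_divide)
  finally show ?thesis unfolding set_eq .
qed

section \<open>Sums over pairs of frequencies\<close>

text \<open>A pair (n, \<xi>) stands for the character of frequency n\<xi>. The zero frequency is
  left out because it carries the mean.\<close>

definition freq_pairs :: "nat \<Rightarrow> nat \<Rightarrow> (nat \<times> ('n \<Rightarrow> int)) set" where
  "freq_pairs N D = block N \<times> (freq_box D - {\<lambda>_. 0})"

definition freq_diff :: "nat \<times> ('n \<Rightarrow> int) \<Rightarrow> nat \<times> ('n \<Rightarrow> int) \<Rightarrow> 'n \<Rightarrow> int" where
  "freq_diff s t = (\<lambda>l. int (fst t) * snd t l - int (fst s) * snd s l)"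

lemma finite_freq_pairs [simp]: "finite (freq_pairs N D :: (nat \<times> ('n::finite \<Rightarrow> int)) set)"
  by (simp add: freq_pairs_def)

text \<open>Write n = n'g and m = m'g with n', m' coprime. Then n\<xi> = m\<eta> forces m' to divide
  every \<xi>_l and n' to divide every \<eta>_l, so Cauchy-Schwarz with the two coefficient sums
  gives sqrt(G G') (n'm')^(-k/2). For k \<ge> 2 this is at most sqrt(G G') g^2/(nm), which the gcd
  sum handles.\<close>

lemma pair_sum_diagonal:
  fixes c c' :: "('n::finite \<Rightarrow> int) \<Rightarrow> real"
  assumes N: "1 \<le> N'" "1 \<le> N" and k2: "2 \<le> CARD('n)"
    and G0: "0 \<le> G" "0 \<le> G'"
    and G': "\<And>q. 1 \<le> q \<Longrightarrow> (\<Sum>\<xi>\<in>{\<xi>\<in>freq_box D'. \<forall>l. \<xi> l \<noteq> 0 \<and> int q dvd \<xi> l}. (c' \<xi>)\<^sup>2) \<le> G' / real q ^ CARD('n)"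
    and G: "\<And>q. 1 \<le> q \<Longrightarrow> (\<Sum>\<xi>\<in>{\<xi>\<in>freq_box D. \<forall>l. \<xi> l \<noteq> 0 \<and> int q dvd \<xi> l}. (c \<xi>)\<^sup>2) \<le> G / real q ^ CARD('n)"
  shows "(\<Sum>(s, t)\<in>{(s, t). s \<in> freq_pairs N' D' \<and> t \<in> freq_pairs N D \<and> (\<forall>l. snd s l \<noteq> 0) \<and> freq_diff s t = (\<lambda>_. 0)}.
      c' (snd s) * c (snd t)) \<le> 18 * real N' * sqrt (G * G')"
proof -
  define Q where "Q = {(s, t). s \<in> freq_pairs N' D' \<and> t \<in> freq_pairs N D \<and> (\<forall>l. snd s l \<noteq> 0) \<and> freq_diff s t = (\<lambda>_::'n. 0)}"
  define h where "h = (\<lambda>(s :: nat \<times> ('n \<Rightarrow> int), t :: nat \<times> ('n \<Rightarrow> int)). c' (snd s) * c (snd t))"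
  define p where "p = (\<lambda>(s :: nat \<times> ('n \<Rightarrow> int), t :: nat \<times> ('n \<Rightarrow> int)). (fst s, fst t))"
  have finQ: "finite Q"
    by (rule finite_subset[of _ "freq_pairs N' D' \<times> freq_pairs N D"]) (auto simp: Q_def)
  have one: "sum h {x\<in>Q. p x = (n, m)} \<le> sqrt (G * G') / (real N' * real N) * real (gcd n m) ^ 2"
    if n: "n \<in> block N'" and m: "m \<in> block N" for n m
  proof -
    define Z where "Z = {x\<in>Q. p x = (n, m)}"
    define X where "X = (\<lambda>x :: (nat \<times> ('n \<Rightarrow> int)) \<times> (nat \<times> ('n \<Rightarrow> int)). snd (fst x))"
    define Y where "Y = (\<lambda>x :: (nat \<times> ('n \<Rightarrow> int)) \<times> (nat \<times> ('n \<Rightarrow> int)). snd (snd x))"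
    have n0: "0 < n" "N' \<le> n" and m0: "0 < m" "N \<le> m" using n m N by (auto simp: block_def)
    define g where "g = gcd n m"
    have g0: "0 < g" using n0 by (simp add: g_def)
    obtain n' m' where nm: "n = n' * g" "m = m' * g" and cop: "coprime n' m'"
      using gcd_coprime_exists[of n m] g0 unfolding g_def by blast
    have nm0: "1 \<le> n'" "1 \<le> m'" using nm n0 m0 by (auto simp: Suc_le_eq intro: gr0I)
    have Zeq: "int n' * X x l = int m' * Y x l" "X x \<in> freq_box D'" "Y x \<in> freq_box D" "X x l \<noteq> 0" "Y x l \<noteq> 0"
      and Zfst: "fst (fst x) = n" "fst (snd x) = m"
      if "x \<in> Z" for x l
    proof -
      obtain n1 \<xi> m1 \<eta> where x1: "x = ((n1, \<xi>), (m1, \<eta>))" by (metis surj_pair)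
      then have "n1 = n" "m1 = m" using that by (auto simp: Z_def p_def)
      then have x: "x = ((n, \<xi>), (m, \<eta>))" using x1 by simp
      show "fst (fst x) = n" "fst (snd x) = m" using x by auto
      have "int m * \<eta> l - int n * \<xi> l = 0" using that x
        by (auto simp: Z_def Q_def freq_diff_def dest: fun_cong[of _ _ l])
      then have e: "int g * (int m' * \<eta> l) = int g * (int n' * \<xi> l)" by (simp add: nm algebra_simps)
      then show "int n' * X x l = int m' * Y x l" using g0 by (simp add: x X_def Y_def)
      show "X x \<in> freq_box D'" "Y x \<in> freq_box D" "X x l \<noteq> 0"
        using that x by (auto simp: Z_def Q_def X_def Y_def freq_pairs_def)
      then show "Y x l \<noteq> 0" using e g0 nm0 by (auto simp: x X_def Y_def)
    qed
    have finZ: "finite Z" using finQ by (simp add: Z_def)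
    have injX: "inj_on X Z" 
    proof (rule inj_onI)
      fix x y assume *: "x \<in> Z" "y \<in> Z" "X x = X y"
      have "Y x = Y y"
      proof
        fix l
        have "int m' * Y x l = int m' * Y y l" using Zeq(1)[OF *(1)] Zeq(1)[OF *(2)] *(3) by metis
        then show "Y x l = Y y l" using nm0 by simp
      qed
      then show "x = y" using * Zfst[OF *(1)] Zfst[OF *(2)] by (auto simp: X_def Y_def prod_eq_iff)
    qed
    have injY: "inj_on Y Z" 
    proof (rule inj_onI)
      fix x y assume *: "x \<in> Z" "y \<in> Z" "Y x = Y y"
      have "X x = X y"
      proof
        fix l
        have "int n' * X x l = int n' * X y l" using Zeq(1)[OF *(1)] Zeq(1)[OF *(2)] *(3) by metis
        then show "X x l = X y l" using nm0 by simp
      qed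
      then show "x = y" using * Zfst[OF *(1)] Zfst[OF *(2)] by (auto simp: X_def Y_def prod_eq_iff)
    qed
    have dX: "int m' dvd X x l" if "x \<in> Z" for x l
    proof -
      have "int m' dvd int n' * X x l" using Zeq(1)[OF that] by simp
      then show ?thesis using cop by (simp add: coprime_dvd_mult_right_iff coprime_commute)
    qed
    have dY: "int n' dvd Y x l" if "x \<in> Z" for x l
    proof -
      have "int n' dvd int m' * Y x l" using Zeq(1)[OF that, symmetric] by simp
      then show ?thesis using cop by (simp add: coprime_dvd_mult_right_iff)
    qed
    have sX: "(\<Sum>x\<in>Z. (c' (X x))\<^sup>2) \<le> G' / real m' ^ CARD('n)"
    proof -
      have "(\<Sum>x\<in>Z. (c' (X x))\<^sup>2) = (\<Sum>\<xi>\<in>X ` Z. (c' \<xi>)\<^sup>2)" using injX by (simp add: sum.reindex)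
      also have "\<dots> \<le> (\<Sum>\<xi>\<in>{\<xi>\<in>freq_box D'. \<forall>l. \<xi> l \<noteq> 0 \<and> int m' dvd \<xi> l}. (c' \<xi>)\<^sup>2)"
        by (intro sum_mono2) (auto simp: Zeq dX)
      finally show ?thesis using G'[OF nm0(2)] by linarith
    qed
    have sY: "(\<Sum>x\<in>Z. (c (Y x))\<^sup>2) \<le> G / real n' ^ CARD('n)"
    proof -
      have "(\<Sum>x\<in>Z. (c (Y x))\<^sup>2) = (\<Sum>\<xi>\<in>Y ` Z. (c \<xi>)\<^sup>2)" using injY by (simp add: sum.reindex)
      also have "\<dots> \<le> (\<Sum>\<xi>\<in>{\<xi>\<in>freq_box D. \<forall>l. \<xi> l \<noteq> 0 \<and> int n' dvd \<xi> l}. (c \<xi>)\<^sup>2)"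
        by (intro sum_mono2) (auto simp: Zeq dY)
      finally show ?thesis using G[OF nm0(1)] by linarith
    qed
    define z where "z = 1 / (real n' * real m')"
    have z: "0 \<le> z" "z \<le> 1"
    proof -
      have "1 * 1 \<le> real n' * real m'" using nm0 by (intro mult_mono) auto
      then show "z \<le> 1" "0 \<le> z" by (auto simp: z_def)
    qed
    have "(sum h Z)\<^sup>2 = (\<Sum>x\<in>Z. c' (X x) * c (Y x))\<^sup>2"
      by (simp add: h_def X_def Y_def case_prod_beta)
    also have "\<dots> \<le> (\<Sum>x\<in>Z. (c' (X x))\<^sup>2) * (\<Sum>x\<in>Z. (c (Y x))\<^sup>2)"
      by (rule Cauchy_Schwarz_ineq_sum)
    also have "\<dots> \<le> (G' / real m' ^ CARD('n)) * (G / real n' ^ CARD('n))"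
      using sX sY G0 by (intro mult_mono) (auto intro!: sum_nonneg)
    also have "\<dots> = G * G' * z ^ CARD('n)"
      by (simp add: z_def power_mult_distrib power_divide mult.commute)
    also have "\<dots> \<le> G * G' * z ^ 2"
      using G0 k2 z by (intro mult_left_mono power_decreasing) auto
    also have "\<dots> = (sqrt (G * G') * z)\<^sup>2"
      using G0 by (simp add: power_mult_distrib)
    finally have "sum h Z \<le> sqrt (G * G') * z"
      by (rule power2_le_imp_le) (use z G0 in simp)
    also have "z \<le> real g ^ 2 / (real N' * real N)"
    proof -
      have "z = real g ^ 2 / (real n * real m)"
        using g0 by (simp add: z_def nm power2_eq_square)
      also have "\<dots> \<le> real g ^ 2 / (real N' * real N)"
        using n0 m0 N by (intro divide_left_mono mult_mono) auto
      finally show ?thesis .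
    qed
    then have "sqrt (G * G') * z \<le> sqrt (G * G') * (real g ^ 2 / (real N' * real N))"
      using G0 by (intro mult_left_mono) auto
    finally show ?thesis by (simp add: Z_def g_def)
  qed
  have "sum h Q = (\<Sum>y\<in>block N' \<times> block N. sum h {x\<in>Q. p x = y})"
    by (rule sum.group[OF finQ, symmetric]) (auto simp: Q_def p_def freq_pairs_def)
  also have "\<dots> = (\<Sum>n\<in>block N'. \<Sum>m\<in>block N. sum h {x\<in>Q. p x = (n, m)})"
    by (simp add: sum.cartesian_product)
  also have "\<dots> \<le> (\<Sum>n\<in>block N'. \<Sum>m\<in>block N. sqrt (G * G') / (real N' * real N) * real (gcd n m) ^ 2)"
    by (intro sum_mono one)
  also have "\<dots> = sqrt (G * G') / (real N' * real N) * (\<Sum>n\<in>block N'. \<Sum>m\<in>block N. real (gcd n m) ^ 2)"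
    by (simp add: sum_distrib_left)
  also have "\<dots> \<le> sqrt (G * G') / (real N' * real N) * (18 * real N' ^ 2 * real N)"
    using G0 by (intro mult_left_mono sum_gcd_square_le) auto
  also have "\<dots> = 18 * real N' * sqrt (G * G')"
    using N by (simp add: power2_eq_square)
  finally show ?thesis by (simp add: Q_def h_def)
qed

text \<open>Since m > 0, the equation determines \<eta>. Counting triples (n, m, \<xi>) therefore
  bounds the fibres of \<open>freq_diff\<close>.\<close>

lemma inj_on_freq_diff:
  assumes "1 \<le> N"
  shows "inj_on (\<lambda>(s, t). (fst s, fst t, snd s)) {(s, t). t \<in> freq_pairs N D \<and> freq_diff s t = \<zeta>}"
    (is "inj_on ?f ?S")
proof (rule inj_onI)
  fix x y assume *: "x \<in> ?S" "y \<in> ?S" "?f x = ?f y"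
  obtain n \<xi> m \<eta> where x: "x = ((n, \<xi>), (m, \<eta>))" by (metis surj_pair)
  obtain n' \<xi>' m' \<eta>' where y: "y = ((n', \<xi>'), (m', \<eta>'))" by (metis surj_pair)
  have eq: "n' = n" "m' = m" "\<xi>' = \<xi>" using *(3) by (auto simp: x y)
  have m0: "m > 0" using *(1) assms by (auto simp: x freq_pairs_def block_def)
  have fd: "freq_diff (n, \<xi>) (m, \<eta>) = \<zeta>" "freq_diff (n, \<xi>) (m, \<eta>') = \<zeta>"
    using *(1,2) by (simp_all add: x y eq)
  have "\<eta> l = \<eta>' l" for l
  proof -
    have "int m * \<eta> l - int n * \<xi> l = \<zeta> l" "int m * \<eta>' l - int n * \<xi> l = \<zeta> l"
      using fun_cong[OF fd(1), of l] fun_cong[OF fd(2), of l] by (simp_all add: freq_diff_def)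
    then have "int m * \<eta> l = int m * \<eta>' l" by linarith
    then show ?thesis using m0 by simp
  qed
  then show "x = y" by (auto simp: x y eq)
qed

text \<open>\<open>g\<close> stands for the absolute Fourier coefficients of the measure. The part
  of the diagonal without zero coordinates keeps its weights c' c, since replacing them by their
  maxima would lose the bound by the expectation; everywhere else the maxima S' S suffice, and only
  counts and the sum of \<open>g\<close> over a box remain.\<close>

lemma pair_sum_le:
  fixes c c' :: "('n::finite \<Rightarrow> int) \<Rightarrow> real" and g :: "('n \<Rightarrow> int) \<Rightarrow> real"
  assumes N: "1 \<le> N'" "N' \<le> N" and k2: "2 \<le> CARD('n)" and D: "1 \<le> D'"
    and G0: "0 \<le> G" "0 \<le> G'"
    and G': "\<And>q. 1 \<le> q \<Longrightarrow> (\<Sum>\<xi>\<in>{\<xi>\<in>freq_box D'. \<forall>l. \<xi> l \<noteq> 0 \<and> int q dvd \<xi> l}. (c' \<xi>)\<^sup>2) \<le> G' / real q ^ CARD('n)"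
    and G: "\<And>q. 1 \<le> q \<Longrightarrow> (\<Sum>\<xi>\<in>{\<xi>\<in>freq_box D. \<forall>l. \<xi> l \<noteq> 0 \<and> int q dvd \<xi> l}. (c \<xi>)\<^sup>2) \<le> G / real q ^ CARD('n)"
    and c': "\<And>\<xi>. \<xi> \<in> freq_box D' \<Longrightarrow> 0 \<le> c' \<xi> \<and> c' \<xi> \<le> S'"
    and c: "\<And>\<xi>. \<xi> \<in> freq_box D \<Longrightarrow> 0 \<le> c \<xi> \<and> c \<xi> \<le> S"
    and g: "\<And>\<zeta>. 0 \<le> g \<zeta>" "\<And>\<zeta>. g \<zeta> \<le> 1" "(\<Sum>\<zeta>\<in>freq_box Q. g \<zeta>) \<le> \<Gamma>"
    and Q: "2 * N * D + 2 * N' * D' \<le> Q"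
    and T: "\<And>u::int. u \<noteq> 0 \<Longrightarrow> \<bar>u\<bar> \<le> int Q + 2 * int N' * int D' \<Longrightarrow> real (card {d::nat. int d dvd u}) \<le> T"
    and T0: "0 \<le> T"
  shows "(\<Sum>s\<in>freq_pairs N' D'. \<Sum>t\<in>freq_pairs N D. c' (snd s) * c (snd t) * g (freq_diff s t))
    \<le> 18 * real N' * sqrt (G * G')
      + S' * S * axis_bound CARD('n) T (real D') (real N')
      + S' * S * offdiag_bound CARD('n) T (real D') (real N') * \<Gamma>"
proof -
  define h where "h = (\<lambda>(s :: nat \<times> ('n \<Rightarrow> int), t :: nat \<times> ('n \<Rightarrow> int)). c' (snd s) * c (snd t) * g (freq_diff s t))"
  define A where "A = (freq_pairs N' D' :: (nat \<times> ('n \<Rightarrow> int)) set) \<times> (freq_pairs N D :: (nat \<times> ('n \<Rightarrow> int)) set)"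
  \<comment> \<open>On the diagonal \<xi> and \<eta> vanish in the same coordinates, so the split
    needs to look at \<open>snd s\<close> only.\<close>
  define QA where "QA = {(s, t). s \<in> freq_pairs N' D' \<and> t \<in> freq_pairs N D \<and> (\<forall>l. snd s l \<noteq> 0) \<and> freq_diff s t = (\<lambda>_::'n. 0)}"
  define QB where "QB = {(s, t). s \<in> freq_pairs N' D' \<and> t \<in> freq_pairs N D \<and> (\<exists>l. snd s l = 0) \<and> freq_diff s t = (\<lambda>_::'n. 0)}"
  define QC where "QC = {(s, t). s \<in> freq_pairs N' D' \<and> t \<in> freq_pairs N D \<and> freq_diff s t \<noteq> (\<lambda>_::'n. 0)}"
  have finA: "finite A" by (simp add: A_def)
  have fin: "finite QA" "finite QB" "finite QC"
    by (rule finite_subset[OF _ finA], auto simp: A_def QA_def QB_def QC_def)+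
  have A: "A = QA \<union> (QB \<union> QC)" by (auto simp: A_def QA_def QB_def QC_def)
  have sums: "sum h A = sum h QA + (sum h QB + sum h QC)"
  proof -
    have "sum h (QA \<union> (QB \<union> QC)) = sum h QA + sum h (QB \<union> QC)"
      using fin by (intro sum.union_disjoint) (auto simp: QA_def QB_def QC_def)
    also have "sum h (QB \<union> QC) = sum h QB + sum h QC"
      using fin by (intro sum.union_disjoint) (auto simp: QB_def QC_def)
    finally show ?thesis by (simp add: A)
  qed
  have S0: "0 \<le> S'" "0 \<le> S"
    using c'[of "\<lambda>_. 0"] c[of "\<lambda>_. 0"] by (auto simp: freq_box_def)
  have hle: "h (s, t) \<le> S' * S * g (freq_diff s t)" and hle1: "h (s, t) \<le> c' (snd s) * c (snd t)"
    if "s \<in> freq_pairs N' D'" "t \<in> freq_pairs N D" for s t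
  proof -
    have cc: "0 \<le> c' (snd s)" "c' (snd s) \<le> S'" "0 \<le> c (snd t)" "c (snd t) \<le> S"
      using that c' c by (auto simp: freq_pairs_def)
    show "h (s, t) \<le> S' * S * g (freq_diff s t)"
      unfolding h_def prod.case using cc g S0 by (intro mult_right_mono mult_mono) auto
    show "h (s, t) \<le> c' (snd s) * c (snd t)"
      unfolding h_def prod.case using cc g by (intro mult_left_le) auto
  qed
  have hA: "sum h QA \<le> 18 * real N' * sqrt (G * G')"
  proof -
    have "sum h QA \<le> (\<Sum>(s, t)\<in>QA. c' (snd s) * c (snd t))"
      by (intro sum_mono) (auto simp: QA_def intro: hle1)
    also have "\<dots> \<le> 18 * real N' * sqrt (G * G')"
      unfolding QA_def using N by (intro pair_sum_diagonal k2 G0 G G') auto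
    finally show ?thesis .
  qed
  have hB: "sum h QB \<le> S' * S * axis_bound CARD('n) T (real D') (real N')"
  proof -
    define E where "E = {(n, m, \<xi> :: 'n \<Rightarrow> int). n \<in> block N' \<and> m \<in> block N \<and> \<xi> \<in> freq_box D' \<and>
      (\<exists>l. \<xi> l = 0) \<and> (\<exists>l. \<xi> l \<noteq> 0) \<and> (\<forall>l. int m dvd int n * \<xi> l)}"
    have finE: "finite E"
      by (rule finite_subset[of _ "block N' \<times> block N \<times> freq_box D'"]) (auto simp: E_def)
    have "card QB \<le> card E"
    proof (rule card_inj_on_le[OF _ _ finE])
      let ?f = "\<lambda>(s :: nat \<times> ('n \<Rightarrow> int), t :: nat \<times> ('n \<Rightarrow> int)). (fst s, fst t, snd s)"
      show "inj_on ?f QB"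
        by (rule inj_on_subset[OF inj_on_freq_diff[of N D "\<lambda>_. 0"]]) (use N in \<open>auto simp: QB_def\<close>)
      show "?f ` QB \<subseteq> E"
      proof
        fix e assume "e \<in> ?f ` QB"
        then obtain n \<xi> m \<eta> where x: "((n, \<xi>), (m, \<eta>)) \<in> QB" "e = (n, m, \<xi>)" by auto
        have "int m dvd int n * \<xi> l" for l
        proof -
          have "int n * \<xi> l = int m * \<eta> l"
            using x unfolding QB_def freq_diff_def by (auto dest: fun_cong[of _ _ l])
          then show ?thesis by simp
        qed
        then show "e \<in> E" using x by (auto simp: QB_def E_def freq_pairs_def)
      qed
    qed
    also have "real (card E) \<le> axis_bound CARD('n) T (real D') (real N')"
      unfolding E_def by (rule count_axis[OF T]) (use D T0 in auto)
    finally have cB: "real (card QB) \<le> axis_bound CARD('n) T (real D') (real N')" by simp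
    have "sum h QB \<le> (\<Sum>x\<in>QB. S' * S)"
    proof (rule sum_mono)
      fix x assume "x \<in> QB"
      then obtain s t where x: "x = (s, t)" "s \<in> freq_pairs N' D'" "t \<in> freq_pairs N D"
        by (auto simp: QB_def)
      have "S' * S * g (freq_diff s t) \<le> S' * S" using S0 g by (intro mult_left_le) auto
      then show "h x \<le> S' * S" using hle[OF x(2,3)] x by simp
    qed
    also have "\<dots> = S' * S * real (card QB)" by simp
    also have "\<dots> \<le> S' * S * axis_bound CARD('n) T (real D') (real N')"
      using S0 by (intro mult_left_mono cB) auto
    finally show ?thesis .
  qed
  define B where "B = offdiag_bound CARD('n) T (real D') (real N')"
  have B0: "0 \<le> B" using T0 by (simp add: B_def offdiag_bound_def)
  have hC: "sum h QC \<le> S' * S * B * \<Gamma>"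
  proof -
    define z where "z = (\<lambda>(s :: nat \<times> ('n \<Rightarrow> int), t). freq_diff s t)"
    have zbox: "z x \<in> freq_box Q" if "x \<in> QC" for x
    proof -
      obtain n \<xi> m \<eta> where x: "x = ((n, \<xi>), (m, \<eta>))" by (metis surj_pair)
      have "\<bar>int m * \<eta> l - int n * \<xi> l\<bar> \<le> int Q" for l
      proof -
        have "\<bar>int m\<bar> * \<bar>\<eta> l\<bar> \<le> int (2 * N) * int D" "\<bar>int n\<bar> * \<bar>\<xi> l\<bar> \<le> int (2 * N') * int D'"
          using that by (auto simp: x QC_def freq_pairs_def block_def freq_box_def intro!: mult_mono)
        then have "\<bar>int m * \<eta> l\<bar> \<le> int (2 * N * D)" "\<bar>int n * \<xi> l\<bar> \<le> int (2 * N' * D')"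
          by (simp_all add: abs_mult)
        moreover have "int (2 * N * D) + int (2 * N' * D') \<le> int Q" using Q by linarith
        ultimately show ?thesis by linarith
      qed
      then show ?thesis by (simp add: z_def x freq_diff_def freq_box_def)
    qed
    have cC: "real (card {x\<in>QC. z x = \<zeta>}) \<le> B" if \<zeta>: "\<zeta> \<in> freq_box Q" for \<zeta>
    proof (cases "\<exists>l. \<zeta> l \<noteq> 0")
      case False
      then have "\<zeta> = (\<lambda>_. 0)" by auto
      then have em: "{x\<in>QC. z x = \<zeta>} = {}" by (auto simp: QC_def z_def)
      show ?thesis unfolding em using B0 by simp
    next
      case True
      define E where "E = {(n, m, \<xi> :: 'n \<Rightarrow> int). n \<in> block N' \<and> m \<in> block N \<and> \<xi> \<in> freq_box D' \<and>
      (\<exists>\<eta>. (\<exists>l. \<eta> l \<noteq> 0) \<and> (\<forall>l. int m * \<eta> l = \<zeta> l + int n * \<xi> l))}"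
      have finE: "finite E"
        by (rule finite_subset[of _ "block N' \<times> block N \<times> freq_box D'"]) (auto simp: E_def)
      have "card {x\<in>QC. z x = \<zeta>} \<le> card E"
      proof (rule card_inj_on_le[OF _ _ finE])
        let ?f = "\<lambda>(s :: nat \<times> ('n \<Rightarrow> int), t :: nat \<times> ('n \<Rightarrow> int)). (fst s, fst t, snd s)"
        show "inj_on ?f {x\<in>QC. z x = \<zeta>}"
          by (rule inj_on_subset[OF inj_on_freq_diff[of N D \<zeta>]]) (use N in \<open>auto simp: QC_def z_def\<close>)
        show "?f ` {x\<in>QC. z x = \<zeta>} \<subseteq> E"
        proof
          fix e assume "e \<in> ?f ` {x\<in>QC. z x = \<zeta>}"
          then obtain n \<xi> m \<eta> where x: "((n, \<xi>), (m, \<eta>)) \<in> QC" "z ((n, \<xi>), (m, \<eta>)) = \<zeta>" "e = (n, m, \<xi>)" by auto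
          have "int m * \<eta> l = \<zeta> l + int n * \<xi> l" for l
            using x(2) by (auto simp: z_def freq_diff_def)
          moreover have "\<exists>l. \<eta> l \<noteq> 0" using x(1) by (auto simp: QC_def freq_pairs_def)
          ultimately show "e \<in> E" using x(1,3) by (auto simp: QC_def E_def freq_pairs_def)
        qed
      qed
      also have "real (card E) \<le> B"
        unfolding E_def B_def
      proof (rule count_offdiag[OF N D k2 True T])
        show "\<bar>\<zeta> l\<bar> + 2 * int N' * int D' \<le> int Q + 2 * int N' * int D'" for l
          using \<zeta> by (simp add: freq_box_def)
      qed
      finally show ?thesis by simp
    qed
    have "sum h QC \<le> (\<Sum>x\<in>QC. S' * S * g (z x))"
      by (intro sum_mono) (auto simp: QC_def z_def intro: hle)
    also have "\<dots> = (\<Sum>\<zeta>\<in>freq_box Q. \<Sum>x\<in>{x\<in>QC. z x = \<zeta>}. S' * S * g (z x))"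
      by (rule sum.group[OF fin(3), symmetric]) (use zbox in auto)
    also have "\<dots> = (\<Sum>\<zeta>\<in>freq_box Q. S' * S * g \<zeta> * real (card {x\<in>QC. z x = \<zeta>}))"
      by (intro sum.cong refl) simp
    also have "\<dots> \<le> (\<Sum>\<zeta>\<in>freq_box Q. S' * S * g \<zeta> * B)"
      using S0 g by (intro sum_mono mult_left_mono cC) auto
    also have "\<dots> = S' * S * B * (\<Sum>\<zeta>\<in>freq_box Q. g \<zeta>)"
      by (simp add: sum_distrib_left mult_ac)
    also have "\<dots> \<le> S' * S * B * \<Gamma>"
      using S0 B0 g by (intro mult_left_mono) auto
    finally show ?thesis .
  qed
  have "(\<Sum>s\<in>freq_pairs N' D'. \<Sum>t\<in>freq_pairs N D. c' (snd s) * c (snd t) * g (freq_diff s t)) = sum h A"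
    unfolding A_def h_def by (simp add: sum.cartesian_product)
  then show ?thesis using hA hB hC sums unfolding B_def by linarith
qed

section \<open>Second moments\<close>

lemma fourier_coeff_minus:
  "norm (fourier_coeff \<mu> (- \<xi>)) = norm (fourier_coeff \<mu> \<xi>)" for \<mu> :: "(real ^ 'n::finite) measure"
proof -
  have "fourier_coeff \<mu> (- \<xi>) = cnj (fourier_coeff \<mu> \<xi>)"
  proof -
    have "fourier_coeff \<mu> (- \<xi>) = (\<integral>x. cnj (cis (- 2 * pi * (\<Sum>j\<in>UNIV. of_int (\<xi> $ j) * x $ j))) \<partial>\<mu>)"
      unfolding fourier_coeff_def
      by (intro Bochner_Integration.integral_cong refl) (simp add: cis_cnj sum_negf)
    also have "\<dots> = cnj (fourier_coeff \<mu> \<xi>)"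
      unfolding fourier_coeff_def by (rule Bochner_Integration.integral_cnj)
    finally show ?thesis .
  qed
  then show ?thesis by simp
qed

lemma norm_fourier_coeff_le_1:
  fixes \<mu> :: "(real ^ 'n::finite) measure"
  assumes "prob_space \<mu>"
  shows "norm (fourier_coeff \<mu> \<xi>) \<le> 1"
proof -
  interpret prob_space \<mu> by fact
  have "norm (fourier_coeff \<mu> \<xi>) \<le> (\<integral>x. norm (cis (- 2 * pi * (\<Sum>j\<in>UNIV. of_int (\<xi> $ j) * x $ j))) \<partial>\<mu>)"
    unfolding fourier_coeff_def by (rule integral_norm_bound)
  also have "\<dots> = 1" by (simp add: prob_space)
  finally show ?thesis .
qed

lemma integrable_bounded_borel:
  fixes f :: "(real ^ 'n::finite) \<Rightarrow> 'b::{banach, second_countable_topology}"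
  assumes "prob_space \<mu>" "sets \<mu> = sets borel" "f \<in> borel_measurable borel" "\<And>x. norm (f x) \<le> B"
  shows "integrable \<mu> f"
proof -
  interpret prob_space \<mu> by fact
  have "f \<in> borel_measurable \<mu>" using assms(3) by (simp add: measurable_cong_sets[OF assms(2) refl])
  then show ?thesis using assms(4) by (intro integrable_const_bound[of _ B]) auto
qed

text \<open>Opening the square gives characters whose integrals are Fourier coefficients at
  differences of frequencies. Only absolute values are kept, so the inhomogeneous shift, a
  unimodular factor of \<open>w\<close>, disappears here.\<close>

lemma trig_sum_square_integral_le:
  fixes \<mu> :: "(real ^ 'n::finite) measure" and \<theta> :: "'i \<Rightarrow> 'n \<Rightarrow> int" and w :: "'i \<Rightarrow> complex"
  assumes \<mu>: "prob_space \<mu>" "sets \<mu> = sets borel" and fin: "finite I"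
  shows "(\<integral>x. (norm (\<Sum>i\<in>I. w i * ee (\<Sum>l\<in>UNIV. of_int (\<theta> i l) * x $ l)))\<^sup>2 \<partial>\<mu>)
    \<le> (\<Sum>i\<in>I. \<Sum>j\<in>I. norm (w i) * norm (w j) * norm (fourier_coeff \<mu> (\<chi> l. \<theta> j l - \<theta> i l)))"
proof -
  define e where "e = (\<lambda>i x. ee (\<Sum>l\<in>UNIV. of_int (\<theta> i l) * x $ l))"
  define F where "F = (\<lambda>i j x. w i * cnj (w j) * cis (- 2 * pi * (\<Sum>l\<in>UNIV. of_int ((\<chi> l. \<theta> j l - \<theta> i l) $ l) * x $ l)))"
  have pt: "of_real ((norm (\<Sum>i\<in>I. w i * e i x))\<^sup>2) = (\<Sum>i\<in>I. \<Sum>j\<in>I. F i j x)" for x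
  proof -
    have "of_real ((norm (\<Sum>i\<in>I. w i * e i x))\<^sup>2) = (\<Sum>i\<in>I. \<Sum>j\<in>I. (w i * e i x) * cnj (w j * e j x))"
      unfolding complex_norm_square cnj_sum sum_product ..
    also have "\<dots> = (\<Sum>i\<in>I. \<Sum>j\<in>I. F i j x)"
    proof (intro sum.cong refl)
      fix i j
      have "e i x * cnj (e j x) = ee ((\<Sum>l\<in>UNIV. of_int (\<theta> i l) * x $ l) - (\<Sum>l\<in>UNIV. of_int (\<theta> j l) * x $ l))"
        by (simp add: e_def cnj_ee flip: ee_add)
      also have "\<dots> = cis (- 2 * pi * (\<Sum>l\<in>UNIV. of_int ((\<chi> l. \<theta> j l - \<theta> i l) $ l) * x $ l))"
        unfolding ee_def by (simp add: sum_subtractf algebra_simps)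
      finally show "(w i * e i x) * cnj (w j * e j x) = F i j x"
        by (simp add: F_def mult_ac)
    qed
    finally show ?thesis .
  qed
  have intF: "integrable \<mu> (F i j)" for i j
  proof (rule integrable_bounded_borel[OF \<mu>])
    have "continuous_on UNIV (F i j)" unfolding F_def
      by (intro continuous_intros)
    then show "F i j \<in> borel_measurable borel" by (rule borel_measurable_continuous_onI)
    show "norm (F i j x) \<le> norm (w i * cnj (w j))" for x by (simp add: F_def norm_mult)
  qed
  have "of_real (\<integral>x. (norm (\<Sum>i\<in>I. w i * e i x))\<^sup>2 \<partial>\<mu>) = (\<integral>x. (\<Sum>i\<in>I. \<Sum>j\<in>I. F i j x) \<partial>\<mu>)"
    unfolding pt[symmetric] by (rule integral_complex_of_real[symmetric])
  also have "\<dots> = (\<Sum>i\<in>I. \<Sum>j\<in>I. w i * cnj (w j) * fourier_coeff \<mu> (\<chi> l. \<theta> j l - \<theta> i l))"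
    using intF by (simp add: Bochner_Integration.integral_sum F_def fourier_coeff_def del: vec_lambda_beta)
  finally have eq: "complex_of_real (\<integral>x. (norm (\<Sum>i\<in>I. w i * e i x))\<^sup>2 \<partial>\<mu>)
     = (\<Sum>i\<in>I. \<Sum>j\<in>I. w i * cnj (w j) * fourier_coeff \<mu> (\<chi> l. \<theta> j l - \<theta> i l))" .
  have "(\<integral>x. (norm (\<Sum>i\<in>I. w i * e i x))\<^sup>2 \<partial>\<mu>) \<le> norm (complex_of_real (\<integral>x. (norm (\<Sum>i\<in>I. w i * e i x))\<^sup>2 \<partial>\<mu>))"
    by simp
  also have "\<dots> \<le> (\<Sum>i\<in>I. \<Sum>j\<in>I. norm (w i) * norm (w j) * norm (fourier_coeff \<mu> (\<chi> l. \<theta> j l - \<theta> i l)))"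
    unfolding eq by (intro sum_norm_le order_trans[OF norm_sum] sum_mono) (simp add: norm_mult)
  finally show ?thesis by (simp add: e_def)
qed

section \<open>From a linear variance bound to almost sure divergence\<close>

lemma filterlim_partial_sums_at_top:
  fixes e :: "nat \<Rightarrow> real"
  assumes nn: "\<And>i. 0 \<le> e i" and div: "\<not> summable e"
  shows "filterlim (\<lambda>X. \<Sum>i<X. e i) at_top sequentially"
proof (rule ccontr)
  have inc: "mono (\<lambda>X. \<Sum>i<X. e i)" by (intro monoI sum_mono2) (auto simp: nn)
  assume "\<not> ?thesis"
  then obtain Z where Z: "\<not> eventually (\<lambda>X. Z \<le> (\<Sum>i<X. e i)) sequentially"
    by (auto simp: filterlim_at_top)
  have "(\<Sum>i<X. e i) \<le> Z" for X
  proof (rule ccontr)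
    assume "\<not> (\<Sum>i<X. e i) \<le> Z"
    then have "Z \<le> (\<Sum>i<Y. e i)" if "Y \<ge> X" for Y
      using monoD[OF inc that] by linarith
    then show False using Z by (auto simp: eventually_sequentially)
  qed
  then have "summable e" using nn by (intro summableI_nonneg_bounded[of _ Z]) auto
  then show False using div by blast
qed

text \<open>If the series stays below K, the deviation at X is at least E X - K in absolute value.
  By Chebyshev this has probability O((1 + E X)/(E X - K)^2), which tends to 0 precisely because the
  variance grows linearly. The centring \<open>e i\<close> will be the Lebesgue mean, so the second
  moment also accounts for the bias of the measure.\<close>

lemma (in prob_space) AE_not_summable_of_variance:
  fixes f :: "nat \<Rightarrow> 'a \<Rightarrow> real" and e :: "nat \<Rightarrow> real"
  assumes f_meas [measurable]: "\<And>i. f i \<in> borel_measurable M"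
    and f0: "\<And>i x. 0 \<le> f i x"
    and e0: "\<And>i. 0 \<le> e i" and div: "\<not> summable e"
    and int: "\<And>X. integrable M (\<lambda>x. (\<Sum>i<X. f i x - e i)\<^sup>2)"
    and var: "\<And>X. (\<integral>x. (\<Sum>i<X. f i x - e i)\<^sup>2 \<partial>M) \<le> C * (1 + (\<Sum>i<X. e i))"
  shows "AE x in M. \<not> summable (\<lambda>i. f i x)"
proof -
  define E where "E X = (\<Sum>i<X. e i)" for X
  have Elim: "filterlim E at_top sequentially"
    unfolding E_def using filterlim_partial_sums_at_top[OF e0 div] .
  define B where "B K = {x \<in> space M. \<forall>X. (\<Sum>i<X. f i x) \<le> real K}" for K :: nat
  have Bm [measurable]: "B K \<in> sets M" for K unfolding B_def by measurable
  have B0: "prob (B K) = 0" for K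
  proof -
    have "eventually (\<lambda>X. prob (B K) \<le> C * (1 + E X) / (E X - K)\<^sup>2) sequentially"
    proof -
      have "eventually (\<lambda>X. E X \<ge> real K + 1) sequentially"
        using Elim by (simp add: filterlim_at_top)
      then show ?thesis
      proof eventually_elim
        case (elim X)
        have pos: "0 < (E X - K)\<^sup>2" using elim by simp
        have "B K \<subseteq> {x \<in> space M. (E X - K)\<^sup>2 \<le> (\<Sum>i<X. f i x - e i)\<^sup>2}"
        proof
          fix x assume x: "x \<in> B K"
          have "(\<Sum>i<X. f i x - e i) = (\<Sum>i<X. f i x) - E X" by (simp add: E_def sum_subtractf)
          moreover have "(\<Sum>i<X. f i x) \<le> real K" using x by (simp add: B_def)
          ultimately have "E X - K \<le> - (\<Sum>i<X. f i x - e i)" by linarith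
          then have "(E X - K)\<^sup>2 \<le> (- (\<Sum>i<X. f i x - e i))\<^sup>2"
            using elim by (intro power_mono) auto
          then show "x \<in> {x \<in> space M. (E X - K)\<^sup>2 \<le> (\<Sum>i<X. f i x - e i)\<^sup>2}"
            using x by (simp add: B_def)
        qed
        then have "prob (B K) \<le> prob {x \<in> space M. (E X - K)\<^sup>2 \<le> (\<Sum>i<X. f i x - e i)\<^sup>2}"
          by (intro finite_measure_mono) auto
        also have "\<dots> \<le> (\<integral>x. (\<Sum>i<X. f i x - e i)\<^sup>2 \<partial>M) / (E X - K)\<^sup>2"
          by (rule integral_Markov_inequality_measure[OF int, of "{}"]) (use pos in auto)
        also have "\<dots> \<le> C * (1 + E X) / (E X - K)\<^sup>2"
          using var[of X] pos by (intro divide_right_mono) (auto simp: E_def)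
        finally show ?case .
      qed
    qed
    moreover have "((\<lambda>X. C * (1 + E X) / (E X - K)\<^sup>2) \<longlongrightarrow> 0) sequentially"
    proof -
      have "((\<lambda>t::real. C * (1 + t) / (t - K)\<^sup>2) \<longlongrightarrow> 0) at_top" by real_asymp
      from filterlim_compose[OF this Elim] show ?thesis .
    qed
    ultimately have "prob (B K) \<le> 0"
      by (intro tendsto_lowerbound[of _ 0 sequentially "prob (B K)"]) auto
    then show ?thesis using measure_nonneg[of M "B K"] by linarith
  qed
  have "AE x in M. x \<notin> B K" for K
    using B0[of K] by (intro AE_not_in) (auto simp: null_sets_def emeasure_eq_measure)
  then have "AE x in M. \<forall>K. x \<notin> B K" by (simp add: AE_all_countable)
  then show ?thesis
  proof (rule AE_mp, intro AE_I2 impI)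
    fix x assume x: "x \<in> space M" "\<forall>K. x \<notin> B K"
    show "\<not> summable (\<lambda>i. f i x)"
    proof
      assume s: "summable (\<lambda>i. f i x)"
      have "(\<Sum>i<X. f i x) \<le> real (nat \<lceil>\<Sum>i. f i x\<rceil>)" for X
      proof -
        have "(\<Sum>i<X. f i x) \<le> (\<Sum>i. f i x)" using s f0 by (intro sum_le_suminf) auto
        then show ?thesis by linarith
      qed
      then show False using x by (auto simp: B_def)
    qed
  qed
qed

lemma geometric_sum_le:
  fixes r :: real
  assumes "0 \<le> r" "r < 1" "finite I"
  shows "(\<Sum>i\<in>I. r ^ i) \<le> 1 / (1 - r)"
proof -
  have "(\<Sum>i\<in>I. r ^ i) \<le> (\<Sum>i. r ^ i)" using assms by (intro sum_le_suminf summable_geometric) auto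
  also have "\<dots> = 1 / (1 - r)" using assms by (intro suminf_geometric) auto
  finally show ?thesis .
qed

text \<open>The decay r^(j - i) means that each \<open>e i\<close> is counted boundedly often, hence
  the linear bound. The error terms sum to a constant because level j meets only j + 1 levels i
  \<le> j.\<close>

lemma symmetric_double_sum_le:
  fixes V :: "nat \<Rightarrow> nat \<Rightarrow> real" and e :: "nat \<Rightarrow> real"
  assumes sym: "\<And>i j. V i j = V j i"
    and V: "\<And>i j. i \<le> j \<Longrightarrow> V i j \<le> a * r ^ (j - i) * (e i + e j) + C * q ^ j"
    and nn: "0 \<le> a" "0 \<le> C" "\<And>i. 0 \<le> e i" and r: "0 \<le> r" "r < 1" and q: "0 < q" "q < 1"
  shows "\<exists>B. \<forall>X. (\<Sum>i<X. \<Sum>j<X. V i j) \<le> B * (1 + (\<Sum>i<X. e i))"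
proof -
  define W where "W i j = a * r ^ (j - i) * (e i + e j) + C * q ^ j" for i j :: nat
  have W0: "0 \<le> W i j" for i j unfolding W_def using nn r q by auto
  define H where "H = (\<Sum>j. real (Suc j) * q ^ j)"
  have sumH: "summable (\<lambda>j. real (Suc j) * q ^ j)"
    using q geometric_deriv_sums[of q] by (simp add: sums_iff)
  note geo = geometric_sum_le[OF r]
  have half: "(\<Sum>j<X. \<Sum>i\<le>j. W i j) \<le> 2 * a / (1 - r) * (\<Sum>i<X. e i) + C * H" for X
  proof -
    have s1: "(\<Sum>j<X. \<Sum>i\<le>j. r ^ (j - i) * e j) \<le> 1 / (1 - r) * (\<Sum>i<X. e i)"
    proof -
      have "(\<Sum>i\<le>j. r ^ (j - i)) \<le> 1 / (1 - r)" for j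
      proof -
        have "(\<Sum>i\<le>j. r ^ (j - i)) = (\<Sum>i\<le>j. r ^ i)"
          by (rule sum.reindex_bij_witness[of _ "\<lambda>i. j - i" "\<lambda>i. j - i"]) auto
        then show ?thesis using geo[of "{..j}"] by simp
      qed
      then have "(\<Sum>j<X. (\<Sum>i\<le>j. r ^ (j - i)) * e j) \<le> (\<Sum>j<X. 1 / (1 - r) * e j)"
        using nn by (intro sum_mono mult_right_mono) auto
      then show ?thesis by (simp add: sum_distrib_right sum_divide_distrib)
    qed
    have s2: "(\<Sum>j<X. \<Sum>i\<le>j. r ^ (j - i) * e i) \<le> 1 / (1 - r) * (\<Sum>i<X. e i)"
    proof -
      have "(\<Sum>j<X. \<Sum>i\<le>j. r ^ (j - i) * e i) = (\<Sum>j<X. \<Sum>i<X. if i \<le> j then r ^ (j - i) * e i else 0)"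
        by (intro sum.cong refl sum.mono_neutral_cong_left) auto
      also have "\<dots> = (\<Sum>i<X. \<Sum>j<X. if i \<le> j then r ^ (j - i) * e i else 0)" by (rule sum.swap)
      also have "\<dots> = (\<Sum>i<X. \<Sum>j\<in>{i..<X}. r ^ (j - i) * e i)"
        by (intro sum.cong refl sum.mono_neutral_cong_right) auto
      also have "\<dots> \<le> (\<Sum>i<X. 1 / (1 - r) * e i)"
      proof (intro sum_mono)
        fix i
        have "(\<Sum>j\<in>{i..<X}. r ^ (j - i)) \<le> 1 / (1 - r)"
        proof -
          have "(\<Sum>j\<in>{i..<X}. r ^ (j - i)) = (\<Sum>m\<in>{..<X - i}. r ^ m)"
            by (rule sum.reindex_bij_witness[of _ "\<lambda>m. m + i" "\<lambda>j. j - i"]) auto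
          then show ?thesis using geo[of "{..<X - i}"] by simp
        qed
        then have "(\<Sum>j\<in>{i..<X}. r ^ (j - i)) * e i \<le> 1 / (1 - r) * e i"
          using nn by (intro mult_right_mono) auto
        then show "(\<Sum>j\<in>{i..<X}. r ^ (j - i) * e i) \<le> 1 / (1 - r) * e i" by (simp add: sum_distrib_right)
      qed
      finally show ?thesis by (simp add: sum_divide_distrib)
    qed
    have s3: "(\<Sum>j<X. \<Sum>i\<le>j. q ^ j) \<le> H"
      unfolding H_def using sum_le_suminf[OF sumH, of "{..<X}"] q by simp
    have "(\<Sum>j<X. \<Sum>i\<le>j. W i j) = a * (\<Sum>j<X. \<Sum>i\<le>j. r ^ (j - i) * e i) + a * (\<Sum>j<X. \<Sum>i\<le>j. r ^ (j - i) * e j)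
        + C * (\<Sum>j<X. \<Sum>i\<le>j. q ^ j)"
    proof -
      have "W i j = (a * (r ^ (j - i) * e i) + a * (r ^ (j - i) * e j)) + C * q ^ j" for i j
        by (simp add: W_def algebra_simps)
      then show ?thesis by (simp only: sum.distrib sum_distrib_left[symmetric])
    qed
    also have "\<dots> \<le> a * (1 / (1 - r) * (\<Sum>i<X. e i)) + a * (1 / (1 - r) * (\<Sum>i<X. e i)) + C * H"
      using nn s1 s2 s3 by (intro add_mono mult_left_mono) auto
    finally show ?thesis by simp
  qed
  have main: "(\<Sum>i<X. \<Sum>j<X. V i j) \<le> 2 * (2 * a / (1 - r) * (\<Sum>i<X. e i) + C * H)" for X
  proof -
    \<comment> \<open>The diagonal is counted in both halves, which is harmless since
      \<open>W\<close> is nonnegative.\<close>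
    have "(\<Sum>i<X. \<Sum>j<X. V i j) \<le> (\<Sum>i<X. \<Sum>j<X. (if i \<le> j then W i j else 0) + (if j \<le> i then W j i else 0))"
    proof (intro sum_mono)
      fix i j show "V i j \<le> (if i \<le> j then W i j else 0) + (if j \<le> i then W j i else 0)"
        using V[of i j] V[of j i] sym[of i j] W0[of i j] W0[of j i]
        by (cases "i \<le> j"; cases "j \<le> i") (auto simp: W_def)
    qed
    also have "\<dots> = (\<Sum>i<X. \<Sum>j<X. if i \<le> j then W i j else 0) + (\<Sum>i<X. \<Sum>j<X. if j \<le> i then W j i else 0)"
      by (simp add: sum.distrib)
    also have "(\<Sum>i<X. \<Sum>j<X. if i \<le> j then W i j else 0) = (\<Sum>j<X. \<Sum>i<X. if i \<le> j then W i j else 0)"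
      by (rule sum.swap)
    also have "(\<Sum>j<X. \<Sum>i<X. if i \<le> j then W i j else 0) = (\<Sum>j<X. \<Sum>i\<le>j. W i j)"
      by (intro sum.cong refl sum.mono_neutral_cong_right) auto
    finally show ?thesis using half[of X] by simp
  qed
  define B where "B = max (4 * a / (1 - r)) (2 * C * H)"
  show ?thesis
  proof (rule exI[of _ B], intro allI)
    fix X
    have E0: "0 \<le> (\<Sum>i<X. e i)" using nn by (simp add: sum_nonneg)
    have "(\<Sum>i<X. \<Sum>j<X. V i j) \<le> (4 * a / (1 - r)) * (\<Sum>i<X. e i) + 2 * C * H"
      using main[of X] by simp
    also have "\<dots> \<le> B * (\<Sum>i<X. e i) + B"
      using E0 by (intro add_mono mult_right_mono) (auto simp: B_def)
    finally show "(\<Sum>i<X. \<Sum>j<X. V i j) \<le> B * (1 + (\<Sum>i<X. e i))" by (simp add: algebra_simps)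
  qed
qed

section \<open>The exponents\<close>

text \<open>The slack is 1/k in the axis term and \<kappa> in the off-diagonal term. Half of it pays
  for all \<epsilon>-losses, which explains the two upper bounds on \<epsilon>; the other half is
  the saving \<delta>.\<close>

lemma error_terms_bound:
  fixes k p :: nat and \<sigma> \<kappa> \<epsilon> h K C\<^sub>\<tau> C\<^sub>\<mu> :: real
  assumes k2: "2 \<le> k" and \<sigma>: "0 \<le> \<sigma>" "\<sigma> \<le> (real k - 1) / (real k + 1) - \<kappa>" and \<kappa>: "0 < \<kappa>"
    and \<epsilon>: "0 < \<epsilon>" "\<epsilon> \<le> \<kappa> / 20" "\<epsilon> \<le> 1 / (6 * real k ^ 2)" and p: "1 \<le> p"
    and nn: "0 \<le> K" "0 \<le> C\<^sub>\<tau>" "0 \<le> C\<^sub>\<mu>"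
    and h: "h = 1 / real k + 3 * \<epsilon>" and L: "\<And>i. real (L i) \<le> 2 * real p * 2 powr (real i * h)"
    and \<tau>: "\<And>j. \<tau> j = C\<^sub>\<tau> * (12 * real p * 2 powr (2 * real j)) powr \<epsilon>"
    and \<delta>: "\<delta> = min (\<kappa> / 2) (1 / (2 * real k))"
  shows "\<exists>C\<ge>0. \<forall>i j S S'. i \<le> j \<longrightarrow> 0 \<le> S' \<longrightarrow> S' \<le> K / 2 ^ i \<longrightarrow> 0 \<le> S \<longrightarrow> S \<le> K / 2 ^ j \<longrightarrow>
     S' * S * axis_bound k (\<tau> j) (real (L i)) (2 ^ i)
   + S' * S * offdiag_bound k (\<tau> j) (real (L i)) (2 ^ i)
      * (C\<^sub>\<mu> * (2 * 2 ^ j * real (L j) + 2 * 2 ^ i * real (L i)) powr \<sigma>)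
   \<le> C * (2 powr (- \<delta>)) ^ j"
proof -
  define P where "P = 2 * real p"
  have P: "2 \<le> P" using p by (simp add: P_def)
  define t where "t = C\<^sub>\<tau> * (12 * real p) powr \<epsilon>"
  have t0: "0 \<le> t" using nn by (simp add: t_def)
  define C1 where "C1 = K\<^sup>2 * real k * (3 * P) ^ (k - 1) * t"
  define C2 where "C2 = K\<^sup>2 * real k * t\<^sup>2 * 9 * 2 ^ (k - 1) * P * (1 + (4 * P) ^ (k - 1)) * C\<^sub>\<mu> * (4 * P) powr \<sigma>"
  have C0: "0 \<le> C1" "0 \<le> C2" using t0 P nn by (auto simp: C1_def C2_def)
  have kk: "0 < real k" "real (k - 1) = real k - 1" using k2 by auto
  have h0: "0 < h" unfolding h using kk(1) \<epsilon>(1) by (intro add_pos_pos divide_pos_pos mult_pos_pos) auto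
  have \<epsilon>k: "6 * real k * \<epsilon> \<le> 1 / real k"
    using \<epsilon>(3) kk by (simp add: field_simps power2_eq_square)
  have hk: "h * (real k - 1) = 1 - 1 / real k + 3 * \<epsilon> * (real k - 1)"
    using kk by (simp add: h field_simps)
  have ek1: "3 * \<epsilon> * (real k - 1) + 2 * \<epsilon> \<le> 3 * real k * \<epsilon>" using \<epsilon> by (simp add: algebra_simps)
  have hk1: "h * (real k - 1) \<le> 1"
  proof -
    have "0 \<le> real k * \<epsilon>" using kk \<epsilon> by simp
    then show ?thesis using hk ek1 \<epsilon>k \<epsilon>(1) by linarith
  qed
  \<comment> \<open>The block length cancels 2^(-i). The k - 1 free coordinates cost h (k - 1),
    which is 1 - 1/k up to \<epsilon>, and the divisor bound costs 2\<epsilon>. All \<epsilon>-terms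
    together are at most 3k\<epsilon> \<le> 1/(2k).\<close>
  have ex1: "- 1 + h * (real k - 1) + 2 * \<epsilon> \<le> - \<delta>"
  proof -
    define u where "u = 1 / real k"
    define v where "v = real k * \<epsilon>"
    have "\<delta> \<le> u / 2" by (simp add: \<delta> u_def)
    moreover have "6 * v \<le> u" using \<epsilon>k by (simp add: u_def v_def)
    moreover have "h * (real k - 1) + 2 * \<epsilon> = 1 - u + (3 * \<epsilon> * (real k - 1) + 2 * \<epsilon>)"
      using hk by (simp add: u_def)
    moreover have "3 * \<epsilon> * (real k - 1) + 2 * \<epsilon> \<le> 3 * v" using ek1 by (simp add: v_def)
    ultimately show ?thesis by linarith
  qed
  \<comment> \<open>In order: the coefficients, two divisor bounds, one free coordinate, and the
    Fourier sum up to height 2^(j(1 + h)). With h = 1/k the bound on \<sigma> makes the total at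
    most -\<kappa>; the corrections add up to 10\<epsilon> \<le> \<kappa>/2.\<close>
  have ex2: "- 1 + 4 * \<epsilon> + h + (1 + h) * \<sigma> \<le> - \<delta>"
  proof -
    have "(real k - 1) / (real k + 1) \<le> 1" using kk by simp
    then have s1: "\<sigma> \<le> 1" using \<sigma> \<kappa> by linarith
    have "(1 + 1 / real k) * \<sigma> \<le> (1 + 1 / real k) * ((real k - 1) / (real k + 1) - \<kappa>)"
      using \<sigma> kk by (intro mult_left_mono) auto
    also have "\<dots> = 1 - 1 / real k - (1 + 1 / real k) * \<kappa>"
    proof -
      have "(1 + 1 / real k) * ((real k - 1) / (real k + 1)) = 1 - 1 / real k"
        using kk by (simp add: divide_simps)
      then show ?thesis by (simp only: right_diff_distrib)
    qed
    also have "\<dots> \<le> 1 - 1 / real k - \<kappa>" using kk \<kappa> by simp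
    finally have a: "(1 + 1 / real k) * \<sigma> \<le> 1 - 1 / real k - \<kappa>" .
    have "3 * \<epsilon> * \<sigma> \<le> 3 * \<epsilon>" using s1 \<epsilon> by simp
    moreover have "(1 + h) * \<sigma> = (1 + 1 / real k) * \<sigma> + 3 * \<epsilon> * \<sigma>" by (simp add: h algebra_simps)
    moreover have "\<delta> \<le> \<kappa> / 2" by (simp add: \<delta>)
    ultimately show ?thesis using a \<epsilon>(2) unfolding h by linarith
  qed
  have key: "S' * S * axis_bound k (\<tau> j) (real (L i)) (2 ^ i)
   + S' * S * offdiag_bound k (\<tau> j) (real (L i)) (2 ^ i)
      * (C\<^sub>\<mu> * (2 * 2 ^ j * real (L j) + 2 * 2 ^ i * real (L i)) powr \<sigma>)
   \<le> (C1 + C2) * (2 powr (- \<delta>)) ^ j"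
    if ij: "i \<le> j" and S: "0 \<le> S'" "S' \<le> K / 2 ^ i" "0 \<le> S" "S \<le> K / 2 ^ j" for i j S S'
  proof -
    define E where "E a = 2 powr (real j * a)" for a :: real
    have E_add: "E a * E b = E (a + b)" for a b by (simp add: E_def powr_add ring_distribs)
    have E0: "0 \<le> E a" for a by (simp add: E_def)
    have Emono: "E a \<le> E b" if "a \<le> b" for a b using that by (simp add: E_def mult_left_mono)
    have E1: "E 1 = 2 ^ j" "E (- 1) = 1 / 2 ^ j" by (simp_all add: E_def powr_realpow powr_minus divide_inverse)
    have \<tau>j: "\<tau> j = t * E (2 * \<epsilon>)"
      by (simp add: \<tau> t_def E_def powr_mult powr_powr mult_ac)
    have Li: "real (L i) \<le> P * 2 powr (real i * h)" using L by (simp add: P_def)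
    have "2 powr (real i * h) \<le> E h" using ij h0 by (simp add: E_def)
    then have LiE: "real (L i) \<le> P * E h" using Li P by (smt (verit, best) mult_left_mono)
    have LjE: "real (L j) \<le> P * E h" using L by (simp add: P_def E_def)
    have pw: "(2 powr (real i * h)) ^ (k - 1) = 2 powr (real i * (h * (real k - 1)))"
      by (simp add: kk(2)[unfolded One_nat_def] powr_powr mult_ac flip: powr_realpow)
    have Lpow: "(a * real (L i)) ^ (k - 1) \<le> (a * P) ^ (k - 1) * 2 powr (real i * (h * (real k - 1)))"
      if "0 \<le> a" for a
    proof -
      have "a * real (L i) \<le> a * P * 2 powr (real i * h)" using Li that by (simp add: mult_left_mono mult.assoc)
      then have "(a * real (L i)) ^ (k - 1) \<le> (a * P * 2 powr (real i * h)) ^ (k - 1)"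
        using that by (intro power_mono) auto
      then show ?thesis by (simp only: power_mult_distrib[of _ "2 powr (real i * h)"] pw)
    qed
    have SS: "S' * S \<le> K\<^sup>2 / 2 ^ i * E (- 1)"
    proof -
      have "S' * S \<le> (K / 2 ^ i) * (K / 2 ^ j)" using S nn by (intro mult_mono) auto
      then show ?thesis by (simp add: E1 power2_eq_square)
    qed
    define s where "s = S' * S"
    have SS0: "0 \<le> s" and SSs: "s \<le> K\<^sup>2 / 2 ^ i * E (- 1)" using S SS by (auto simp: s_def)
    have b1: "(3 * real (L i)) ^ (k - 1) \<le> (3 * P) ^ (k - 1) * E (h * (real k - 1))"
    proof -
      have "2 powr (real i * (h * (real k - 1))) \<le> E (h * (real k - 1))"
        using ij h0 k2 by (simp add: E_def mult_right_mono)
      then show ?thesis using Lpow[of 3] P by (smt (verit, best) mult_left_mono zero_le_power)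
    qed
    have first: "S' * S * axis_bound k (\<tau> j) (real (L i)) (2 ^ i) \<le> C1 * E (- \<delta>)"
    proof -
      have "S' * S * axis_bound k (\<tau> j) (real (L i)) (2 ^ i)
        \<le> (K\<^sup>2 / 2 ^ i * E (- 1)) * (real k * (2 ^ i * (((3 * P) ^ (k - 1) * E (h * (real k - 1))) * (t * E (2 * \<epsilon>)))))"
        unfolding axis_bound_def \<tau>j s_def[symmetric] using SS0 t0 E0 P
        by (intro mult_mono SSs b1 order_refl mult_nonneg_nonneg zero_le_power) auto
      also have "\<dots> = C1 * (E (- 1) * E (h * (real k - 1)) * E (2 * \<epsilon>))" by (simp add: C1_def)
      also have "E (- 1) * E (h * (real k - 1)) * E (2 * \<epsilon>) = E (- 1 + h * (real k - 1) + 2 * \<epsilon>)"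
        by (simp only: E_add)
      also have "C1 * \<dots> \<le> C1 * E (- \<delta>)" using C0 by (intro mult_left_mono Emono ex1)
      finally show ?thesis .
    qed
    \<comment> \<open>As h (k - 1) \<le> 1, the remaining k - 1 coordinates cost no more than the
      block length.\<close>
    have b2: "2 ^ i + (4 * real (L i)) ^ (k - 1) \<le> 2 ^ i * (1 + (4 * P) ^ (k - 1))"
    proof -
      have "2 powr (real i * (h * (real k - 1))) \<le> 2 powr (real i * 1)"
        using hk1 by (intro powr_mono mult_left_mono) auto
      then have "2 powr (real i * (h * (real k - 1))) \<le> 2 ^ i" by (simp add: powr_realpow)
      then have "(4 * P) ^ (k - 1) * 2 powr (real i * (h * (real k - 1))) \<le> (4 * P) ^ (k - 1) * 2 ^ i"
        using P by (intro mult_left_mono) auto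
      then have le: "(4 * real (L i)) ^ (k - 1) \<le> (4 * P) ^ (k - 1) * 2 ^ i"
        by (intro order_trans[OF Lpow]) auto
      have "2 ^ i * (1 + Z) = 2 ^ i + Z * 2 ^ i" for Z :: real by (simp add: algebra_simps)
      then show ?thesis using le by (metis add_left_mono)
    qed
    have b3: "(2 * 2 ^ j * real (L j) + 2 * 2 ^ i * real (L i)) powr \<sigma> \<le> (4 * P) powr \<sigma> * E ((1 + h) * \<sigma>)"
    proof -
      have "2 * 2 ^ i * real (L i) \<le> 2 * 2 ^ j * (P * E h)"
        using ij LiE by (intro mult_mono power_increasing) auto
      moreover have "2 * 2 ^ j * real (L j) \<le> 2 * 2 ^ j * (P * E h)"
        using LjE by (intro mult_left_mono) auto
      moreover have "2 * 2 ^ j * (P * E h) + 2 * 2 ^ j * (P * E h) = 4 * P * (2 ^ j * E h)" by simp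
      ultimately have "2 * 2 ^ j * real (L j) + 2 * 2 ^ i * real (L i) \<le> 4 * P * (2 ^ j * E h)" by linarith
      also have "2 ^ j * E h = E (1 + h)" unfolding E1(1)[symmetric] by (simp only: E_add)
      finally have "(2 * 2 ^ j * real (L j) + 2 * 2 ^ i * real (L i)) powr \<sigma> \<le> (4 * P * E (1 + h)) powr \<sigma>"
        using \<sigma> by (intro powr_mono2) auto
      also have "\<dots> = (4 * P) powr \<sigma> * E ((1 + h) * \<sigma>)"
        using P by (simp add: powr_mult E_def powr_powr mult_ac)
      finally show ?thesis .
    qed
    have second: "S' * S * offdiag_bound k (\<tau> j) (real (L i)) (2 ^ i)
      * (C\<^sub>\<mu> * (2 * 2 ^ j * real (L j) + 2 * 2 ^ i * real (L i)) powr \<sigma>) \<le> C2 * E (- \<delta>)"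
    proof -
      have "S' * S * offdiag_bound k (\<tau> j) (real (L i)) (2 ^ i)
      * (C\<^sub>\<mu> * (2 * 2 ^ j * real (L j) + 2 * 2 ^ i * real (L i)) powr \<sigma>)
       \<le> (K\<^sup>2 / 2 ^ i * E (- 1)) * (real k * ((t * E (2 * \<epsilon>)) * (9 * 2 ^ (k - 1) * (P * E h) * (2 ^ i * (1 + (4 * P) ^ (k - 1))) * (t * E (2 * \<epsilon>)))))
      * (C\<^sub>\<mu> * ((4 * P) powr \<sigma> * E ((1 + h) * \<sigma>)))"
        unfolding offdiag_bound_def \<tau>j s_def[symmetric] using SS0 t0 E0 nn P
        by (intro mult_mono SSs b2 b3 LiE order_refl mult_nonneg_nonneg add_nonneg_nonneg zero_le_power) auto
      also have "\<dots> = C2 * (E (- 1) * (E (2 * \<epsilon>) * E (2 * \<epsilon>)) * E h * E ((1 + h) * \<sigma>))"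
        by (simp add: C2_def power2_eq_square)
      also have "E (- 1) * (E (2 * \<epsilon>) * E (2 * \<epsilon>)) * E h * E ((1 + h) * \<sigma>) = E (- 1 + 4 * \<epsilon> + h + (1 + h) * \<sigma>)"
        by (simp only: E_add) simp
      also have "C2 * \<dots> \<le> C2 * E (- \<delta>)" using C0 by (intro mult_left_mono Emono ex2)
      finally show ?thesis .
    qed
    have "E (- \<delta>) = (2 powr (- \<delta>)) ^ j"
      by (simp add: E_def powr_powr mult.commute flip: powr_realpow)
    then show ?thesis using first second by (simp add: distrib_right)
  qed
  show ?thesis
    by (rule exI[of _ "C1 + C2"]) (use C0 key in auto)
qed

section \<open>Fourier expansion of the smoothed count\<close>

lemma block_expansion:
  fixes A :: "('n::finite \<Rightarrow> real) set" and \<kappa> :: "real \<Rightarrow> int \<Rightarrow> real" and b :: "real \<Rightarrow> real \<Rightarrow> real"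
    and x y :: "real ^ 'n"
  assumes b: "\<And>\<alpha> l t. \<alpha> \<in> A \<Longrightarrow> of_real (b (\<alpha> l) t) = (\<Sum>u\<in>{- int L..int L}. of_real (\<kappa> (\<alpha> l) u) * ee (of_int u * t))"
    and \<kappa>0: "\<And>\<alpha> l. \<alpha> \<in> A \<Longrightarrow> \<kappa> (\<alpha> l) 0 = \<alpha> l"
  shows "of_real (\<Sum>n\<in>block N. \<Sum>\<alpha>\<in>A. \<Prod>l\<in>UNIV. b (\<alpha> l) (real n * x $ l - y $ l))
    = of_real (real N * (\<Sum>\<alpha>\<in>A. \<Prod>l\<in>UNIV. \<alpha> l))
      + (\<Sum>s\<in>freq_pairs N L. (of_real (\<Sum>\<alpha>\<in>A. \<Prod>l\<in>UNIV. \<kappa> (\<alpha> l) (snd s l)) * ee (- (\<Sum>l\<in>UNIV. of_int (snd s l) * y $ l)))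
          * ee (\<Sum>l\<in>UNIV. of_int (int (fst s) * snd s l) * x $ l))"
proof -
  define c where "c \<xi> = (\<Sum>\<alpha>\<in>A. \<Prod>l\<in>UNIV. \<kappa> (\<alpha> l) (\<xi> l))" for \<xi> :: "'n \<Rightarrow> int"
  define \<phi> where "\<phi> n \<xi> = ee (- (\<Sum>l\<in>UNIV. of_int (\<xi> l) * y $ l)) * ee (\<Sum>l\<in>UNIV. of_int (int n * \<xi> l) * x $ l)"
    for n and \<xi> :: "'n \<Rightarrow> int"
  have one: "of_real (\<Prod>l\<in>UNIV. b (\<alpha> l) (real n * x $ l - y $ l))
      = (\<Sum>\<xi>\<in>freq_box L. of_real (\<Prod>l\<in>UNIV. \<kappa> (\<alpha> l) (\<xi> l)) * \<phi> n \<xi>)" if "\<alpha> \<in> A" for \<alpha> n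
  proof -
    have "of_real (\<Prod>l\<in>UNIV. b (\<alpha> l) (real n * x $ l - y $ l))
      = (\<Prod>l\<in>UNIV. \<Sum>u\<in>{- int L..int L}. of_real (\<kappa> (\<alpha> l) u) * ee (of_int u * (real n * x $ l - y $ l)))"
      unfolding of_real_prod using b[OF that] by simp
    also have "\<dots> = (\<Sum>\<xi>\<in>freq_box L. \<Prod>l\<in>UNIV. of_real (\<kappa> (\<alpha> l) (\<xi> l)) * ee (of_int (\<xi> l) * (real n * x $ l - y $ l)))"
      unfolding freq_box_PiE by (rule prod_sum_PiE) auto
    also have "\<dots> = (\<Sum>\<xi>\<in>freq_box L. of_real (\<Prod>l\<in>UNIV. \<kappa> (\<alpha> l) (\<xi> l)) * \<phi> n \<xi>)"
    proof (intro sum.cong refl)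
      fix \<xi> :: "'n \<Rightarrow> int"
      have "(\<Prod>l\<in>UNIV. ee (of_int (\<xi> l) * (real n * x $ l - y $ l)))
          = ee (\<Sum>l\<in>UNIV. of_int (\<xi> l) * (real n * x $ l - y $ l))" by (simp add: ee_sum)
      also have "(\<Sum>l\<in>UNIV. of_int (\<xi> l) * (real n * x $ l - y $ l))
         = - (\<Sum>l\<in>UNIV. of_int (\<xi> l) * y $ l) + (\<Sum>l\<in>UNIV. of_int (int n * \<xi> l) * x $ l)"
        by (simp add: sum_subtractf algebra_simps flip: sum.distrib)
      finally show "(\<Prod>l\<in>UNIV. of_real (\<kappa> (\<alpha> l) (\<xi> l)) * ee (of_int (\<xi> l) * (real n * x $ l - y $ l)))
         = of_real (\<Prod>l\<in>UNIV. \<kappa> (\<alpha> l) (\<xi> l)) * \<phi> n \<xi>"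
        by (simp add: prod.distrib \<phi>_def flip: ee_add)
    qed
    finally show ?thesis .
  qed
  have per_n: "(\<Sum>\<alpha>\<in>A. of_real (\<Prod>l\<in>UNIV. b (\<alpha> l) (real n * x $ l - y $ l)))
      = of_real (\<Sum>\<alpha>\<in>A. \<Prod>l\<in>UNIV. \<alpha> l) + (\<Sum>\<xi>\<in>freq_box L - {\<lambda>_. 0}. of_real (c \<xi>) * \<phi> n \<xi>)" for n
  proof -
    have "(\<Sum>\<alpha>\<in>A. of_real (\<Prod>l\<in>UNIV. b (\<alpha> l) (real n * x $ l - y $ l)))
       = (\<Sum>\<alpha>\<in>A. \<Sum>\<xi>\<in>freq_box L. of_real (\<Prod>l\<in>UNIV. \<kappa> (\<alpha> l) (\<xi> l)) * \<phi> n \<xi>)"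
      by (intro sum.cong refl one)
    also have "\<dots> = (\<Sum>\<xi>\<in>freq_box L. of_real (c \<xi>) * \<phi> n \<xi>)"
      unfolding c_def of_real_sum sum_distrib_right by (rule sum.swap)
    also have "\<dots> = of_real (c (\<lambda>_. 0)) * \<phi> n (\<lambda>_. 0) + (\<Sum>\<xi>\<in>freq_box L - {\<lambda>_. 0}. of_real (c \<xi>) * \<phi> n \<xi>)"
      by (intro sum.remove finite_freq_box) (auto simp: freq_box_iff)
    also have "c (\<lambda>_. 0) = (\<Sum>\<alpha>\<in>A. \<Prod>l\<in>UNIV. \<alpha> l)"
      unfolding c_def by (intro sum.cong prod.cong refl) (simp add: \<kappa>0)
    also have "\<phi> n (\<lambda>_. 0) = 1" by (simp add: \<phi>_def)
    finally show ?thesis by simp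
  qed
  have "of_real (\<Sum>n\<in>block N. \<Sum>\<alpha>\<in>A. \<Prod>l\<in>UNIV. b (\<alpha> l) (real n * x $ l - y $ l))
     = (\<Sum>n\<in>block N. complex_of_real (\<Sum>\<alpha>\<in>A. \<Prod>l\<in>UNIV. \<alpha> l) + (\<Sum>\<xi>\<in>freq_box L - {\<lambda>_. 0}. of_real (c \<xi>) * \<phi> n \<xi>))"
    unfolding per_n[symmetric] by simp
  also have "\<dots> = of_real (real N * (\<Sum>\<alpha>\<in>A. \<Prod>l\<in>UNIV. \<alpha> l)) + (\<Sum>n\<in>block N. \<Sum>\<xi>\<in>freq_box L - {\<lambda>_. 0}. of_real (c \<xi>) * \<phi> n \<xi>)"
    by (simp add: sum.distrib)
  also have "(\<Sum>n\<in>block N. \<Sum>\<xi>\<in>freq_box L - {\<lambda>_. 0}. of_real (c \<xi>) * \<phi> n \<xi>)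
     = (\<Sum>s\<in>freq_pairs N L. of_real (c (snd s)) * \<phi> (fst s) (snd s))"
    unfolding freq_pairs_def by (simp add: sum.cartesian_product case_prod_beta)
  finally show ?thesis by (simp only: c_def \<phi>_def mult.assoc)
qed

lemma sum_freq_box_fourier:
  fixes \<mu> :: "(real ^ 'n::finite) measure"
  shows "(\<Sum>\<zeta>\<in>freq_box Q. norm (fourier_coeff \<mu> (\<chi> l. \<zeta> l)))
    = (\<Sum>\<xi>\<in>{\<xi>::int^'n. \<forall>j. real_of_int \<bar>\<xi> $ j\<bar> \<le> real Q}. norm (fourier_coeff \<mu> \<xi>))"
proof (rule sum.reindex_bij_witness[of _ "\<lambda>\<xi>. \<lambda>l. \<xi> $ l" "\<lambda>\<zeta>. \<chi> l. \<zeta> l"])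
  show "(\<chi> l. \<zeta> l) \<in> {\<xi>::int^'n. \<forall>j. real_of_int \<bar>\<xi> $ j\<bar> \<le> real Q}" if "\<zeta> \<in> freq_box Q" for \<zeta>
  proof -
    have "real_of_int \<bar>\<zeta> j\<bar> \<le> real Q" for j
      using that by (metis (mono_tags) freq_box_def mem_Collect_eq of_int_le_iff of_int_of_nat_eq)
    then show ?thesis by simp
  qed
  show "(\<lambda>l. \<xi> $ l) \<in> freq_box Q" if "\<xi> \<in> {\<xi>::int^'n. \<forall>j. real_of_int \<bar>\<xi> $ j\<bar> \<le> real Q}" for \<xi>
  proof -
    have "\<bar>\<xi> $ j\<bar> \<le> int Q" for j
      using that by (metis (mono_tags, lifting) mem_Collect_eq of_int_le_iff of_int_of_nat_eq)
    then show ?thesis by (simp add: freq_box_def)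
  qed
qed auto

definition hits :: "('n::finite \<Rightarrow> real) \<Rightarrow> real ^ 'n \<Rightarrow> nat \<Rightarrow> real ^ 'n \<Rightarrow> bool" where
  "hits \<alpha> y n x \<longleftrightarrow> (\<forall>l. dnint (real n * x $ l - y $ l) < \<alpha> l)"

text \<open>One coordinate outside its interval supplies the small factor \<open>\<eta>\<close>; the
  remaining factors are bounded by the peaks of their kernels.\<close>

lemma kernel_product_nonhit:
  fixes \<alpha> :: "'n::finite \<Rightarrow> real"
  assumes "\<not> hits \<alpha> y n x" and B: "0 \<le> B" "0 \<le> \<eta>" and \<alpha>: "\<And>l. 0 \<le> \<alpha> l"
    and b0: "\<And>l t. 0 \<le> b (\<alpha> l) t" and bB: "\<And>l t. b (\<alpha> l) t \<le> \<alpha> l * B"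
    and tail: "\<And>l t. \<alpha> l \<le> dnint t \<Longrightarrow> b (\<alpha> l) t \<le> \<alpha> l * B * \<eta>"
  shows "(\<Prod>l\<in>UNIV. b (\<alpha> l) (real n * x $ l - y $ l)) \<le> (\<Prod>l\<in>UNIV. \<alpha> l) * B ^ CARD('n) * \<eta>"
proof -
  obtain l0 where l0: "\<alpha> l0 \<le> dnint (real n * x $ l0 - y $ l0)"
    using assms(1) by (auto simp: hits_def not_less)
  have "(\<Prod>l\<in>UNIV. b (\<alpha> l) (real n * x $ l - y $ l))
     = b (\<alpha> l0) (real n * x $ l0 - y $ l0) * (\<Prod>l\<in>UNIV - {l0}. b (\<alpha> l) (real n * x $ l - y $ l))"
    by (intro prod.remove) auto
  also have "\<dots> \<le> (\<alpha> l0 * B * \<eta>) * (\<Prod>l\<in>UNIV - {l0}. \<alpha> l * B)"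
    using B \<alpha> b0 bB by (intro mult_mono tail l0 prod_mono prod_nonneg) auto
  also have "\<dots> = ((\<alpha> l0 * B) * (\<Prod>l\<in>UNIV - {l0}. \<alpha> l * B)) * \<eta>" by simp
  also have "(\<alpha> l0 * B) * (\<Prod>l\<in>UNIV - {l0}. \<alpha> l * B) = (\<Prod>l\<in>UNIV. \<alpha> l * B)"
    by (rule prod.remove[symmetric]) auto
  also have "(\<Prod>l\<in>UNIV. \<alpha> l * B) = (\<Prod>l\<in>UNIV. \<alpha> l) * B ^ CARD('n)" by (simp add: prod.distrib)
  finally show ?thesis .
qed

section \<open>The variance argument for a family of boxes\<close>

text \<open>\<open>\<psi> i\<close> is the common volume of the boxes of level i.
  \<open>total\<close> bounds the expected hits in a block, and \<open>overlap\<close> says that the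
  boxes of one level behave as if they were essentially disjoint. The exponent \<open>h\<close>
  exceeds that of the shortest admissible side by 2\<epsilon>, so \<open>M i\<close> times any side
  is at least 2^(2\<epsilon>i); the second condition on \<open>p\<close> raises this to 2^((2k +
  3)i) in the tails of the kernels.\<close>

locale box_system =
  fixes \<mu> :: "(real ^ 'n::finite) measure" and k :: nat and \<sigma> \<kappa> \<epsilon> h K C\<^sub>\<tau> C\<^sub>\<mu> :: real and p :: nat
    and M L :: "nat \<Rightarrow> nat" and A :: "nat \<Rightarrow> ('n \<Rightarrow> real) set" and \<psi> :: "nat \<Rightarrow> real" and y :: "real ^ 'n"
  assumes prob: "prob_space \<mu>" and sets_mu: "sets \<mu> = sets borel"
    and k: "k = CARD('n)" and k2: "2 \<le> k"
    and \<sigma>: "0 \<le> \<sigma>" "\<sigma> \<le> (real k - 1) / (real k + 1) - \<kappa>" and \<kappa>: "0 < \<kappa>"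
    and \<epsilon>: "0 < \<epsilon>" "\<epsilon> \<le> \<kappa> / 20" "\<epsilon> \<le> 1 / (6 * real k ^ 2)"
    and p: "1 \<le> p" "2 * real k + 3 \<le> 4 * real p * \<epsilon>"
    and nn: "0 \<le> K" "0 \<le> C\<^sub>\<tau>" "0 \<le> C\<^sub>\<mu>"
    and h: "h = 1 / real k + 3 * \<epsilon>"
    and M: "\<And>i. M i = nat \<lceil>2 powr (real i * h)\<rceil>" and L: "\<And>i. L i = p * M i"
    and fourier: "\<And>Q::nat. 1 \<le> Q \<Longrightarrow> (\<Sum>\<zeta>\<in>freq_box Q. norm (fourier_coeff \<mu> (\<chi> l. \<zeta> l))) \<le> C\<^sub>\<mu> * real Q powr \<sigma>"
    and divisors: "\<And>n::nat. 1 \<le> n \<Longrightarrow> real (card {d. d dvd n}) \<le> C\<^sub>\<tau> * real n powr \<epsilon>"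
    and finA: "\<And>i. finite (A i)"
    and lo: "\<And>i \<alpha> l. \<alpha> \<in> A i \<Longrightarrow> 2 powr (- (real i * (1 / real k + \<epsilon>))) \<le> \<alpha> l"
    and hi: "\<And>i \<alpha> l. \<alpha> \<in> A i \<Longrightarrow> \<alpha> l \<le> 1"
    and vol: "\<And>i \<alpha>. \<alpha> \<in> A i \<Longrightarrow> (\<Prod>l\<in>UNIV. \<alpha> l) = \<psi> i"
    and total: "\<And>i. 2 ^ i * (real (card (A i)) * \<psi> i) \<le> K"
    and overlap: "\<And>i \<alpha>. \<alpha> \<in> A i \<Longrightarrow> (\<Sum>\<alpha>'\<in>A i. \<Prod>l\<in>UNIV. min (\<alpha> l) (\<alpha>' l)) \<le> K * \<psi> i"
    and diverges: "\<not> summable (\<lambda>i. 2 ^ i * (real (card (A i)) * \<psi> i))"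
begin

definition mass :: "nat \<Rightarrow> real" where
  "mass i = real (card (A i)) * \<psi> i"

text \<open>The expected number of hits under Lebesgue measure, counted over all boxes of the
  level.\<close>

definition expected :: "nat \<Rightarrow> real" where
  "expected i = 2 ^ i * mass i"

definition fc :: "('n \<Rightarrow> int) \<Rightarrow> real" where
  "fc \<zeta> = norm (fourier_coeff \<mu> (\<chi> l. \<zeta> l))"

text \<open>12 p 4^j bounds the nonzero integers whose divisors are counted for levels up to j: all
  degrees there are at most 2p 2^j and all block lengths at most 2^j.\<close>

definition tau :: "nat \<Rightarrow> real" where
  "tau j = C\<^sub>\<tau> * (12 * real p * 2 powr (2 * real j)) powr \<epsilon>"

lemma pos: "\<alpha> \<in> A i \<Longrightarrow> 0 < \<alpha> l"
  using lo[of \<alpha> i l] by (smt (verit, best) powr_gt_zero)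

lemma psi_nonneg: "\<alpha> \<in> A i \<Longrightarrow> 0 \<le> \<psi> i"
  using vol[of \<alpha> i] pos[of \<alpha> i] by (metis prod_nonneg less_imp_le)

lemma mass_nonneg: "0 \<le> mass i"
proof (cases "A i = {}")
  case False
  then show ?thesis using psi_nonneg by (auto simp: mass_def)
qed (simp add: mass_def)

lemma expected_nonneg: "0 \<le> expected i"
  using mass_nonneg by (simp add: expected_def)

lemma mass_le: "mass i \<le> K / 2 ^ i"
  using total[of i] by (simp add: mass_def field_simps)

lemma h_bounds: "0 < h" "h \<le> 1"
proof -
  have kk: "2 \<le> real k" using k2 by simp
  show "0 < h" unfolding h using kk \<epsilon>(1) by (intro add_pos_pos divide_pos_pos mult_pos_pos) auto
  have "2 ^ 2 \<le> real k ^ 2" using kk by (intro power_mono) auto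
  then have "1 / (6 * real k ^ 2) \<le> 1 / (6 * 2 ^ 2)" using kk by (intro divide_left_mono) auto
  moreover have "1 / real k \<le> 1 / 2" using kk by (intro divide_left_mono) auto
  ultimately show "h \<le> 1" using \<epsilon>(3) unfolding h by simp
qed

lemma M_bounds: "1 \<le> M i" "2 powr (real i * h) \<le> real (M i)" "real (M i) \<le> 2 * 2 powr (real i * h)"
proof -
  have "1 \<le> 2 powr (real i * h)" using h_bounds by (simp add: ge_one_powr_ge_zero)
  then show "1 \<le> M i" "2 powr (real i * h) \<le> real (M i)" "real (M i) \<le> 2 * 2 powr (real i * h)"
    unfolding M by linarith+
qed

lemma L_bounds: "1 \<le> L i" "real (L i) \<le> 2 * real p * 2 powr (real i * h)"
proof -
  show "1 \<le> L i" using M_bounds(1)[of i] p by (simp add: L Suc_le_eq)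
  have "real p * real (M i) \<le> real p * (2 * 2 powr (real i * h))"
    by (intro mult_left_mono M_bounds) auto
  then show "real (L i) \<le> 2 * real p * 2 powr (real i * h)" by (simp add: L)
qed

lemma fc_minus: "fc (\<lambda>l. - \<zeta> l) = fc \<zeta>"
  using fourier_coeff_minus[of \<mu> "\<chi> l. \<zeta> l"] unfolding fc_def
  by (simp add: vec_eq_iff uminus_vec_def)

lemma fc_bounds: "0 \<le> fc \<zeta>" "fc \<zeta> \<le> 1"
  using norm_fourier_coeff_le_1[OF prob] by (auto simp: fc_def)

lemma freq_diff_swap: "fc (freq_diff s t) = fc (freq_diff t s)"
  using fc_minus[of "freq_diff t s"] by (simp add: freq_diff_def)

lemma tau_bound:
  assumes "i \<le> j" "u \<noteq> 0" "\<bar>u\<bar> \<le> int (2 * 2 ^ j * L j + 2 * 2 ^ i * L i) + 2 * int (2 ^ i) * int (L i)"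
  shows "real (card {d::nat. int d dvd u}) \<le> tau j"
proof -
  have Lj: "real (L i') \<le> 2 * real p * 2 ^ j" if "i' \<le> j" for i'
  proof -
    have "2 powr (real i' * h) \<le> 2 powr (real j * 1)"
      using that h_bounds by (intro powr_mono mult_mono) auto
    then have "2 * real p * 2 powr (real i' * h) \<le> 2 * real p * 2 ^ j"
      by (intro mult_left_mono) (auto simp: powr_realpow)
    then show ?thesis using L_bounds(2)[of i'] by linarith
  qed
  have two: "(2::real) ^ i' * real (L i') \<le> 2 ^ j * (2 * real p * 2 ^ j)" if "i' \<le> j" for i'
    using that Lj[OF that] by (intro mult_mono power_increasing) auto
  have "real_of_int \<bar>u\<bar> \<le> real_of_int (int (2 * 2 ^ j * L j + 2 * 2 ^ i * L i) + 2 * int (2 ^ i) * int (L i))"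
    using assms(3) by (simp only: of_int_le_iff)
  also have "\<dots> = 2 * (2 ^ j * real (L j)) + 4 * (2 ^ i * real (L i))" by simp
  also have "\<dots> \<le> 2 * (2 ^ j * (2 * real p * 2 ^ j)) + 4 * (2 ^ j * (2 * real p * 2 ^ j))"
    by (intro add_mono mult_left_mono two) (use assms in auto)
  also have "\<dots> = 12 * real p * 2 powr (2 * real j)"
  proof -
    have "2 powr (2 * real j) = 2 ^ j * (2::real) ^ j" by (simp only: mult_2 powr_add powr_realpow[of 2, simplified])
    then show ?thesis by simp
  qed
  finally have le: "real (nat \<bar>u\<bar>) \<le> 12 * real p * 2 powr (2 * real j)" by simp
  have "{d::nat. int d dvd u} = {d. d dvd nat \<bar>u\<bar>}" by auto
  then have "real (card {d::nat. int d dvd u}) \<le> C\<^sub>\<tau> * real (nat \<bar>u\<bar>) powr \<epsilon>"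
    using divisors[of "nat \<bar>u\<bar>"] assms(2) by simp
  also have "\<dots> \<le> tau j"
    unfolding tau_def using le nn \<epsilon> by (intro mult_left_mono powr_mono2) auto
  finally show ?thesis .
qed

lemma tau_nonneg: "0 \<le> tau j" using nn by (simp add: tau_def)

definition kernel_pair :: "nat \<Rightarrow> real \<Rightarrow> (int \<Rightarrow> real) \<Rightarrow> (real \<Rightarrow> real) \<Rightarrow> bool" where
  "kernel_pair i a c b \<longleftrightarrow> c 0 = a \<and> (\<forall>\<xi>. 0 \<le> c \<xi>) \<and>
    (\<forall>\<xi>\<in>{-int (L i)..int (L i)}. c \<xi> \<le> 4 * a / (1 + a * \<bar>of_int \<xi>\<bar>)\<^sup>2) \<and>
    (\<forall>x. of_real (b x) = (\<Sum>\<xi>\<in>{-int (L i)..int (L i)}. of_real (c \<xi>) * ee (of_int \<xi> * x))) \<and>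
    (\<forall>x. 0 \<le> b x) \<and> (\<forall>x. b x \<le> a * real (L i + 1)) \<and>
    (\<forall>x. a \<le> dnint x \<longrightarrow> b x \<le> a * real (L i + 1) / (real (M i) * a) ^ (2 * p))"

text \<open>A kernel depends on the level and the side length alone, so one choice serves all boxes
  and coordinates.\<close>

lemma kernel_pair_exists:
  "\<exists>c b. \<forall>i a. 0 < a \<longrightarrow> a \<le> 1 \<longrightarrow> kernel_pair i a (c i a) (b i a)"
proof -
  define F where "F i a = (SOME cb. kernel_pair i a (fst cb) (snd cb))" for i a
  have "kernel_pair i a (fst (F i a)) (snd (F i a))" if a: "0 < a" "a \<le> 1" for i a
  proof -
    obtain c b where "kernel_pair i a c b"
      unfolding kernel_pair_def L using box_kernel[OF M_bounds(1)[of i] a, of p] by auto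
    then have "kernel_pair i a (fst (c, b)) (snd (c, b))" by simp
    then show ?thesis unfolding F_def by (rule someI)
  qed
  then show ?thesis by (intro exI[of _ "\<lambda>i a. fst (F i a)"] exI[of _ "\<lambda>i a. snd (F i a)"]) blast
qed

context
  fixes c :: "nat \<Rightarrow> real \<Rightarrow> int \<Rightarrow> real" and b :: "nat \<Rightarrow> real \<Rightarrow> real \<Rightarrow> real"
  assumes gk: "\<And>i a. 0 < a \<Longrightarrow> a \<le> 1 \<Longrightarrow> kernel_pair i a (c i a) (b i a)"
begin

lemma kernel:
  assumes "\<alpha> \<in> A i"
  shows "c i (\<alpha> l) 0 = \<alpha> l" "0 \<le> c i (\<alpha> l) u"
    "u \<in> {-int (L i)..int (L i)} \<Longrightarrow> c i (\<alpha> l) u \<le> 4 * \<alpha> l / (1 + \<alpha> l * \<bar>of_int u\<bar>)\<^sup>2"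
    "of_real (b i (\<alpha> l) t) = (\<Sum>\<xi>\<in>{-int (L i)..int (L i)}. of_real (c i (\<alpha> l) \<xi>) * ee (of_int \<xi> * t))"
    "0 \<le> b i (\<alpha> l) t" "b i (\<alpha> l) t \<le> \<alpha> l * real (L i + 1)"
    "\<alpha> l \<le> dnint t \<Longrightarrow> b i (\<alpha> l) t \<le> \<alpha> l * real (L i + 1) / (real (M i) * \<alpha> l) ^ (2 * p)"
  using gk[OF pos[OF assms, of l] hi[OF assms, of l], of i] unfolding kernel_pair_def by blast+

definition coeff :: "nat \<Rightarrow> ('n \<Rightarrow> int) \<Rightarrow> real" where
  "coeff i \<xi> = (\<Sum>\<alpha>\<in>A i. \<Prod>l\<in>UNIV. c i (\<alpha> l) (\<xi> l))"

definition count :: "nat \<Rightarrow> real ^ 'n \<Rightarrow> real" where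
  "count i x = (\<Sum>n\<in>block (2 ^ i). \<Sum>\<alpha>\<in>A i. \<Prod>l\<in>UNIV. b i (\<alpha> l) (real n * x $ l - y $ l))"

definition weight :: "nat \<Rightarrow> nat \<times> ('n \<Rightarrow> int) \<Rightarrow> complex" where
  "weight i s = of_real (coeff i (snd s)) * ee (- (\<Sum>l\<in>UNIV. of_int (snd s l) * y $ l))"

lemma count_nonneg: "0 \<le> count i x"
  unfolding count_def by (intro sum_nonneg prod_nonneg) (auto intro: kernel)

lemma sum_vol: "(\<Sum>\<alpha>\<in>A i. \<Prod>l\<in>UNIV. \<alpha> l) = mass i"
proof -
  have "(\<Sum>\<alpha>\<in>A i. \<Prod>l\<in>UNIV. \<alpha> l) = (\<Sum>\<alpha>\<in>A i. \<psi> i)" by (intro sum.cong refl vol)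
  then show ?thesis by (simp add: mass_def)
qed

lemma count_expansion:
  "of_real (count i x - expected i) = (\<Sum>s\<in>freq_pairs (2 ^ i) (L i).
     weight i s * ee (\<Sum>l\<in>UNIV. of_int (int (fst s) * snd s l) * x $ l))"
proof -
  have "of_real (count i x) = of_real (real (2 ^ i) * (\<Sum>\<alpha>\<in>A i. \<Prod>l\<in>UNIV. \<alpha> l))
      + (\<Sum>s\<in>freq_pairs (2 ^ i) (L i). weight i s * ee (\<Sum>l\<in>UNIV. of_int (int (fst s) * snd s l) * x $ l))"
    unfolding count_def weight_def coeff_def
    by (rule block_expansion[where b = "b i" and \<kappa> = "c i"]) (rule kernel(4) kernel(1), assumption)+
  then show ?thesis unfolding sum_vol expected_def by simp
qed

lemma coeff_bounds:
  assumes "\<xi> \<in> freq_box (L i)"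
  shows "0 \<le> coeff i \<xi>" "coeff i \<xi> \<le> 4 ^ k * mass i"
proof -
  show "0 \<le> coeff i \<xi>" unfolding coeff_def by (intro sum_nonneg prod_nonneg) (auto intro: kernel)
  have "coeff i \<xi> \<le> (\<Sum>\<alpha>\<in>A i. \<Prod>l\<in>UNIV. 4 * \<alpha> l)"
    unfolding coeff_def
  proof (intro sum_mono prod_mono conjI)
    fix \<alpha> l assume a: "\<alpha> \<in> A i"
    show "0 \<le> c i (\<alpha> l) (\<xi> l)" by (rule kernel[OF a])
    have "c i (\<alpha> l) (\<xi> l) \<le> 4 * \<alpha> l / (1 + \<alpha> l * \<bar>of_int (\<xi> l)\<bar>)\<^sup>2"
      using assms by (intro kernel[OF a]) (auto simp: freq_box_iff)
    also have "\<dots> \<le> 4 * \<alpha> l / 1"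
    proof (rule divide_left_mono)
      show one: "1 \<le> (1 + \<alpha> l * \<bar>real_of_int (\<xi> l)\<bar>)\<^sup>2" using pos[OF a, of l] by (simp add: one_le_power)
      show "0 \<le> 4 * \<alpha> l" using pos[OF a, of l] by simp
      show "0 < (1 + \<alpha> l * \<bar>real_of_int (\<xi> l)\<bar>)\<^sup>2 * 1" using one by linarith
    qed
    finally show "c i (\<alpha> l) (\<xi> l) \<le> 4 * \<alpha> l" by simp
  qed
  also have "\<dots> = 4 ^ k * mass i"
    unfolding prod.distrib sum_vol[symmetric] by (simp add: k sum_distrib_left)
  finally show "coeff i \<xi> \<le> 4 ^ k * mass i" .
qed

lemma norm_weight: "s \<in> freq_pairs N (L i) \<Longrightarrow> norm (weight i s) = coeff i (snd s)"
  using coeff_bounds(1)[of "snd s" i] by (auto simp: weight_def norm_mult freq_pairs_def)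

lemma coeff_square_sum:
  assumes "1 \<le> q"
  shows "(\<Sum>\<xi>\<in>{\<xi>\<in>freq_box (L i). \<forall>l. \<xi> l \<noteq> 0 \<and> int q dvd \<xi> l}. (coeff i \<xi>)\<^sup>2)
     \<le> (32 ^ k * K * mass i) / real q ^ CARD('n)"
proof -
  have "(\<Sum>\<xi>\<in>{\<xi>\<in>freq_box (L i). \<forall>l. \<xi> l \<noteq> 0 \<and> int q dvd \<xi> l}. (coeff i \<xi>)\<^sup>2)
     \<le> 32 ^ CARD('n) * (real (card (A i)) * (K * \<psi> i)) / real q ^ CARD('n)"
    unfolding coeff_def
    by (rule coeff_square_sum_le) (use finA assms kernel pos overlap in auto)
  then show ?thesis by (simp add: k mass_def mult_ac)
qed

definition pair_sum :: "nat \<Rightarrow> nat \<Rightarrow> real" where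
  "pair_sum i j = (\<Sum>s\<in>freq_pairs (2 ^ i) (L i). \<Sum>t\<in>freq_pairs (2 ^ j) (L j).
     coeff i (snd s) * coeff j (snd t) * fc (freq_diff s t))"

lemma pair_sum_sym: "pair_sum i j = pair_sum j i"
  unfolding pair_sum_def by (subst sum.swap) (simp add: mult_ac freq_diff_swap)

text \<open>As \<open>expected i\<close> is 2^i \<open>mass i\<close>, the left side equals 2^((i -
  j)/2) times the geometric mean of the two expectations. The short block in the gcd sum is what
  produces this decay in j - i.\<close>

lemma sqrt_mass_product:
  assumes "i \<le> j"
  shows "2 ^ i * sqrt (mass j * mass i) \<le> (1 / sqrt 2) ^ (j - i) * ((expected i + expected j) / 2)"
proof -
  define r :: real where "r = (1 / sqrt 2) ^ (j - i)"
  have r0: "0 \<le> r" by (simp add: r_def)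
  have r2: "r\<^sup>2 * 2 ^ j = 2 ^ i"
  proof -
    have "r\<^sup>2 = (1 / 2) ^ (j - i)"
      unfolding r_def by (simp add: power_divide flip: power_mult, subst mult.commute, simp add: power_mult)
    moreover have "(2::real) ^ j = 2 ^ (j - i) * 2 ^ i" using assms by (simp flip: power_add)
    ultimately show ?thesis by (simp add: power_divide)
  qed
  have "2 ^ i * sqrt (mass j * mass i) = sqrt ((2 ^ i)\<^sup>2 * (mass j * mass i))"
    by (simp add: real_sqrt_mult)
  also have "(2 ^ i)\<^sup>2 * (mass j * mass i) = r\<^sup>2 * (expected i * expected j)"
    unfolding expected_def using r2 by (simp add: power2_eq_square)
  also have "sqrt (r\<^sup>2 * (expected i * expected j)) = r * sqrt (expected i * expected j)"
    using r0 by (simp add: real_sqrt_mult)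
  also have "\<dots> \<le> r * ((expected i + expected j) / 2)"
    using r0 expected_nonneg by (intro mult_left_mono arith_geo_mean_sqrt) auto
  finally show ?thesis by (simp add: r_def)
qed

text \<open>With G = 32^k K \<open>mass j\<close> and G' = 32^k K \<open>mass i\<close>, the
  diagonal is 18 (32^k K) times the quantity just estimated; the arithmetic mean halves the 18. The
  rest is the power saving from the exponents.\<close>

lemma pair_sum_bound:
  "\<exists>C\<ge>0. \<exists>q. 0 < q \<and> q < 1 \<and> (\<forall>i j. i \<le> j \<longrightarrow>
     pair_sum i j \<le> (9 * 32 ^ k * K) * (1 / sqrt 2) ^ (j - i) * (expected i + expected j) + C * q ^ j)"
proof -
  define \<delta> where "\<delta> = min (\<kappa> / 2) (1 / (2 * real k))"
  have \<delta>0: "0 < \<delta>" using \<kappa> k2 by (simp add: \<delta>_def)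
  obtain C where C0: "0 \<le> C" and C: "\<And>i j S S'. i \<le> j \<Longrightarrow> 0 \<le> S' \<Longrightarrow> S' \<le> 4 ^ k * K / 2 ^ i \<Longrightarrow> 0 \<le> S \<Longrightarrow> S \<le> 4 ^ k * K / 2 ^ j \<Longrightarrow>
     S' * S * axis_bound k (tau j) (real (L i)) (2 ^ i)
   + S' * S * offdiag_bound k (tau j) (real (L i)) (2 ^ i)
      * (C\<^sub>\<mu> * (2 * 2 ^ j * real (L j) + 2 * 2 ^ i * real (L i)) powr \<sigma>)
   \<le> C * (2 powr (- \<delta>)) ^ j"
    using error_terms_bound[OF k2 \<sigma> \<kappa> \<epsilon> p(1) _ nn(2,3) h L_bounds(2) tau_def \<delta>_def, of "4 ^ k * K"] nn(1) by auto
  have main: "pair_sum i j \<le> (9 * 32 ^ k * K) * (1 / sqrt 2) ^ (j - i) * (expected i + expected j) + C * (2 powr (- \<delta>)) ^ j"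
    if ij: "i \<le> j" for i j
  proof -
    define Q where "Q = 2 * 2 ^ j * L j + 2 * 2 ^ i * L i"
    have Q1: "1 \<le> Q" using L_bounds(1)[of j] by (simp add: Q_def Suc_le_eq)
    have "pair_sum i j \<le> 18 * real (2 ^ i) * sqrt ((32 ^ k * K * mass j) * (32 ^ k * K * mass i))
      + (4 ^ k * mass i) * (4 ^ k * mass j) * axis_bound CARD('n) (tau j) (real (L i)) (real (2 ^ i))
      + (4 ^ k * mass i) * (4 ^ k * mass j) * offdiag_bound CARD('n) (tau j) (real (L i)) (real (2 ^ i))
        * (C\<^sub>\<mu> * real Q powr \<sigma>)"
      unfolding pair_sum_def
    proof (rule pair_sum_le[where Q = Q])
      show "(\<Sum>\<zeta>\<in>freq_box Q. fc \<zeta>) \<le> C\<^sub>\<mu> * real Q powr \<sigma>"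
        using fourier[OF Q1] by (simp add: fc_def)
      show "real (card {d::nat. int d dvd u}) \<le> tau j"
        if "u \<noteq> 0" "\<bar>u\<bar> \<le> int Q + 2 * int (2 ^ i) * int (L i)" for u
        by (rule tau_bound[OF ij that(1)]) (use that(2) in \<open>simp only: Q_def\<close>)
      show "(2::nat) ^ i \<le> 2 ^ j" using ij by simp
      show "2 * 2 ^ j * L j + 2 * 2 ^ i * L i \<le> Q" by (simp only: Q_def)
    qed (use k k2 L_bounds nn mass_nonneg coeff_square_sum coeff_bounds fc_bounds tau_nonneg in auto)
    also have "18 * real (2 ^ i) * sqrt ((32 ^ k * K * mass j) * (32 ^ k * K * mass i))
        = 18 * (32 ^ k * K) * (2 ^ i * sqrt (mass j * mass i))"
    proof -
      have "(32 ^ k * K * mass j) * (32 ^ k * K * mass i) = (32 ^ k * K)\<^sup>2 * (mass j * mass i)"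
        by (simp add: power2_eq_square)
      then show ?thesis unfolding real_sqrt_mult[of "_\<^sup>2"] using nn by (simp only: real_sqrt_mult real_sqrt_abs) simp
    qed
    also have "\<dots> \<le> 18 * (32 ^ k * K) * ((1 / sqrt 2) ^ (j - i) * ((expected i + expected j) / 2))"
      using nn by (intro mult_left_mono sqrt_mass_product ij) auto
    also have "\<dots> = (9 * 32 ^ k * K) * (1 / sqrt 2) ^ (j - i) * (expected i + expected j)" by simp
    finally have le: "pair_sum i j \<le> (9 * 32 ^ k * K) * (1 / sqrt 2) ^ (j - i) * (expected i + expected j)
      + (4 ^ k * mass i) * (4 ^ k * mass j) * axis_bound CARD('n) (tau j) (real (L i)) (real (2 ^ i))
      + (4 ^ k * mass i) * (4 ^ k * mass j) * offdiag_bound CARD('n) (tau j) (real (L i)) (real (2 ^ i))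
        * (C\<^sub>\<mu> * real Q powr \<sigma>)" by simp
    have Sb: "0 \<le> 4 ^ k * mass i'" "4 ^ k * mass i' \<le> 4 ^ k * K / 2 ^ i'" for i'
      using mass_nonneg[of i'] mult_left_mono[OF mass_le[of i'], of "4 ^ k"] by auto
    have "real Q = 2 * 2 ^ j * real (L j) + 2 * 2 ^ i * real (L i)" by (simp add: Q_def)
    moreover have "real ((2::nat) ^ i) = 2 ^ i" by simp
    ultimately show ?thesis
      using le C[OF ij Sb Sb] unfolding k by (simp only:)
  qed
  have "2 powr (- \<delta>) < 1" using \<delta>0 by (simp add: powr_less_one)
  then show ?thesis
    using C0 main by (intro exI[of _ C] conjI exI[of _ "2 powr (- \<delta>)"]) auto
qed

text \<open>The kernels \<open>b\<close> are given only through their Fourier expansions, so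
  continuity, and with it measurability, is read off from there.\<close>

lemma continuous_count: "continuous_on UNIV (count i)"
proof -
  have "count i = (\<lambda>x. expected i + Re (\<Sum>s\<in>freq_pairs (2 ^ i) (L i).
     weight i s * ee (\<Sum>l\<in>UNIV. of_int (int (fst s) * snd s l) * x $ l)))"
    unfolding count_expansion[symmetric] by auto
  moreover have "continuous_on UNIV \<dots>"
    unfolding ee_def by (intro continuous_intros)
  ultimately show ?thesis by simp
qed

lemma measurable_count [measurable]: "count i \<in> borel_measurable \<mu>"
  using borel_measurable_continuous_onI[OF continuous_count] by (simp add: measurable_cong_sets[OF sets_mu refl])

lemma deviation_expansion:
  "of_real (\<Sum>i<X. count i x - expected i) = (\<Sum>t\<in>Sigma {..<X} (\<lambda>i. freq_pairs (2 ^ i) (L i)).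
     weight (fst t) (snd t) * ee (\<Sum>l\<in>UNIV. of_int (int (fst (snd t)) * snd (snd t) l) * x $ l))"
  unfolding of_real_sum count_expansion by (simp add: sum.Sigma case_prod_beta)

text \<open>Both claims come from reading the whole deviation as one trigonometric sum indexed by
  level, n and \<xi>.\<close>

lemma variance_bound:
  shows "integrable \<mu> (\<lambda>x. (\<Sum>i<X. count i x - expected i)\<^sup>2)"
    and "(\<integral>x. (\<Sum>i<X. count i x - expected i)\<^sup>2 \<partial>\<mu>) \<le> (\<Sum>i<X. \<Sum>j<X. pair_sum i j)"
proof -
  define I where "I = Sigma {..<X} (\<lambda>i. freq_pairs (2 ^ i) (L i) :: (nat \<times> ('n \<Rightarrow> int)) set)"
  define w where "w = (\<lambda>t :: nat \<times> nat \<times> ('n \<Rightarrow> int). weight (fst t) (snd t))"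
  define \<theta> where "\<theta> = (\<lambda>t :: nat \<times> nat \<times> ('n \<Rightarrow> int). \<lambda>l. int (fst (snd t)) * snd (snd t) l)"
  have finI: "finite I" by (simp add: I_def)
  have sq: "(\<Sum>i<X. count i x - expected i)\<^sup>2
      = (norm (\<Sum>t\<in>I. w t * ee (\<Sum>l\<in>UNIV. of_int (\<theta> t l) * x $ l)))\<^sup>2" for x
    unfolding I_def w_def \<theta>_def deviation_expansion[symmetric] by (simp only: norm_of_real power2_abs)
  show "integrable \<mu> (\<lambda>x. (\<Sum>i<X. count i x - expected i)\<^sup>2)"
  proof (rule integrable_bounded_borel[OF prob sets_mu])
    show "(\<lambda>x. (\<Sum>i<X. count i x - expected i)\<^sup>2) \<in> borel_measurable borel"
      by (intro borel_measurable_continuous_onI continuous_intros continuous_count)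
    show "norm ((\<Sum>i<X. count i x - expected i)\<^sup>2) \<le> (\<Sum>t\<in>I. norm (w t))\<^sup>2" for x
    proof -
      have "norm (\<Sum>t\<in>I. w t * ee (\<Sum>l\<in>UNIV. of_int (\<theta> t l) * x $ l)) \<le> (\<Sum>t\<in>I. norm (w t))"
        by (rule order_trans[OF norm_sum]) (simp add: norm_mult)
      then show ?thesis unfolding sq by (simp add: power_mono)
    qed
  qed
  have "(\<integral>x. (\<Sum>i<X. count i x - expected i)\<^sup>2 \<partial>\<mu>)
     \<le> (\<Sum>s\<in>I. \<Sum>t\<in>I. norm (w s) * norm (w t) * norm (fourier_coeff \<mu> (\<chi> l. \<theta> t l - \<theta> s l)))"
    unfolding sq by (rule trig_sum_square_integral_le[OF prob sets_mu finI])
  also have "\<dots> = (\<Sum>s\<in>I. \<Sum>t\<in>I. coeff (fst s) (snd (snd s)) * coeff (fst t) (snd (snd t)) * fc (freq_diff (snd s) (snd t)))"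
    by (intro sum.cong refl) (auto simp: w_def I_def \<theta>_def norm_weight fc_def freq_diff_def)
  also have "\<dots> = (\<Sum>i<X. \<Sum>s\<in>freq_pairs (2 ^ i) (L i). \<Sum>j<X. \<Sum>t\<in>freq_pairs (2 ^ j) (L j).
      coeff i (snd s) * coeff j (snd t) * fc (freq_diff s t))"
  proof -
    have "sum f I = (\<Sum>i<X. \<Sum>s\<in>freq_pairs (2 ^ i) (L i). f (i, s))" for f :: "nat \<times> nat \<times> ('n \<Rightarrow> int) \<Rightarrow> real"
      unfolding I_def by (subst sum.Sigma) auto
    then show ?thesis by simp
  qed
  also have "\<dots> = (\<Sum>i<X. \<Sum>j<X. pair_sum i j)"
    unfolding pair_sum_def by (intro sum.cong refl sum.swap)
  finally show "(\<integral>x. (\<Sum>i<X. count i x - expected i)\<^sup>2 \<partial>\<mu>) \<le> (\<Sum>i<X. \<Sum>j<X. pair_sum i j)" .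
qed

lemma AE_count_not_summable: "AE x in \<mu>. \<not> summable (\<lambda>i. count i x)"
proof -
  interpret prob_space \<mu> by (rule prob)
  obtain C q where C: "0 \<le> C" "0 < q" "q < 1" "\<And>i j. i \<le> j \<Longrightarrow>
     pair_sum i j \<le> (9 * 32 ^ k * K) * (1 / sqrt 2) ^ (j - i) * (expected i + expected j) + C * q ^ j"
    using pair_sum_bound by blast
  obtain B where B: "\<And>X. (\<Sum>i<X. \<Sum>j<X. pair_sum i j) \<le> B * (1 + (\<Sum>i<X. expected i))"
    using symmetric_double_sum_le[OF pair_sum_sym C(4) _ C(1) expected_nonneg _ _ C(2,3)] nn by auto
  show ?thesis
  proof (rule AE_not_summable_of_variance)
    show "\<not> summable expected" using diverges by (simp add: expected_def[abs_def] mass_def)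
    show "(\<integral>x. (\<Sum>i<X. count i x - expected i)\<^sup>2 \<partial>\<mu>) \<le> B * (1 + (\<Sum>i<X. expected i))" for X
      using variance_bound(2)[of X] B[of X] by linarith
  qed (use count_nonneg expected_nonneg variance_bound(1) in auto)
qed

text \<open>A block without hits contributes only kernel tails. The tail factor 2^(-(2k + 3)i)
  outweighs the peaks (L + 1)^k = O(2^(ki)), and the trivial count of terms weighted by volume is at
  most \<open>K\<close>, so what remains is summable over i.\<close>

lemma count_nonhit:
  assumes "\<And>n \<alpha>. n \<in> block (2 ^ i) \<Longrightarrow> \<alpha> \<in> A i \<Longrightarrow> \<not> hits \<alpha> y n x"
  shows "count i x \<le> K * (4 * real p) ^ k * (1 / 2) ^ i"
proof -
  define \<eta> :: real where "\<eta> = 1 / 2 ^ ((2 * k + 3) * i)"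
  have \<eta>: "1 / (real (M i) * \<alpha> l) ^ (2 * p) \<le> \<eta>" if a: "\<alpha> \<in> A i" for \<alpha> l
  proof -
    have "2 powr (real i * h) * 2 powr (- (real i * (1 / real k + \<epsilon>))) \<le> real (M i) * \<alpha> l"
      by (intro mult_mono M_bounds lo a) auto
    moreover have "real i * h + - (real i * (1 / real k + \<epsilon>)) = 2 * \<epsilon> * real i"
      by (simp add: h algebra_simps)
    ultimately have "2 powr (2 * \<epsilon> * real i) \<le> real (M i) * \<alpha> l"
      by (simp only: powr_add[symmetric])
    then have "(2 powr (2 * \<epsilon> * real i)) ^ (2 * p) \<le> (real (M i) * \<alpha> l) ^ (2 * p)"
      by (intro power_mono) auto
    moreover have "2 ^ ((2 * k + 3) * i) \<le> (2 powr (2 * \<epsilon> * real i)) ^ (2 * p)"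
    proof -
      have "(2 * real k + 3) * real i \<le> (4 * real p * \<epsilon>) * real i" by (intro mult_right_mono p) auto
      then have "2 powr real ((2 * k + 3) * i) \<le> 2 powr (2 * \<epsilon> * real i * real (2 * p))"
        by (intro powr_mono) (auto simp: algebra_simps)
      then show ?thesis by (simp only: powr_realpow powr_power mult.commute[of "real (2 * p)"])
    qed
    ultimately have "2 ^ ((2 * k + 3) * i) \<le> (real (M i) * \<alpha> l) ^ (2 * p)" by linarith
    moreover have "0 < real (M i) * \<alpha> l" using M_bounds(1)[of i] pos[OF a, of l] by simp
    ultimately show ?thesis unfolding \<eta>_def by (intro divide_left_mono) auto
  qed
  have "count i x \<le> (\<Sum>n\<in>block (2 ^ i). \<Sum>\<alpha>\<in>A i. \<psi> i * real (L i + 1) ^ CARD('n) * \<eta>)"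
    unfolding count_def
  proof (intro sum_mono)
    fix n \<alpha> assume n: "n \<in> block (2 ^ i)" and a: "\<alpha> \<in> A i"
    have "(\<Prod>l\<in>UNIV. b i (\<alpha> l) (real n * x $ l - y $ l)) \<le> (\<Prod>l\<in>UNIV. \<alpha> l) * real (L i + 1) ^ CARD('n) * \<eta>"
    proof (rule kernel_product_nonhit[OF assms[OF n a]])
      show "b i (\<alpha> l) t \<le> \<alpha> l * real (L i + 1) * \<eta>" if "\<alpha> l \<le> dnint t" for l t
      proof -
        have "b i (\<alpha> l) t \<le> \<alpha> l * real (L i + 1) * (1 / (real (M i) * \<alpha> l) ^ (2 * p))"
          using kernel(7)[OF a that] by simp
        also have "\<dots> \<le> \<alpha> l * real (L i + 1) * \<eta>"
          using pos[OF a, of l] by (intro mult_left_mono \<eta> a) auto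
        finally show ?thesis .
      qed
    qed (use kernel(5,6)[OF a] pos[OF a] in \<open>auto simp: \<eta>_def less_imp_le\<close>)
    then show "(\<Prod>l\<in>UNIV. b i (\<alpha> l) (real n * x $ l - y $ l)) \<le> \<psi> i * real (L i + 1) ^ CARD('n) * \<eta>"
      by (simp only: vol[OF a])
  qed
  also have "\<dots> = expected i * (real (L i + 1) ^ k * \<eta>)"
    by (simp add: expected_def mass_def k)
  also have "\<dots> \<le> K * ((4 * real p * 2 ^ i) ^ k * \<eta>)"
  proof -
    have "2 powr (real i * h) \<le> 2 powr (real i * 1)" using h_bounds by (intro powr_mono mult_left_mono) auto
    then have "2 * real p * 2 powr (real i * h) \<le> 2 * real p * 2 ^ i"
      by (intro mult_left_mono) (auto simp: powr_realpow)
    then have "real (L i + 1) \<le> 4 * real p * 2 ^ i"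
      using L_bounds[of i] by linarith
    then show ?thesis
      using total[of i] nn by (intro mult_mono power_mono mult_nonneg_nonneg) (auto simp: expected_def mass_def \<eta>_def)
  qed
  also have "\<dots> \<le> K * (4 * real p) ^ k * (1 / 2) ^ i"
  proof -
    have "(2 ^ i) ^ k * \<eta> = (1::real) / 2 ^ ((k + 3) * i)"
    proof -
      have "(2 * k + 3) * i = k * i + (k + 3) * i" by (simp add: algebra_simps)
      then have "(2::real) ^ ((2 * k + 3) * i) = (2 ^ i) ^ k * 2 ^ ((k + 3) * i)"
        by (simp only: power_add) (simp add: mult.commute flip: power_mult)
      then show ?thesis by (simp add: \<eta>_def)
    qed
    also have "\<dots> \<le> 1 / 2 ^ i" by (intro divide_left_mono power_increasing) auto
    finally have "(2 ^ i) ^ k * \<eta> \<le> (1 / 2) ^ i" by (simp add: power_divide)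
    then have "K * (4 * real p) ^ k * ((2 ^ i) ^ k * \<eta>) \<le> K * (4 * real p) ^ k * (1 / 2) ^ i"
      using nn by (intro mult_left_mono) auto
    then show ?thesis by (simp only: power_mult_distrib mult.assoc)
  qed
  finally show ?thesis .
qed

text \<open>With hits in only finitely many blocks, the counts would eventually lie below a
  convergent geometric series, against their almost sure divergence.\<close>

lemma AE_hits_aux:
  "AE x in \<mu>. infinite {i. \<exists>n\<in>block (2 ^ i). \<exists>\<alpha>\<in>A i. hits \<alpha> y n x}"
  using AE_count_not_summable
proof (rule AE_mp, intro AE_I2 impI)
  fix x assume ns: "\<not> summable (\<lambda>i. count i x)"
  show "infinite {i. \<exists>n\<in>block (2 ^ i). \<exists>\<alpha>\<in>A i. hits \<alpha> y n x}"
  proof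
    assume fin: "finite {i. \<exists>n\<in>block (2 ^ i). \<exists>\<alpha>\<in>A i. hits \<alpha> y n x}"
    then obtain m where m: "\<And>i. i \<in> {i. \<exists>n\<in>block (2 ^ i). \<exists>\<alpha>\<in>A i. hits \<alpha> y n x} \<Longrightarrow> i < m"
      by (meson finite_nat_set_iff_bounded)
    have "summable (\<lambda>i. count i x)"
    proof (rule summable_comparison_test'[of "\<lambda>i. K * (4 * real p) ^ k * (1 / 2) ^ i" m])
      show "summable (\<lambda>i. K * (4 * real p) ^ k * (1 / 2 :: real) ^ i)"
        by (intro summable_mult summable_geometric) auto
      show "norm (count i x) \<le> K * (4 * real p) ^ k * (1 / 2) ^ i" if "m \<le> i" for i
      proof -
        have "\<not> hits \<alpha> y n x" if "n \<in> block (2 ^ i)" "\<alpha> \<in> A i" for n \<alpha>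
          using m[of i] that \<open>m \<le> i\<close> by (metis (mono_tags, lifting) linorder_not_le mem_Collect_eq)
        then show ?thesis using count_nonhit[of i x] count_nonneg[of i x] by simp
      qed
    qed
    then show False using ns by blast
  qed
qed

end

theorem AE_hits: "AE x in \<mu>. infinite {i. \<exists>n\<in>block (2 ^ i). \<exists>\<alpha>\<in>A i. hits \<alpha> y n x}"
  using kernel_pair_exists AE_hits_aux by metis

end

section \<open>Measures of large $\ell^1$ dimension\<close>

lemma sum_fourier_floor:
  fixes \<mu> :: "(real ^ 'n::finite) measure"
  assumes "0 \<le> Q"
  shows "(\<Sum>\<xi>\<in>{\<xi>::int^'n. \<forall>j. real_of_int \<bar>\<xi> $ j\<bar> \<le> Q}. norm (fourier_coeff \<mu> \<xi>))
    = (\<Sum>\<zeta>\<in>freq_box (nat \<lfloor>Q\<rfloor>). norm (fourier_coeff \<mu> (\<chi> l. \<zeta> l)))"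
proof -
  have "real_of_int \<bar>z\<bar> \<le> Q \<longleftrightarrow> real_of_int \<bar>z\<bar> \<le> real (nat \<lfloor>Q\<rfloor>)" for z :: int
  proof -
    have "real_of_int \<bar>z\<bar> \<le> Q \<longleftrightarrow> \<bar>z\<bar> \<le> \<lfloor>Q\<rfloor>" by (simp add: le_floor_iff)
    also have "\<dots> \<longleftrightarrow> real_of_int \<bar>z\<bar> \<le> real_of_int \<lfloor>Q\<rfloor>" by (simp only: of_int_le_iff)
    also have "real_of_int \<lfloor>Q\<rfloor> = real (nat \<lfloor>Q\<rfloor>)" using assms by simp
    finally show ?thesis .
  qed
  then show ?thesis unfolding sum_freq_box_fourier by simp
qed

lemma fourier_coeff_0:
  fixes \<mu> :: "(real ^ 'n::finite) measure"
  assumes "prob_space \<mu>"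
  shows "fourier_coeff \<mu> 0 = 1"
proof -
  interpret prob_space \<mu> by fact
  show ?thesis by (simp add: fourier_coeff_def prob_space)
qed

text \<open>An admissible s > d is taken from below the supremum and \<sigma> = k - s. The frequency
  0 contributes 1 to every sum, so the sums cannot decay, which gives \<sigma> \<ge> 0.\<close>

lemma l1_dim_exponent:
  fixes \<mu> :: "(real ^ 'n::finite) measure"
  assumes \<mu>: "prob_space \<mu>" and dim: "l1_dim \<mu> > d" 
  obtains \<sigma> C where "0 \<le> \<sigma>" "\<sigma> < real CARD('n) - d" "0 \<le> C"
    "\<forall>Q::nat. 1 \<le> Q \<longrightarrow> (\<Sum>\<zeta>\<in>freq_box Q. norm (fourier_coeff \<mu> (\<chi> l. \<zeta> l))) \<le> C * real Q powr \<sigma>"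
proof -
  define k where "k = real CARD('n)"
  define F where "F Q = (\<Sum>\<zeta>\<in>freq_box Q. norm (fourier_coeff \<mu> (\<chi> l. \<zeta> l)))" for Q
  define S where "S = {s. s \<ge> 0 \<and> (\<exists>C. \<forall>Q::real. Q \<ge> 1 \<longrightarrow>
      (\<Sum>\<xi>\<in>{\<xi>::int^'n. \<forall>j. real_of_int \<bar>\<xi> $ j\<bar> \<le> Q}. norm (fourier_coeff \<mu> \<xi>)) \<le> C * Q powr (k - s))}"
  \<comment> \<open>A nonempty set is what \<open>less_cSupE\<close> asks for. The value s = 0
    qualifies because coefficients are at most 1 and a box contains O(Q^k) frequencies.\<close>
  have "0 \<in> S"
  proof -
    have "(\<Sum>\<xi>\<in>{\<xi>::int^'n. \<forall>j. real_of_int \<bar>\<xi> $ j\<bar> \<le> Q}. norm (fourier_coeff \<mu> \<xi>)) \<le> 3 ^ CARD('n) * Q powr (k - 0)"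
      if Q: "Q \<ge> 1" for Q
    proof -
      define R where "R = nat \<lfloor>Q\<rfloor>"
      have R: "1 \<le> R" "real R \<le> Q" using Q by (auto simp: R_def le_nat_iff le_floor_iff)
      have "F R \<le> (\<Sum>\<zeta>\<in>(freq_box R :: ('n \<Rightarrow> int) set). 1)"
        unfolding F_def by (intro sum_mono norm_fourier_coeff_le_1 \<mu>)
      also have "\<dots> = real (card (freq_box R :: ('n \<Rightarrow> int) set))" by simp
      also have "card (freq_box R :: ('n \<Rightarrow> int) set) = (2 * R + 1) ^ CARD('n)"
        unfolding freq_box_PiE by (subst card_PiE) (auto simp: nat_add_distrib nat_mult_distrib)
      also have "real ((2 * R + 1) ^ CARD('n)) \<le> (3 * Q) ^ CARD('n)"
        unfolding of_nat_power using R by (intro power_mono) auto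
      also have "\<dots> = 3 ^ CARD('n) * Q powr (k - 0)"
        using Q by (simp add: power_mult_distrib k_def powr_realpow)
      finally show ?thesis using Q unfolding R_def F_def by (subst sum_fourier_floor) auto
    qed
    then show ?thesis unfolding S_def by blast
  qed
  then obtain s where s: "s \<in> S" "d < s"
    using dim less_cSupE[of d S] unfolding l1_dim_def S_def k_def by blast
  then obtain C where C: "\<And>Q. Q \<ge> 1 \<Longrightarrow>
      (\<Sum>\<xi>\<in>{\<xi>::int^'n. \<forall>j. real_of_int \<bar>\<xi> $ j\<bar> \<le> Q}. norm (fourier_coeff \<mu> \<xi>)) \<le> C * Q powr (k - s)"
    unfolding S_def by blast
  have F: "F Q \<le> C * real Q powr (k - s)" if "1 \<le> Q" for Q :: nat
    using C[of "real Q"] that unfolding F_def sum_freq_box_fourier by simp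
  have F1: "1 \<le> F Q" for Q
  proof -
    have "(\<chi> l. (0::int)) = (0 :: int ^ 'n)" by (simp add: vec_eq_iff)
    then have "norm (fourier_coeff \<mu> (\<chi> l. (\<lambda>_. 0) l)) = 1" using fourier_coeff_0[OF \<mu>] by simp
    moreover have "norm (fourier_coeff \<mu> (\<chi> l. (\<lambda>_. 0) l)) \<le> F Q"
      unfolding F_def by (rule member_le_sum) (auto simp: freq_box_iff simp del: finite_freq_box intro: finite_freq_box)
    ultimately show ?thesis by simp
  qed
  have Cpos: "1 \<le> C" using F[of 1] F1[of 1] by simp
  have "s \<le> k"
  proof (rule ccontr)
    assume "\<not> s \<le> k"
    then have neg: "k - s < 0" by simp
    have "((\<lambda>Q::nat. C * real Q powr (k - s)) \<longlongrightarrow> C * 0) sequentially"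
      by (intro tendsto_intros tendsto_neg_powr[OF neg] filterlim_real_sequentially)
    moreover have "eventually (\<lambda>Q. 1 \<le> C * real Q powr (k - s)) sequentially"
      using eventually_ge_at_top[of 1] by eventually_elim (use F F1 in \<open>meson order_trans\<close>)
    ultimately have "1 \<le> C * 0" by (intro tendsto_lowerbound[of _ _ sequentially 1]) auto
    then show False by simp
  qed
  show ?thesis
    by (rule that[of "k - s" C]) (use \<open>s \<le> k\<close> s Cpos F in \<open>auto simp: F_def k_def\<close>)
qed

text \<open>Wiener's argument: the average of the characters e(m x_l) over m < M is 1 on the
  hyperplane, while its second moment is at most M^(-2) M C M^\<sigma>, which tends to 0. This
  bridges the closed cube carrying \<mu> and the half-open cube containing the limsup sets.\<close>

lemma AE_coordinate_neq_1:
  fixes \<mu> :: "(real ^ 'n::finite) measure"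
  assumes \<mu>: "prob_space \<mu>" "sets \<mu> = sets borel" and \<sigma>: "\<sigma> < 1"
    and fourier: "\<And>Q::nat. 1 \<le> Q \<Longrightarrow> (\<Sum>\<zeta>\<in>freq_box Q. norm (fourier_coeff \<mu> (\<chi> l. \<zeta> l))) \<le> C * real Q powr \<sigma>"
  shows "AE x in \<mu>. x $ l \<noteq> 1"
proof -
  interpret prob_space \<mu> by fact
  define H where "H = {x :: real ^ 'n. x $ l = 1}"
  have Hm: "H \<in> sets \<mu>" unfolding \<mu>(2) H_def by measurable
  have bound: "prob H \<le> C * real M powr (\<sigma> - 1)" if M: "1 \<le> M" for M :: nat
  proof -
    define \<theta> where "\<theta> m j = (if j = l then int m else 0)" for m :: nat and j
    define f where "f x = (norm (\<Sum>m<M. of_real (1 / real M) * ee (\<Sum>j\<in>UNIV. of_int (\<theta> m j) * x $ j)))\<^sup>2" for x :: "real ^ 'n"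
    have \<theta>x: "(\<Sum>j\<in>UNIV. of_int (\<theta> m j) * x $ j) = real m * x $ l" for m x
      by (simp add: \<theta>_def if_distrib[of "\<lambda>z. z * _"] if_distrib[of of_int] cong: if_cong)
    have fH: "f x = 1" if "x \<in> H" for x
    proof -
      have "ee (real m * x $ l) = 1" for m using that ee_of_int[of "int m"] by (simp add: H_def)
      then show ?thesis using M by (simp add: f_def \<theta>x)
    qed
    have "prob H = (\<integral>x. indicator H x \<partial>\<mu>)" using Hm by simp
    also have "\<dots> \<le> (\<integral>x. f x \<partial>\<mu>)"
    proof (rule integral_mono)
      show "integrable \<mu> (indicat_real H)" using Hm by (simp add: integrable_indicator_iff emeasure_eq_measure)
      show "integrable \<mu> f"
      proof (rule integrable_bounded_borel[OF \<mu>])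
        show "f \<in> borel_measurable borel" unfolding f_def ee_def
          by (intro borel_measurable_continuous_onI continuous_intros)
        show "norm (f x) \<le> 1" for x
        proof -
          have "norm (\<Sum>m<M. of_real (1 / real M) * ee (\<Sum>j\<in>UNIV. of_int (\<theta> m j) * x $ j)) \<le> 1"
            by (rule order_trans[OF norm_sum]) (use M in \<open>simp add: norm_mult norm_divide\<close>)
          then show ?thesis unfolding f_def by (simp add: power_le_one)
        qed
      qed
      show "indicat_real H x \<le> f x" for x
        using fH[of x] by (auto simp: indicator_def f_def)
    qed
    also have "\<dots> \<le> (\<Sum>m<M. \<Sum>m'<M. norm (complex_of_real (1 / real M)) * norm (complex_of_real (1 / real M))
        * norm (fourier_coeff \<mu> (\<chi> j. \<theta> m' j - \<theta> m j)))"
      unfolding f_def by (rule trig_sum_square_integral_le[OF \<mu>]) auto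
    also have "\<dots> \<le> (\<Sum>m<M. 1 / real M * (1 / real M) * (C * real M powr \<sigma>))"
    proof (rule sum_mono)
      fix m assume m: "m \<in> {..<M}"
      let ?g = "\<lambda>m' j. \<theta> m' j - \<theta> m j"
      have inj: "inj_on ?g {..<M}"
      proof (rule inj_onI)
        fix a b assume "?g a = ?g b"
        then have "?g a l = ?g b l" by (rule fun_cong)
        then show "a = b" by (simp add: \<theta>_def)
      qed
      have "(\<Sum>m'<M. norm (fourier_coeff \<mu> (\<chi> j. \<theta> m' j - \<theta> m j)))
          = (\<Sum>\<zeta>\<in>?g ` {..<M}. norm (fourier_coeff \<mu> (\<chi> j. \<zeta> j)))"
        using sum.reindex[OF inj, of "\<lambda>\<zeta>. norm (fourier_coeff \<mu> (\<chi> j. \<zeta> j))"] by (simp add: o_def)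
      also have "\<dots> \<le> (\<Sum>\<zeta>\<in>freq_box M. norm (fourier_coeff \<mu> (\<chi> j. \<zeta> j)))"
        using m by (intro sum_mono2) (auto simp: freq_box_iff \<theta>_def)
      also have "\<dots> \<le> C * real M powr \<sigma>" by (rule fourier[OF M])
      finally have "1 / real M * (1 / real M) * (\<Sum>m'<M. norm (fourier_coeff \<mu> (\<chi> j. \<theta> m' j - \<theta> m j)))
         \<le> 1 / real M * (1 / real M) * (C * real M powr \<sigma>)" by (intro mult_left_mono) auto
      then show "(\<Sum>m'<M. norm (complex_of_real (1 / real M)) * norm (complex_of_real (1 / real M))
        * norm (fourier_coeff \<mu> (\<chi> j. \<theta> m' j - \<theta> m j))) \<le> 1 / real M * (1 / real M) * (C * real M powr \<sigma>)"
        by (simp add: sum_divide_distrib norm_divide)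
    qed
    also have "\<dots> = C * real M powr (\<sigma> - 1)" using M by (simp add: powr_diff)
    finally show ?thesis .
  qed
  have "((\<lambda>M::nat. C * real M powr (\<sigma> - 1)) \<longlongrightarrow> C * 0) sequentially"
    using \<sigma> by (intro tendsto_intros tendsto_neg_powr filterlim_real_sequentially) auto
  then have "prob H \<le> C * 0"
    by (rule tendsto_lowerbound) (auto intro!: eventually_mono[OF eventually_ge_at_top[of 1]] bound)
  then have "prob H = 0" using measure_nonneg[of \<mu> H] by simp
  then have "AE x in \<mu>. x \<notin> H" using Hm by (intro AE_not_in) (auto simp: null_sets_def emeasure_eq_measure)
  then show ?thesis by (simp add: H_def)
qed

text \<open>What \<open>box_system\<close> asks of the boxes, separated from the measure: \<epsilon>
  is fixed by the measure first, and the boxes are built for that \<epsilon> afterwards.\<close>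

definition box_family :: "real \<Rightarrow> real \<Rightarrow> (nat \<Rightarrow> ('n::finite \<Rightarrow> real) set) \<Rightarrow> (nat \<Rightarrow> real) \<Rightarrow> bool" where
  "box_family \<epsilon> K A \<psi> \<longleftrightarrow> 0 \<le> K \<and> (\<forall>i. finite (A i) \<and> 2 ^ i * (real (card (A i)) * \<psi> i) \<le> K) \<and>
     (\<forall>i. \<forall>\<alpha>\<in>A i. (\<forall>l. 2 powr (- (real i * (1 / real CARD('n) + \<epsilon>))) \<le> \<alpha> l \<and> \<alpha> l \<le> 1) \<and>
        (\<Prod>l\<in>UNIV. \<alpha> l) = \<psi> i \<and> (\<Sum>\<alpha>'\<in>A i. \<Prod>l\<in>UNIV. min (\<alpha> l) (\<alpha>' l)) \<le> K * \<psi> i)"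

definition box_hitting :: "(real ^ 'n::finite) measure \<Rightarrow> real \<Rightarrow> bool" where
  "box_hitting \<mu> \<epsilon> \<longleftrightarrow> (\<forall>K A \<psi> y. box_family \<epsilon> K A \<psi> \<longrightarrow>
     \<not> summable (\<lambda>i. 2 ^ i * (real (card (A i)) * \<psi> i)) \<longrightarrow>
     (AE x in \<mu>. infinite {i. \<exists>n\<in>block (2 ^ i). \<exists>\<alpha>\<in>A i. hits \<alpha> y n x}))"

lemma box_hitting_exists:
  fixes \<mu> :: "(real ^ 'n::finite) measure"
  assumes \<mu>: "prob_space \<mu>" "sets \<mu> = sets borel" and k2: "2 \<le> CARD('n)"
    and \<sigma>: "0 \<le> \<sigma>" "\<sigma> < (real CARD('n) - 1) / (real CARD('n) + 1)" and C: "0 \<le> C"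
    and fourier: "\<And>Q::nat. 1 \<le> Q \<Longrightarrow> (\<Sum>\<zeta>\<in>freq_box Q. norm (fourier_coeff \<mu> (\<chi> l. \<zeta> l))) \<le> C * real Q powr \<sigma>"
  obtains \<epsilon> where "0 < \<epsilon>" "\<epsilon> \<le> 1 / (6 * real CARD('n) ^ 2)"
    "box_hitting \<mu> \<epsilon>"
proof -
  define k where "k = CARD('n)"
  \<comment> \<open>The slack in the dimension hypothesis. Both \<epsilon> and \<open>p\<close> are
    chosen from it and k alone, so they serve all box families and shifts.\<close>
  define \<kappa> where "\<kappa> = (real k - 1) / (real k + 1) - \<sigma>"
  define \<epsilon> where "\<epsilon> = min (\<kappa> / 20) (1 / (6 * real k ^ 2))"
  have \<kappa>: "0 < \<kappa>" using \<sigma> by (simp add: \<kappa>_def k_def)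
  have \<epsilon>: "0 < \<epsilon>" "\<epsilon> \<le> \<kappa> / 20" "\<epsilon> \<le> 1 / (6 * real k ^ 2)"
    using \<kappa> k2 by (auto simp: \<epsilon>_def k_def)
  define p where "p = nat \<lceil>(2 * real k + 3) / (4 * \<epsilon>)\<rceil> + 1"
  have p: "1 \<le> p" "2 * real k + 3 \<le> 4 * real p * \<epsilon>"
  proof -
    have "(2 * real k + 3) / (4 * \<epsilon>) \<le> real p" unfolding p_def by linarith
    then show "2 * real k + 3 \<le> 4 * real p * \<epsilon>" using \<epsilon>(1) by (simp add: field_simps)
  qed (simp add: p_def)
  obtain C\<^sub>\<tau> where C\<^sub>\<tau>: "1 \<le> C\<^sub>\<tau>" "\<And>n::nat. 1 \<le> n \<Longrightarrow> real (card {d. d dvd n}) \<le> C\<^sub>\<tau> * real n powr \<epsilon>"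
    using divisor_count_bound[OF \<epsilon>(1)] by blast
  show ?thesis
  proof (rule that[of \<epsilon>])
    show "0 < \<epsilon>" "\<epsilon> \<le> 1 / (6 * real CARD('n) ^ 2)" using \<epsilon> by (auto simp: k_def)
    show "box_hitting \<mu> \<epsilon>" unfolding box_hitting_def
    proof (intro allI impI)
      fix K :: real and A :: "nat \<Rightarrow> ('n \<Rightarrow> real) set" and \<psi> :: "nat \<Rightarrow> real" and y :: "real ^ 'n"
      assume fam: "box_family \<epsilon> K A \<psi>" and div: "\<not> summable (\<lambda>i. 2 ^ i * (real (card (A i)) * \<psi> i))"
      have *: "0 \<le> K" "\<And>i. finite (A i)"
        "\<And>i \<alpha> l. \<alpha> \<in> A i \<Longrightarrow> 2 powr (- (real i * (1 / real CARD('n) + \<epsilon>))) \<le> \<alpha> l"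
        "\<And>i \<alpha> l. \<alpha> \<in> A i \<Longrightarrow> \<alpha> l \<le> 1"
        "\<And>i \<alpha>. \<alpha> \<in> A i \<Longrightarrow> (\<Prod>l\<in>UNIV. \<alpha> l) = \<psi> i"
        "\<And>i. 2 ^ i * (real (card (A i)) * \<psi> i) \<le> K"
        "\<And>i \<alpha>. \<alpha> \<in> A i \<Longrightarrow> (\<Sum>\<alpha>'\<in>A i. \<Prod>l\<in>UNIV. min (\<alpha> l) (\<alpha>' l)) \<le> K * \<psi> i"
        using fam unfolding box_family_def by blast+
      have "\<sigma> \<le> (real k - 1) / (real k + 1) - \<kappa>" "0 \<le> C\<^sub>\<tau>" "2 \<le> k" using C\<^sub>\<tau>(1) k2 by (auto simp: \<kappa>_def k_def)
      then interpret box_system \<mu> k \<sigma> \<kappa> \<epsilon> "1 / real k + 3 * \<epsilon>" K C\<^sub>\<tau> C p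
        "\<lambda>i. nat \<lceil>2 powr (real i * (1 / real k + 3 * \<epsilon>))\<rceil>"
        "\<lambda>i. p * nat \<lceil>2 powr (real i * (1 / real k + 3 * \<epsilon>))\<rceil>" A \<psi> y
        by (intro box_system.intro \<mu> \<sigma>(1) \<kappa> \<epsilon> p C fourier C\<^sub>\<tau>(2) *[folded k_def] div refl) (simp_all add: k_def)
      show "AE x in \<mu>. infinite {i. \<exists>n\<in>block (2 ^ i). \<exists>\<alpha>\<in>A i. hits \<alpha> y n x}"
        by (rule AE_hits)
    qed
  qed
qed

section \<open>The divergence theorems\<close>

lemma borel_measurable_dnint [measurable]: "dnint \<in> borel_measurable borel"
proof -
  have eq: "dnint = (\<lambda>x. \<bar>x - of_int \<lfloor>x + 1 / 2\<rfloor>\<bar>)"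
    by (simp add: dnint_def[abs_def] round_def)
  show ?thesis unfolding eq by measurable
qed

lemma unit_cube_ho_borel [measurable]: "(unit_cube_ho :: (real ^ 'n::finite) set) \<in> sets borel"
  unfolding unit_cube_ho_def by measurable

lemma Max_range_less_iff: "Max (range f) < c \<longleftrightarrow> (\<forall>j. f j < c)" for f :: "'n::finite \<Rightarrow> real"
  by (subst Max_less_iff) auto

lemma infinite_nat_set_borel:
  fixes P :: "nat \<Rightarrow> (real ^ 'n::finite) \<Rightarrow> bool"
  assumes [measurable]: "\<And>n. Measurable.pred borel (P n)"
  shows "{x \<in> unit_cube_ho. infinite {n. P n x}} \<in> sets borel"
proof -
  have "{x \<in> unit_cube_ho. infinite {n. P n x}} = {x. x \<in> unit_cube_ho \<and> (\<forall>m. \<exists>n. m < n \<and> P n x)}"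
    by (auto simp: infinite_nat_iff_unbounded)
  also have "\<dots> \<in> sets borel" by measurable
  finally show ?thesis .
qed

lemma W_simul_borel: "W_simul \<psi> y \<in> sets borel"
  unfolding W_simul_def Max_range_less_iff by (rule infinite_nat_set_borel) measurable

lemma W_mult_borel: "W_mult \<psi> y \<in> sets borel"
  unfolding W_mult_def by (rule infinite_nat_set_borel) measurable

lemma infinite_blocks:
  assumes "infinite {i. \<exists>n\<in>block (2 ^ i). P n}" and "\<And>n. P n \<Longrightarrow> Q n"
  shows "infinite {n::nat. n \<ge> 1 \<and> Q n}"
proof
  assume "finite {n::nat. n \<ge> 1 \<and> Q n}"
  then obtain m where m: "\<And>n. n \<ge> 1 \<Longrightarrow> Q n \<Longrightarrow> n < m" by (auto simp: finite_nat_set_iff_bounded)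
  obtain i where i: "m < i" "\<exists>n\<in>block (2 ^ i). P n"
    using assms(1) unfolding infinite_nat_iff_unbounded by blast
  then obtain n where n: "2 ^ i \<le> n" "P n" by (auto simp: block_def)
  have "i < 2 ^ i" by (rule less_exp)
  then have "m < n" using i n by linarith
  moreover have "n \<ge> 1" using n(1) by (meson one_le_numeral one_le_power order_trans)
  ultimately show False using m[of n] assms(2)[OF n(2)] by simp
qed

text \<open>One half of Cauchy condensation. It is stated with a majorant \<open>u\<close> on
  blocks, so that the logarithm in the Gallagher series can be bounded together with the monotone
  factor.\<close>

lemma not_summable_blocks:
  fixes f u :: "nat \<Rightarrow> real"
  assumes f0: "\<And>n. 1 \<le> n \<Longrightarrow> 0 \<le> f n" and fu: "\<And>i n. n \<in> block (2 ^ i) \<Longrightarrow> f n \<le> u i"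
    and div: "\<not> summable (\<lambda>n. f (Suc n))"
  shows "\<not> summable (\<lambda>i. 2 ^ i * u i)"
proof
  assume s: "summable (\<lambda>i. 2 ^ i * u i)"
  have u0: "0 \<le> u i" for i
    using f0[of "2 ^ i"] fu[of "2 ^ i" i] by (fastforce simp: block_def)
  have part: "(\<Sum>n\<in>{1..<2 ^ X}. f n) \<le> (\<Sum>i<X. 2 ^ i * u i)" for X
  proof (induction X)
    case (Suc X)
    have split: "{1..<2 ^ Suc X} = {1..<2 ^ X} \<union> block (2 ^ X)"
    proof -
      have "(1::nat) \<le> 2 ^ X" by simp
      then show ?thesis by (auto simp: block_def)
    qed
    have "(\<Sum>n\<in>{1..<2 ^ Suc X}. f n) = (\<Sum>n\<in>{1..<2 ^ X}. f n) + (\<Sum>n\<in>block (2 ^ X). f n)"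
      unfolding split by (rule sum.union_disjoint) (auto simp: block_def)
    also have "(\<Sum>n\<in>block (2 ^ X). f n) \<le> (\<Sum>n\<in>block (2 ^ X). u X)" by (intro sum_mono fu)
    finally show ?case using Suc.IH by simp
  qed simp
  have "(\<Sum>n<X. f (Suc n)) \<le> (\<Sum>i. 2 ^ i * u i)" for X
  proof -
    have "(\<Sum>n<X. f (Suc n)) = (\<Sum>n\<in>{1..X}. f n)"
      by (rule sum.reindex_bij_witness[of _ "\<lambda>n. n - 1" Suc]) auto
    also have "\<dots> \<le> (\<Sum>n\<in>{1..<2 ^ X}. f n)"
      using less_exp[of X] f0 by (intro sum_mono2) (auto simp del: less_exp intro: le_less_trans)
    also have "\<dots> \<le> (\<Sum>i<X. 2 ^ i * u i)" by (rule part)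
    also have "\<dots> \<le> (\<Sum>i. 2 ^ i * u i)" using u0 by (intro sum_le_suminf s) auto
    finally show ?thesis .
  qed
  then have "summable (\<lambda>n. f (Suc n))" using f0 by (intro summableI_nonneg_bounded) auto
  then show False using div by blast
qed

lemma admissible_psi_block:
  assumes "admissible_psi \<psi>" "n \<in> block (2 ^ i)"
  shows "\<psi> n \<le> \<psi> (2 ^ i)" "\<psi> (2 ^ Suc i) \<le> \<psi> n" "0 \<le> \<psi> n"
proof -
  have "1 \<le> (2::nat) ^ i" "2 ^ i \<le> n" "1 \<le> n" "n \<le> 2 ^ Suc i"
    using assms(2) one_le_power[of "2::nat" i] by (auto simp: block_def)
  then show "\<psi> n \<le> \<psi> (2 ^ i)" "\<psi> (2 ^ Suc i) \<le> \<psi> n" "0 \<le> \<psi> n"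
    using assms(1) unfolding admissible_psi_def by blast+
qed

text \<open>If the truncated series converged, its terms would eventually be below 1, where
  truncation changes nothing.\<close>

lemma not_summable_min_one:
  fixes a :: "nat \<Rightarrow> real"
  assumes a0: "\<And>i. 0 \<le> a i" and div: "\<not> summable a"
  shows "\<not> summable (\<lambda>i. min (a i) 1)"
proof
  assume s: "summable (\<lambda>i. min (a i) 1)"
  have "eventually (\<lambda>i. min (a i) 1 < 1) sequentially"
    using summable_LIMSEQ_zero[OF s] by (rule order_tendstoD) auto
  then have "eventually (\<lambda>i. norm (a i) \<le> min (a i) 1) sequentially"
    by eventually_elim (use a0 in \<open>auto simp: min_def split: if_splits\<close>)
  then have "summable a" by (rule summable_comparison_test_ev) (rule s)
  then show False using div by blast
qed

lemma not_summable_drop: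
  fixes a b :: "nat \<Rightarrow> real"
  assumes "\<not> summable a" "summable b" "\<And>i. 0 \<le> a i" "\<And>i. \<not> P i \<Longrightarrow> a i \<le> b i" "\<And>i. 0 \<le> b i"
  shows "\<not> summable (\<lambda>i. if P i then a i else 0)"
proof
  assume s: "summable (\<lambda>i. if P i then a i else 0)"
  have "summable a"
  proof (rule summable_comparison_test'[OF summable_add[OF s assms(2)]])
    show "norm (a i) \<le> (if P i then a i else 0) + b i" if "i \<ge> 0" for i
      using assms(3-5)[of i] by auto
  qed
  then show False using assms(1) by blast
qed

lemma summable_two_powr_neg:
  assumes "0 < c"
  shows "summable (\<lambda>i. 2 powr (- (real i * c)))"
proof -
  have "(\<lambda>i. 2 powr (- (real i * c))) = (\<lambda>i. (2 powr (- c)) ^ i)"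
    by (auto simp: powr_power mult.commute)
  moreover have "summable (\<lambda>i. (2 powr (- c)) ^ i)"
    using assms by (intro summable_geometric) (simp add: powr_less_one)
  ultimately show ?thesis by simp
qed

section \<open>The Khinchin theorem: one cube per level\<close>

lemma box_hitting_imp_Khinchin:
  fixes \<mu> :: "(real ^ 'n::finite) measure"
  assumes \<mu>: "prob_space \<mu>" "sets \<mu> = sets borel" and k2: "2 \<le> CARD('n)"
    and cube: "AE x in \<mu>. x \<in> unit_cube_ho"
    and \<epsilon>: "0 < \<epsilon>" "\<epsilon> \<le> 1 / (6 * real CARD('n) ^ 2)" and hit: "box_hitting \<mu> \<epsilon>"
  shows "inhom_div_Khinchin \<mu>"
  unfolding inhom_div_Khinchin_def
proof (intro allI impI conjI)
  fix \<psi> :: "nat \<Rightarrow> real" and y :: "real ^ 'n"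
  assume adm: "admissible_psi \<psi>" and div: "\<not> summable (\<lambda>n. \<psi> (Suc n) ^ CARD('n))"
  define k where "k = CARD('n)"
  have k0: "0 < real k" using k2 by (simp add: k_def)
  \<comment> \<open>The value just past block i is a minorant of \<psi> on the block, so a hit of
    the cube is a solution for the actual \<psi>(n). After condensation this costs a shift of the
    index by one.\<close>
  define q where "q i = \<psi> (2 ^ Suc i)" for i
  have q: "0 \<le> q i" "q i < 1" for i
    using adm by (auto simp: admissible_psi_def q_def)
  note block_le = admissible_psi_block[OF adm]
  \<comment> \<open>Capping the side at 2^(-i/k) caps the expected hits of a block at 1.\<close>
  define r where "r i = 2 powr (- (real i / real k))" for i :: nat
  define \<beta> where "\<beta> i = min (q i) (r i)" for i
  \<comment> \<open>The lower bound on sides demanded by \<open>box_family\<close>. A level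
    violating it has at most 2^(-ik\<epsilon>) expected hits, a summable loss, and gets no
    box.\<close>
  define P where "P i \<longleftrightarrow> 2 powr (- (real i * (1 / real k + \<epsilon>))) \<le> \<beta> i" for i
  define A where "A i = (if P i then {\<lambda>_::'n. \<beta> i} else {})" for i
  have \<beta>: "0 \<le> \<beta> i" "\<beta> i \<le> 1" for i using q[of i] by (auto simp: \<beta>_def r_def)
  have rk: "2 ^ i * r i ^ k = 1" for i
  proof -
    have "r i ^ k = 2 powr (- (real i / real k) * real k)" by (simp add: r_def powr_power)
    also have "- (real i / real k) * real k = - real i" using k0 by simp
    finally show ?thesis by (simp add: powr_minus powr_realpow)
  qed
  have \<beta>k: "2 ^ i * \<beta> i ^ k = min (2 ^ i * q i ^ k) 1" for i
  proof (cases "q i \<le> r i")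
    case True
    then have "q i ^ k \<le> r i ^ k" using q by (intro power_mono) auto
    then have "2 ^ i * q i ^ k \<le> 2 ^ i * r i ^ k" by simp
    then show ?thesis using True rk[of i] by (simp add: \<beta>_def)
  next
    case False
    then have "r i ^ k \<le> q i ^ k" by (intro power_mono) (auto simp: r_def)
    then have "2 ^ i * r i ^ k \<le> 2 ^ i * q i ^ k" by simp
    then show ?thesis using False rk[of i] by (simp add: \<beta>_def)
  qed
  have div1: "\<not> summable (\<lambda>i. 2 ^ i * \<psi> (2 ^ i) ^ k)"
  proof (rule not_summable_blocks[where f = "\<lambda>n. \<psi> n ^ k"])
    show "\<psi> n ^ k \<le> \<psi> (2 ^ i) ^ k" if "n \<in> block (2 ^ i)" for i n
      using block_le(1,3)[OF that] by (rule power_mono)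
  qed (use adm div in \<open>auto simp: admissible_psi_def k_def\<close>)
  have div2: "\<not> summable (\<lambda>i. 2 ^ i * q i ^ k)"
  proof
    assume "summable (\<lambda>i. 2 ^ i * q i ^ k)"
    from summable_mult[OF this, of 2] have "summable (\<lambda>i. 2 ^ Suc i * \<psi> (2 ^ Suc i) ^ k)"
      by (simp add: q_def mult.assoc)
    then show False using div1 summable_Suc_iff[of "\<lambda>i. 2 ^ i * \<psi> (2 ^ i) ^ k"] by blast
  qed
  have div3: "\<not> summable (\<lambda>i. if P i then 2 ^ i * \<beta> i ^ k else 0)"
  proof (rule not_summable_drop)
    show "\<not> summable (\<lambda>i. 2 ^ i * \<beta> i ^ k)"
      unfolding \<beta>k using q div2 by (intro not_summable_min_one) auto
    show "summable (\<lambda>i. 2 powr (- (real i * (real k * \<epsilon>))))"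
      using k0 \<epsilon> by (intro summable_two_powr_neg) auto
    show "2 ^ i * \<beta> i ^ k \<le> 2 powr (- (real i * (real k * \<epsilon>)))" if "\<not> P i" for i
    proof -
      have "\<beta> i ^ k \<le> (2 powr (- (real i * (1 / real k + \<epsilon>)))) ^ k"
        using that \<beta> by (intro power_mono) (auto simp: P_def)
      also have "\<dots> = 2 powr (- real i - real i * (real k * \<epsilon>))"
      proof -
        have "real k * - (real i * (1 / real k + \<epsilon>)) = - real i - real i * (real k * \<epsilon>)"
          using k0 by (simp add: field_simps)
        then show ?thesis by (simp only: powr_power)
      qed
      finally have "2 ^ i * \<beta> i ^ k \<le> 2 powr real i * 2 powr (- real i - real i * (real k * \<epsilon>))"
        by (simp add: powr_realpow)
      then show ?thesis by (simp add: powr_add[symmetric])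
    qed
  qed (use \<beta> in auto)
  have eq: "2 ^ i * (real (card (A i)) * \<beta> i ^ k) = (if P i then 2 ^ i * \<beta> i ^ k else 0)" for i
    by (simp add: A_def)
  have "AE x in \<mu>. infinite {i. \<exists>n\<in>block (2 ^ i). \<exists>\<alpha>\<in>A i. hits \<alpha> y n x}"
  proof (rule hit[unfolded box_hitting_def, rule_format])
    have "2 ^ i * (real (card (A i)) * \<beta> i ^ k) \<le> 1" for i
      unfolding eq using \<beta>k[of i] by simp
    moreover have "2 powr (- (real i * (1 / real CARD('n) + \<epsilon>))) \<le> \<alpha> l" if "\<alpha> \<in> A i" for i \<alpha> l
      using that unfolding A_def P_def k_def by (auto split: if_splits)
    ultimately show "box_family \<epsilon> 1 A (\<lambda>i. \<beta> i ^ k)"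
      unfolding box_family_def using \<beta> by (auto simp: A_def k_def split: if_splits)
    show "\<not> summable (\<lambda>i. 2 ^ i * (real (card (A i)) * \<beta> i ^ k))"
      unfolding eq by (rule div3)
  qed
  with cube have AE_W: "AE x in \<mu>. x \<in> W_simul \<psi> y"
  proof eventually_elim
    case (elim x)
    have "infinite {n::nat. n \<ge> 1 \<and> Max (range (\<lambda>j. dnint (real n * x $ j - y $ j))) < \<psi> n}"
    proof (rule infinite_blocks[where P = "\<lambda>n. Max (range (\<lambda>j. dnint (real n * x $ j - y $ j))) < \<psi> n"])
      show "infinite {i. \<exists>n\<in>block (2 ^ i). Max (range (\<lambda>j. dnint (real n * x $ j - y $ j))) < \<psi> n}"
      proof (rule infinite_super[OF _ elim(2)], intro subsetI)
        fix i assume "i \<in> {i. \<exists>n\<in>block (2 ^ i). \<exists>\<alpha>\<in>A i. hits \<alpha> y n x}"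
        then obtain n \<alpha> where n: "n \<in> block (2 ^ i)" "\<alpha> \<in> A i" "hits \<alpha> y n x" by blast
        have "dnint (real n * x $ j - y $ j) < \<psi> n" for j
        proof -
          have "dnint (real n * x $ j - y $ j) < \<beta> i"
            using n(2,3) by (auto simp: hits_def A_def split: if_splits)
          also have "\<dots> \<le> \<psi> n" using block_le(2)[OF n(1)] by (simp add: \<beta>_def q_def)
          finally show ?thesis .
        qed
        then show "i \<in> {i. \<exists>n\<in>block (2 ^ i). Max (range (\<lambda>j. dnint (real n * x $ j - y $ j))) < \<psi> n}"
          using n(1) unfolding Max_range_less_iff by blast
      qed
    qed
    then show ?case using elim(1) by (simp add: W_simul_def)
  qed
  show W: "W_simul \<psi> y \<in> sets \<mu>" using W_simul_borel \<mu>(2) by simp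
  show "emeasure \<mu> (W_simul \<psi> y) = 1"
    using prob_space.emeasure_eq_1_AE[OF \<mu>(1) W AE_W] .
qed

section \<open>The Gallagher theorem: dyadic boxes below a hyperbola\<close>

text \<open>With truncated subtraction \<open>(x - m) + (m - x)\<close> is |x - m|. Each side of x
  gives a geometric series, so the bound is uniform in \<open>I\<close>.\<close>

lemma sum_power_distance_le:
  fixes r :: real and I :: "nat set"
  assumes r: "0 \<le> r" "r < 1" and fin: "finite I"
  shows "(\<Sum>m\<in>I. r ^ ((x - m) + (m - x))) \<le> 2 / (1 - r)"
proof -
  note geo = geometric_sum_le[OF r]
  have "(\<Sum>m\<in>I. r ^ ((x - m) + (m - x))) \<le> (\<Sum>m\<in>{..x} \<union> {x..x + Max (insert 0 I)}. r ^ ((x - m) + (m - x)))"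
  proof (rule sum_mono2)
    show "I \<subseteq> {..x} \<union> {x..x + Max (insert 0 I)}"
    proof
      fix m assume "m \<in> I"
      then have "m \<le> Max (insert 0 I)" using fin by (intro Max_ge) auto
      then show "m \<in> {..x} \<union> {x..x + Max (insert 0 I)}" by auto
    qed
  qed (use r in auto)
  also have "\<dots> \<le> (\<Sum>m\<in>{..x}. r ^ ((x - m) + (m - x))) + (\<Sum>m\<in>{x..x + Max (insert 0 I)}. r ^ ((x - m) + (m - x)))"
    by (subst sum_Un) (use r in \<open>auto intro!: sum_nonneg\<close>)
  also have "(\<Sum>m\<in>{..x}. r ^ ((x - m) + (m - x))) = (\<Sum>j\<in>{..x}. r ^ j)"
    by (rule sum.reindex_bij_witness[of _ "\<lambda>j. x - j" "\<lambda>m. x - m"]) auto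
  also have "(\<Sum>m\<in>{x..x + Max (insert 0 I)}. r ^ ((x - m) + (m - x))) = (\<Sum>j\<in>{..Max (insert 0 I)}. r ^ j)"
    by (rule sum.reindex_bij_witness[of _ "\<lambda>j. x + j" "\<lambda>m. m - x"]) auto
  also have "(\<Sum>j\<in>{..x}. r ^ j) + (\<Sum>j\<in>{..Max (insert 0 I)}. r ^ j) \<le> 2 / (1 - r)"
    using geo[of "{..x}"] geo[of "{..Max (insert 0 I)}"] by simp
  finally show ?thesis .
qed

text \<open>The square of a minimum is the product of the two numbers times the ratio of the smaller
  to the larger, here a power of 1/2.\<close>

lemma min_dyadic_square:
  "(min (1 / 2 ^ x) (1 / 2 ^ y :: real))\<^sup>2 = 1 / 2 ^ x * (1 / 2 ^ y) * (1 / 2) ^ ((x - y) + (y - x))"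
proof -
  have *: "(min (1 / 2 ^ x) (1 / 2 ^ y :: real))\<^sup>2 = 1 / 2 ^ x * (1 / 2 ^ y) * (1 / 2) ^ (y - x)" if "x \<le> y" for x y :: nat
  proof -
    have y: "(2::real) ^ y = 2 ^ x * 2 ^ (y - x)" using that by (simp flip: power_add)
    have "(1::real) / 2 ^ y \<le> 1 / 2 ^ x" using that by (intro divide_left_mono power_increasing) auto
    then show ?thesis by (simp add: min_absorb2 power2_eq_square power_divide y)
  qed
  show ?thesis
  proof (cases "x \<le> y")
    case True
    then show ?thesis using *[OF True] by simp
  next
    case False
    then show ?thesis using *[of y x] by (simp add: min.commute mult.commute)
  qed
qed

text \<open>The exponents are free outside \<open>l0\<close>, and the side at \<open>l0\<close> is
  solved for so that the volume is exactly \<open>v\<close>. All these boxes lie below the same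
  hyperbola.\<close>

definition dyadic_box :: "'n::finite \<Rightarrow> real \<Rightarrow> ('n \<Rightarrow> nat) \<Rightarrow> 'n \<Rightarrow> real" where
  "dyadic_box l0 v a = (\<lambda>l. if l = l0 then v * 2 ^ (\<Sum>j\<in>UNIV - {l0}. a j) else 1 / 2 ^ a l)"

lemma dyadic_box_volume: "(\<Prod>l\<in>UNIV. dyadic_box l0 v a l) = v"
proof -
  have "(\<Prod>l\<in>UNIV. dyadic_box l0 v a l) = dyadic_box l0 v a l0 * (\<Prod>l\<in>UNIV - {l0}. dyadic_box l0 v a l)"
    by (intro prod.remove) auto
  also have "(\<Prod>l\<in>UNIV - {l0}. dyadic_box l0 v a l) = (\<Prod>l\<in>UNIV - {l0}. 1 / 2 ^ a l)"
    by (intro prod.cong) (auto simp: dyadic_box_def)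
  also have "\<dots> = 1 / 2 ^ (\<Sum>j\<in>UNIV - {l0}. a j)"
    by (simp add: prod_dividef power_sum)
  finally show ?thesis by (simp add: dyadic_box_def)
qed

lemma dyadic_box_nonneg: "0 \<le> v \<Longrightarrow> 0 \<le> dyadic_box l0 v a l"
  by (simp add: dyadic_box_def)

lemma inj_on_dyadic_box: "inj_on (dyadic_box l0 v) (Pi\<^sub>E (UNIV - {l0}) B)"
proof (rule inj_onI)
  fix a b assume ab: "a \<in> Pi\<^sub>E (UNIV - {l0}) B" "b \<in> Pi\<^sub>E (UNIV - {l0}) B" "dyadic_box l0 v a = dyadic_box l0 v b"
  show "a = b"
  proof (rule PiE_ext[OF ab(1,2)])
    fix l assume l: "l \<in> UNIV - {l0}"
    have "dyadic_box l0 v a l = dyadic_box l0 v b l" using ab(3) by simp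
    then have "(2::real) ^ a l = 2 ^ b l" using l by (simp add: dyadic_box_def)
    then show "a l = b l" by simp
  qed
qed

text \<open>
  The logarithms of the side ratios of two boxes of equal volume sum to 0, so the overlap decays
  geometrically in the distance of the exponent vectors although the side at \<open>l0\<close> is not controlled.
\<close>

lemma dyadic_box_overlap:
  fixes a b :: "'n::finite \<Rightarrow> nat"
  assumes "0 \<le> v"
  shows "(\<Prod>l\<in>UNIV. min (dyadic_box l0 v a l) (dyadic_box l0 v b l))
    \<le> v * (\<Prod>l\<in>UNIV - {l0}. (1 / sqrt 2) ^ ((a l - b l) + (b l - a l)))"
proof -
  let ?A = "dyadic_box l0 v a" and ?B = "dyadic_box l0 v b"
  have nn: "0 \<le> ?A l" "0 \<le> ?B l" for l using assms by (simp_all add: dyadic_box_nonneg)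
  have "(\<Prod>l\<in>UNIV. min (?A l) (?B l))\<^sup>2 = (\<Prod>l\<in>UNIV. (min (?A l) (?B l))\<^sup>2)"
    by (simp add: prod_power_distrib)
  also have "\<dots> = (min (?A l0) (?B l0))\<^sup>2 * (\<Prod>l\<in>UNIV - {l0}. (min (?A l) (?B l))\<^sup>2)"
    by (intro prod.remove) auto
  also have "\<dots> \<le> (?A l0 * ?B l0) * (\<Prod>l\<in>UNIV - {l0}. (?A l * ?B l) * (1 / 2) ^ ((a l - b l) + (b l - a l)))"
  proof (intro mult_mono prod_mono conjI)
    show "(min (?A l0) (?B l0))\<^sup>2 \<le> ?A l0 * ?B l0"
      unfolding power2_eq_square using nn by (intro mult_mono) auto
    show "(min (?A l) (?B l))\<^sup>2 \<le> (?A l * ?B l) * (1 / 2) ^ ((a l - b l) + (b l - a l))" if "l \<in> UNIV - {l0}" for l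
      using that min_dyadic_square[of "a l" "b l"] by (simp add: dyadic_box_def)
  qed (use nn in \<open>auto intro!: prod_nonneg\<close>)
  also have "\<dots> = ((?A l0 * ?B l0) * (\<Prod>l\<in>UNIV - {l0}. ?A l * ?B l)) * (\<Prod>l\<in>UNIV - {l0}. (1 / 2) ^ ((a l - b l) + (b l - a l)))"
    by (simp only: prod.distrib mult.assoc)
  also have "(?A l0 * ?B l0) * (\<Prod>l\<in>UNIV - {l0}. ?A l * ?B l) = (\<Prod>l\<in>UNIV. ?A l * ?B l)"
    by (rule prod.remove[symmetric]) auto
  also have "(\<Prod>l\<in>UNIV. ?A l * ?B l) = v\<^sup>2"
    by (simp only: prod.distrib dyadic_box_volume power2_eq_square)
  also have "(\<Prod>l\<in>UNIV - {l0}. (1 / 2) ^ ((a l - b l) + (b l - a l)) :: real)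
      = (\<Prod>l\<in>UNIV - {l0}. (1 / sqrt 2) ^ ((a l - b l) + (b l - a l)))\<^sup>2"
  proof -
    have "((1 / sqrt 2) ^ t)\<^sup>2 = (1 / 2 :: real) ^ t" for t
      by (simp only: power_commutes power_mult[symmetric] mult.commute[of t]) (simp add: power_mult power_divide)
    then show ?thesis by (simp only: prod_power_distrib)
  qed
  finally have "(\<Prod>l\<in>UNIV. min (?A l) (?B l))\<^sup>2 \<le> (v * (\<Prod>l\<in>UNIV - {l0}. (1 / sqrt 2) ^ ((a l - b l) + (b l - a l))))\<^sup>2"
    by (simp only: power_mult_distrib)
  then show ?thesis
    by (rule power2_le_imp_le) (use assms in \<open>auto intro!: mult_nonneg_nonneg prod_nonneg\<close>)
qed

text \<open>Half of the exponent \<open>c\<close> pays for the polynomial, the other half leaves a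
  geometric series.\<close>

lemma summable_poly_two_powr_neg:
  assumes "0 < c"
  shows "summable (\<lambda>i. (real i + 2) ^ m * 2 powr (- (real i * c)))"
proof -
  define d where "d = c / (2 * real (Suc m))"
  have d: "0 < d" "d * real m \<le> c / 2"
  proof -
    show "0 < d" using assms by (simp add: d_def)
    have "c * real m \<le> c * real (Suc m)" using assms by simp
    then show "d * real m \<le> c / 2" by (simp add: d_def field_simps)
  qed
  define \<eta> where "\<eta> = min (1 / 2) (d * ln 2)"
  have \<eta>: "0 < \<eta>" using d by (simp add: \<eta>_def)
  have lin: "real i + 2 \<le> 2 powr (real i * d) / \<eta>" for i
  proof -
    have "\<eta> * (real i + 2) \<le> 1 + real i * (d * ln 2)"
    proof -
      have "\<eta> * real i \<le> (d * ln 2) * real i" by (intro mult_right_mono) (auto simp: \<eta>_def)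
      moreover have "\<eta> * 2 \<le> 1" by (simp add: \<eta>_def)
      ultimately show ?thesis by (simp add: algebra_simps)
    qed
    also have "\<dots> \<le> exp (real i * (d * ln 2))" by (rule exp_ge_add_one_self)
    also have "\<dots> = 2 powr (real i * d)" by (simp add: powr_def)
    finally show ?thesis using \<eta> by (simp add: field_simps)
  qed
  show ?thesis
  proof (rule summable_comparison_test')
    show "summable (\<lambda>i. (1 / \<eta>) ^ m * 2 powr (- (real i * (c / 2))))"
      using assms by (intro summable_mult summable_two_powr_neg) auto
    show "norm ((real i + 2) ^ m * 2 powr (- (real i * c))) \<le> (1 / \<eta>) ^ m * 2 powr (- (real i * (c / 2)))"
      if "i \<ge> 0" for i
    proof -
      have "(real i + 2) ^ m \<le> (2 powr (real i * d) / \<eta>) ^ m" by (intro power_mono lin) auto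
      also have "\<dots> = (1 / \<eta>) ^ m * 2 powr (real i * d * real m)"
        by (simp add: power_divide powr_power mult.commute)
      also have "\<dots> \<le> (1 / \<eta>) ^ m * 2 powr (real i * (c / 2))"
        using \<eta> d(2) by (intro mult_left_mono powr_mono) (auto simp: mult.assoc intro!: mult_left_mono)
      finally have "(real i + 2) ^ m * 2 powr (- (real i * c))
         \<le> (1 / \<eta>) ^ m * 2 powr (real i * (c / 2)) * 2 powr (- (real i * c))"
        by (intro mult_right_mono) auto
      also have "\<dots> = (1 / \<eta>) ^ m * 2 powr (- (real i * (c / 2)))"
      proof -
        have "real i * (c / 2) + - (real i * c) = - (real i * (c / 2))" by (simp add: field_simps)
        then show ?thesis by (simp only: mult.assoc powr_add[symmetric])
      qed
      finally show ?thesis by simp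
    qed
  qed
qed

lemma box_hitting_imp_Gallagher:
  fixes \<mu> :: "(real ^ 'n::finite) measure"
  assumes \<mu>: "prob_space \<mu>" "sets \<mu> = sets borel" and k2: "2 \<le> CARD('n)"
    and cube: "AE x in \<mu>. x \<in> unit_cube_ho"
    and \<epsilon>: "0 < \<epsilon>" "\<epsilon> \<le> 1 / (6 * real CARD('n) ^ 2)" and hit: "box_hitting \<mu> \<epsilon>"
  shows "inhom_div_Gallagher \<mu>"
  unfolding inhom_div_Gallagher_def
proof (intro allI impI conjI)
  fix \<psi> :: "nat \<Rightarrow> real" and y :: "real ^ 'n"
  assume adm: "admissible_psi \<psi>" and div: "\<not> summable (\<lambda>n. \<psi> (Suc n) * ln (real (Suc n)) ^ (CARD('n) - 1))"
  define k where "k = CARD('n)"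
  define m where "m = k - 1"
  have k0: "2 \<le> real k" "real m = real k - 1" using k2 by (auto simp: k_def m_def)
  have \<epsilon>1: "\<epsilon> \<le> 1"
  proof -
    have "1 \<le> real k ^ 2" using k0 by (intro one_le_power) auto
    then have "1 / (6 * real k ^ 2) \<le> 1" by (subst divide_le_eq_1_pos) linarith+
    then show ?thesis using \<epsilon>(2) unfolding k_def by (rule order_trans[rotated])
  qed
  \<comment> \<open>Exponents will range over a window of length \<delta>i below i/k. Together the k
    - 1 of them move the solved side by a factor of at most 2^((\<epsilon>/2)i).\<close>
  define \<delta> where "\<delta> = \<epsilon> / (2 * real k)"
  have \<delta>: "0 < \<delta>" "\<delta> * real m \<le> \<epsilon> / 2" "\<delta> \<le> 1"
  proof -
    show "0 < \<delta>" using \<epsilon> k0 by (simp add: \<delta>_def)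
    have "\<delta> * real m \<le> \<delta> * real k" using \<open>0 < \<delta>\<close> k0 by (intro mult_left_mono) auto
    then show "\<delta> * real m \<le> \<epsilon> / 2" using k0 by (simp add: \<delta>_def)
    have "\<epsilon> / (2 * real k) \<le> 1 / 1" using \<epsilon>1 k0 by (intro frac_le) auto
    then show "\<delta> \<le> 1" by (simp add: \<delta>_def)
  qed
  define q where "q i = \<psi> (2 ^ Suc i)" for i
  have q: "0 \<le> q i" "q i < 1" for i
    using adm by (auto simp: admissible_psi_def q_def)
  note block_le = admissible_psi_block[OF adm]
  \<comment> \<open>On block i the logarithm is at most i + 1; evaluating \<psi> past the block
    shifts this to i + 2.\<close>
  define e where "e i = 2 ^ i * q i * (real i + 2) ^ m" for i
  \<comment> \<open>The cap keeps the expected hits of a block bounded. It also gives v \<le>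
    2^(-i), which keeps the solved side at most 1.\<close>
  define v where "v i = min (q i) (1 / (2 ^ i * (real i + 2) ^ m))" for i
  have v0: "0 \<le> v i" for i using q by (simp add: v_def)
  have ve: "2 ^ i * v i * (real i + 2) ^ m = min (e i) 1" for i
  proof -
    define z where "z = 2 ^ i * (real i + 2) ^ m"
    have z: "0 < z" by (simp add: z_def)
    have "z * min (q i) (1 / z) = min (z * q i) 1"
      using z by (cases "q i \<le> 1 / z") (auto simp: min_def field_simps)
    then show ?thesis by (simp add: v_def e_def z_def mult_ac)
  qed
  have div1: "\<not> summable (\<lambda>i. 2 ^ i * (\<psi> (2 ^ i) * (real i + 1) ^ m))"
  proof (rule not_summable_blocks[where f = "\<lambda>n. \<psi> n * ln (real n) ^ m"])
    show "\<psi> n * ln (real n) ^ m \<le> \<psi> (2 ^ i) * (real i + 1) ^ m" if "n \<in> block (2 ^ i)" for i n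
    proof -
      note psi = block_le(1,3)[OF that]
      have n1: "1 \<le> n" and n: "n < 2 ^ Suc i"
        using that one_le_power[of "2::nat" i] by (auto simp: block_def)
      have "real n \<le> real (2 ^ Suc i)" using n by (simp only: of_nat_le_iff less_imp_le)
      then have "real n \<le> 2 ^ Suc i" by simp
      then have "ln (real n) \<le> ln (2 ^ Suc i)" using n1 by (simp del: power_Suc)
      also have "\<dots> = real (Suc i) * ln 2" by (rule ln_realpow)
      also have "\<dots> \<le> real (Suc i) * 1" using ln_2_less_1 by (intro mult_left_mono) auto
      finally have "ln (real n) \<le> real i + 1" by simp
      moreover have "0 \<le> ln (real n)" using n1 by simp
      ultimately show ?thesis using psi by (intro mult_mono power_mono) auto
    qed
  qed (use adm div in \<open>auto simp: admissible_psi_def k_def m_def\<close>)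
  have div2: "\<not> summable e"
  proof
    assume "summable e"
    from summable_mult[OF this, of 2] have "summable (\<lambda>i. 2 ^ Suc i * (\<psi> (2 ^ Suc i) * (real (Suc i) + 1) ^ m))"
      by (simp add: e_def q_def mult_ac add_ac)
    then show False using div1 summable_Suc_iff[of "\<lambda>i. 2 ^ i * (\<psi> (2 ^ i) * (real i + 1) ^ m)"] by blast
  qed
  \<comment> \<open>The \<epsilon>/2 allowed here and the \<epsilon>/2 from the window of exponents
    add up to the \<epsilon> permitted for the side at \<open>l0\<close>. The omitted levels
    contribute a convergent sum.\<close>
  define P where "P i \<longleftrightarrow> 2 powr (- (real i * (1 + \<epsilon> / 2))) \<le> v i" for i
  have div3: "\<not> summable (\<lambda>i. if P i then 2 ^ i * v i * (real i + 2) ^ m else 0)"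
  proof (rule not_summable_drop)
    show "\<not> summable (\<lambda>i. 2 ^ i * v i * (real i + 2) ^ m)"
      unfolding ve using q div2 by (intro not_summable_min_one) (auto simp: e_def[abs_def])
    show "summable (\<lambda>i. (real i + 2) ^ m * 2 powr (- (real i * (\<epsilon> / 2))))"
      using \<epsilon> by (intro summable_poly_two_powr_neg) auto
    show "2 ^ i * v i * (real i + 2) ^ m \<le> (real i + 2) ^ m * 2 powr (- (real i * (\<epsilon> / 2)))" if "\<not> P i" for i
    proof -
      have "2 ^ i * v i \<le> 2 powr real i * 2 powr (- (real i * (1 + \<epsilon> / 2)))"
        using that unfolding P_def by (intro mult_mono) (auto simp: powr_realpow v0)
      also have "\<dots> = 2 powr (- (real i * (\<epsilon> / 2)))"
        unfolding powr_add[symmetric] by (simp add: algebra_simps)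
      finally have "(real i + 2) ^ m * (2 ^ i * v i) \<le> (real i + 2) ^ m * 2 powr (- (real i * (\<epsilon> / 2)))"
        by (intro mult_left_mono) auto
      then show ?thesis by (simp add: mult_ac)
    qed
  qed (use v0 in auto)
  define lo where "lo i = nat \<lceil>real i / real k - \<delta> * real i\<rceil>" for i
  define hi where "hi i = nat \<lfloor>real i / real k\<rfloor>" for i
  have lo: "real i / real k - \<delta> * real i \<le> real (lo i)" for i unfolding lo_def by linarith
  have hi: "real (hi i) \<le> real i / real k" "real i / real k < real (hi i) + 1" for i
  proof -
    have "0 \<le> real i / real k" by simp
    then show "real (hi i) \<le> real i / real k" "real i / real k < real (hi i) + 1"
      unfolding hi_def by linarith+
  qed
  have hii: "hi i \<le> i" for i
  proof -
    have "real i / real k \<le> real i / 1" using k0 by (intro divide_left_mono) auto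
    then show ?thesis using hi(1)[of i] by simp
  qed
  obtain l0 :: 'n where True by blast
  define I where "I i = (\<Pi>\<^sub>E l\<in>UNIV - {l0}. {lo i..hi i})" for i
  define A where "A i = (if P i then dyadic_box l0 (v i) ` I i else {})" for i
  define r :: real where "r = 1 / sqrt 2"
  have r: "0 \<le> r" "r < 1" by (auto simp: r_def)
  define K where "K = (2 / (1 - r)) ^ m"
  have K1: "1 \<le> K" unfolding K_def using r by (intro one_le_power) (simp add: field_simps)
  have finI: "finite (I i)" for i unfolding I_def by (intro finite_PiE) auto
  have cardm: "card (UNIV - {l0}) = m" by (simp add: m_def k_def)
  have cardI: "card (I i) = (hi i + 1 - lo i) ^ m" for i
    unfolding I_def by (subst card_PiE) (auto simp: cardm)
  have cardA: "card (A i) = (if P i then (hi i + 1 - lo i) ^ m else 0)" for i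
    unfolding A_def cardI[symmetric] using inj_on_dyadic_box[of l0 "v i" "\<lambda>_. {lo i..hi i}"]
    by (auto simp: I_def card_image)
  have total: "2 ^ i * (real (card (A i)) * v i) \<le> K" for i
  proof -
    have "real (card (A i)) \<le> (real i + 2) ^ m"
    proof -
      have "real (hi i + 1 - lo i) \<le> real i + 2" using hii[of i] by linarith
      then show ?thesis unfolding cardA by (auto intro!: power_mono)
    qed
    then have "(2 ^ i * v i) * real (card (A i)) \<le> (2 ^ i * v i) * (real i + 2) ^ m"
      using v0 by (intro mult_left_mono) auto
    then show ?thesis using ve[of i] K1 by (simp add: mult_ac)
  qed
  have sumI: "real m * (real i / real k - \<delta> * real i) \<le> real (\<Sum>j\<in>UNIV - {l0}. a j)"
    "real (\<Sum>j\<in>UNIV - {l0}. a j) \<le> real m * (real i / real k)" if a: "a \<in> I i" for a i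
  proof -
    have al: "a j \<in> {lo i..hi i}" if "j \<in> UNIV - {l0}" for j using a that unfolding I_def by (rule PiE_mem)
    have "(\<Sum>j\<in>UNIV - {l0}. real i / real k - \<delta> * real i) \<le> (\<Sum>j\<in>UNIV - {l0}. real (a j))"
      by (intro sum_mono order_trans[OF lo[of i]]) (use al in auto)
    then show "real m * (real i / real k - \<delta> * real i) \<le> real (\<Sum>j\<in>UNIV - {l0}. a j)" by (simp only: sum_constant cardm of_nat_sum)
    have "(\<Sum>j\<in>UNIV - {l0}. real (a j)) \<le> (\<Sum>j\<in>UNIV - {l0}. real i / real k)"
      by (intro sum_mono order_trans[OF _ hi(1)[of i]]) (use al in auto)
    then show "real (\<Sum>j\<in>UNIV - {l0}. a j) \<le> real m * (real i / real k)" by (simp only: sum_constant cardm of_nat_sum)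
  qed
  have mk: "real m * (real i / real k) = real i - real i / real k" for i :: nat
    unfolding k0(2) using k0(1) by (simp add: field_simps)
  have side: "2 powr (- (real i * (1 / real k + \<epsilon>))) \<le> dyadic_box l0 (v i) a l \<and> dyadic_box l0 (v i) a l \<le> 1"
    if a: "a \<in> I i" and P: "P i" for a i l
  proof (cases "l = l0")
    case False
    then have al: "a l \<in> {lo i..hi i}" by (intro PiE_mem[OF a[unfolded I_def]]) simp
    have eq: "dyadic_box l0 (v i) a l = 2 powr (- real (a l))"
      using False by (simp add: dyadic_box_def powr_minus powr_realpow divide_inverse)
    have "real (a l) \<le> real i / real k" using al hi(1)[of i] by simp
    moreover have "0 \<le> real i * \<epsilon>" using \<epsilon> by simp
    ultimately have "- (real i * (1 / real k + \<epsilon>)) \<le> - real (a l)" by (simp add: algebra_simps)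
    then show ?thesis
      unfolding eq using powr_mono[of "- real (a l)" 0 2] by (intro conjI powr_mono) auto
  next
    case True
    define S where "S = real (\<Sum>j\<in>UNIV - {l0}. a j)"
    have eq: "dyadic_box l0 (v i) a l = v i * 2 powr S"
      unfolding S_def powr_realpow[of 2, simplified] using True by (simp add: dyadic_box_def)
    define u where "u = real i / real k"
    define w where "w = real m * \<delta> * real i"
    have u0: "0 \<le> u" by (simp add: u_def)
    have mu: "real m * u = real i - u" unfolding u_def by (rule mk)
    have S: "real i - u - w \<le> S" "S \<le> real i - u"
    proof -
      have "real m * (u - \<delta> * real i) = real m * u - w" by (simp add: w_def right_diff_distrib)
      then show "real i - u - w \<le> S" using sumI(1)[OF a, folded u_def S_def] mu by simp
      show "S \<le> real i - u" using sumI(2)[OF a, folded u_def S_def] mu by simp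
    qed
    have "2 powr (- (real i * (1 / real k + \<epsilon>))) \<le> 2 powr (- (real i * (1 + \<epsilon> / 2)) + S)"
    proof -
      have "w \<le> \<epsilon> / 2 * real i"
        unfolding w_def using \<delta>(2) by (intro mult_right_mono) (auto simp: mult.commute)
      moreover have "real i * (1 / real k + \<epsilon>) = u + 2 * (\<epsilon> / 2 * real i)"
        "real i * (1 + \<epsilon> / 2) = real i + \<epsilon> / 2 * real i"
        by (simp_all add: u_def distrib_left mult.commute)
      ultimately have "- (real i * (1 / real k + \<epsilon>)) \<le> - (real i * (1 + \<epsilon> / 2)) + S"
        using S(1) by simp
      then show ?thesis by (rule powr_mono) simp
    qed
    also have "\<dots> \<le> v i * 2 powr S"
      unfolding powr_add using P by (intro mult_right_mono) (auto simp: P_def)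
    finally have lower: "2 powr (- (real i * (1 / real k + \<epsilon>))) \<le> v i * 2 powr S" .
    have "1 * 2 ^ i \<le> (real i + 2) ^ m * 2 ^ i"
      by (intro mult_right_mono one_le_power) auto
    then have "1 / (2 ^ i * (real i + 2) ^ m) \<le> 1 / 2 ^ i"
      by (intro divide_left_mono) (auto simp: mult.commute)
    moreover have "v i \<le> 1 / (2 ^ i * (real i + 2) ^ m)" by (simp add: v_def)
    moreover have "1 / 2 ^ i = 2 powr (- real i)" by (simp add: powr_minus powr_realpow divide_inverse)
    ultimately have "v i \<le> 2 powr (- real i)" by linarith
    then have "v i * 2 powr S \<le> 2 powr (- real i) * 2 powr S" by (intro mult_right_mono) auto
    also have "\<dots> = 2 powr (- real i + S)" by (simp only: powr_add)
    also have "\<dots> \<le> 2 powr 0"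
    proof -
      have "- real i + S \<le> 0" using S(2) u0 by simp
      then show ?thesis by (intro powr_mono) auto
    qed
    finally show ?thesis using lower unfolding eq by simp
  qed
  have overlap: "(\<Sum>\<alpha>'\<in>A i. \<Prod>l\<in>UNIV. min (\<alpha> l) (\<alpha>' l)) \<le> K * v i" if \<alpha>: "\<alpha> \<in> A i" for i \<alpha>
  proof -
    have P: "P i" using \<alpha> by (auto simp: A_def split: if_splits)
    then obtain a where a: "a \<in> I i" "\<alpha> = dyadic_box l0 (v i) a"
      using \<alpha> unfolding A_def by auto
    have "(\<Sum>\<alpha>'\<in>A i. \<Prod>l\<in>UNIV. min (\<alpha> l) (\<alpha>' l)) = (\<Sum>b\<in>I i. \<Prod>l\<in>UNIV. min (dyadic_box l0 (v i) a l) (dyadic_box l0 (v i) b l))"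
      using P inj_on_dyadic_box[of l0 "v i" "\<lambda>_. {lo i..hi i}"]
      by (simp add: A_def a sum.reindex I_def)
    also have "\<dots> \<le> (\<Sum>b\<in>I i. v i * (\<Prod>l\<in>UNIV - {l0}. r ^ ((a l - b l) + (b l - a l))))"
      unfolding r_def by (intro sum_mono dyadic_box_overlap v0)
    also have "\<dots> = v i * (\<Prod>l\<in>UNIV - {l0}. \<Sum>j\<in>{lo i..hi i}. r ^ ((a l - j) + (j - a l)))"
      unfolding I_def by (subst prod_sum_PiE) (auto simp: sum_distrib_left)
    also have "\<dots> \<le> v i * (\<Prod>l\<in>UNIV - {l0}. 2 / (1 - r))"
      using v0 r by (intro mult_left_mono prod_mono conjI sum_power_distance_le sum_nonneg) auto
    also have "\<dots> = K * v i" by (simp only: prod_constant cardm K_def mult.commute)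
    finally show ?thesis .
  qed
  have fam: "box_family \<epsilon> K A v"
    unfolding box_family_def
  proof (intro conjI allI ballI)
    show "0 \<le> K" using K1 by simp
    show "finite (A i)" for i using finI by (simp add: A_def)
    show "2 ^ i * (real (card (A i)) * v i) \<le> K" for i by (rule total)
    fix i \<alpha> assume \<alpha>: "\<alpha> \<in> A i"
    then have P: "P i" by (auto simp: A_def split: if_splits)
    then obtain a where a: "a \<in> I i" "\<alpha> = dyadic_box l0 (v i) a"
      using \<alpha> unfolding A_def by auto
    show "2 powr (- (real i * (1 / real CARD('n) + \<epsilon>))) \<le> \<alpha> l" "\<alpha> l \<le> 1" for l
      using side[OF a(1) P, of l] by (auto simp: a(2) k_def)
    show "(\<Prod>l\<in>UNIV. \<alpha> l) = v i" unfolding a(2) by (rule dyadic_box_volume)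
    show "(\<Sum>\<alpha>'\<in>A i. \<Prod>l\<in>UNIV. min (\<alpha> l) (\<alpha>' l)) \<le> K * v i" by (rule overlap[OF \<alpha>])
  qed
  \<comment> \<open>Each of the m free exponents has at least (\<delta>/4)(i + 2) values once
    \<delta>i \<ge> 4, so the boxes retain a positive proportion of the factor (i + 2)^m and
    divergence carries over.\<close>
  have div4: "\<not> summable (\<lambda>i. 2 ^ i * (real (card (A i)) * v i))"
  proof
    assume s: "summable (\<lambda>i. 2 ^ i * (real (card (A i)) * v i))"
    have "summable (\<lambda>i. if P i then 2 ^ i * v i * (real i + 2) ^ m else 0)"
    proof (rule summable_comparison_test_ev)
      show "summable (\<lambda>i. (4 / \<delta>) ^ m * (2 ^ i * (real (card (A i)) * v i)))"
        by (intro summable_mult s)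
      have "eventually (\<lambda>i. nat \<lceil>4 / \<delta>\<rceil> \<le> i) sequentially" by (rule eventually_ge_at_top)
      then show "eventually (\<lambda>i. norm (if P i then 2 ^ i * v i * (real i + 2) ^ m else 0)
          \<le> (4 / \<delta>) ^ m * (2 ^ i * (real (card (A i)) * v i))) sequentially"
      proof eventually_elim
        case (elim i)
        show ?case
        proof (cases "P i")
          case True
          have "4 / \<delta> \<le> real i" using elim by linarith
          then have di: "4 \<le> \<delta> * real i" using \<delta> by (simp add: field_simps)
          have "\<delta> * real i - 1 \<le> real (hi i + 1 - lo i)"
          proof -
            have "real (lo i) < max 0 (real i / real k - \<delta> * real i) + 1" unfolding lo_def by linarith
            moreover have "\<delta> * real i \<le> real i / real k"
            proof -
              have "\<delta> \<le> 1 / real k"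
              proof -
                have "\<epsilon> / (2 * real k) \<le> 1 / real k" using k0 \<epsilon>1 by (intro frac_le) auto
                then show ?thesis by (simp add: \<delta>_def)
              qed
              then have "\<delta> * real i \<le> 1 / real k * real i" by (intro mult_right_mono) auto
              then show ?thesis by simp
            qed
            ultimately have "real (lo i) < real i / real k - \<delta> * real i + 1" by linarith
            then have "\<delta> * real i - 1 < real (hi i) + 1 - real (lo i)" using hi(2)[of i] by linarith
            then show ?thesis by linarith
          qed
          moreover have "\<delta> / 4 * (real i + 2) \<le> \<delta> * real i - 1"
          proof -
            have "\<delta> / 4 * (real i + 2) = (\<delta> * real i) / 4 + \<delta> / 2" by (simp add: field_simps)
            then show ?thesis using di \<delta>(3) by linarith
          qed
          ultimately have "\<delta> / 4 * (real i + 2) \<le> real (hi i + 1 - lo i)" by linarith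
          then have "4 / \<delta> * (\<delta> / 4 * (real i + 2)) \<le> 4 / \<delta> * real (hi i + 1 - lo i)"
            using \<delta>(1) by (intro mult_left_mono) auto
          moreover have "4 / \<delta> * (\<delta> / 4 * (real i + 2)) = real i + 2" using \<delta>(1) by simp
          ultimately have "real i + 2 \<le> 4 / \<delta> * real (hi i + 1 - lo i)" by (simp only:)
          then have "(real i + 2) ^ m \<le> (4 / \<delta> * real (hi i + 1 - lo i)) ^ m" by (rule power_mono) simp
          also have "\<dots> = (4 / \<delta>) ^ m * real (card (A i))"
          proof -
            have "real (card (A i)) = real (hi i + 1 - lo i) ^ m"
              using True cardA[of i] by (simp only: if_True of_nat_power)
            then show ?thesis by (simp only: power_mult_distrib)
          qed
          finally have "2 ^ i * v i * (real i + 2) ^ m \<le> 2 ^ i * v i * ((4 / \<delta>) ^ m * real (card (A i)))"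
            using v0 by (intro mult_left_mono) auto
          then show ?thesis using True v0[of i] by (simp add: mult_ac)
        qed (use \<delta> v0 in auto)
      qed
    qed
    then show False using div3 by blast
  qed
  have "AE x in \<mu>. infinite {i. \<exists>n\<in>block (2 ^ i). \<exists>\<alpha>\<in>A i. hits \<alpha> y n x}"
    by (rule hit[unfolded box_hitting_def, rule_format, OF fam div4])
  with cube have AE_W: "AE x in \<mu>. x \<in> W_mult \<psi> y"
  proof eventually_elim
    case (elim x)
    have "infinite {n::nat. n \<ge> 1 \<and> (\<Prod>j\<in>UNIV. dnint (real n * x $ j - y $ j)) < \<psi> n}"
    proof (rule infinite_blocks[where P = "\<lambda>n. (\<Prod>j\<in>UNIV. dnint (real n * x $ j - y $ j)) < \<psi> n"])
      show "infinite {i. \<exists>n\<in>block (2 ^ i). (\<Prod>j\<in>UNIV. dnint (real n * x $ j - y $ j)) < \<psi> n}"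
      proof (rule infinite_super[OF _ elim(2)], intro subsetI)
        fix i assume "i \<in> {i. \<exists>n\<in>block (2 ^ i). \<exists>\<alpha>\<in>A i. hits \<alpha> y n x}"
        then obtain n \<alpha> where n: "n \<in> block (2 ^ i)" "\<alpha> \<in> A i" "hits \<alpha> y n x" by blast
        \<comment> \<open>A hit puts each distance strictly below the corresponding side, so the
          product is strictly below the volume of the box.\<close>
        have "(\<Prod>j\<in>UNIV. dnint (real n * x $ j - y $ j)) < (\<Prod>j\<in>UNIV. \<alpha> j)"
          using n(3) by (intro prod_mono_strict[of l0]) (auto simp: hits_def intro: less_imp_le le_less_trans[OF dnint_nonneg])
        also have "\<dots> = v i" using fam n(2) unfolding box_family_def by blast
        also have "\<dots> \<le> \<psi> n" using block_le(2)[OF n(1)] by (simp add: v_def q_def)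
        finally show "i \<in> {i. \<exists>n\<in>block (2 ^ i). (\<Prod>j\<in>UNIV. dnint (real n * x $ j - y $ j)) < \<psi> n}"
          using n(1) by blast
      qed
    qed
    then show ?case using elim(1) by (simp add: W_mult_def)
  qed
  show W: "W_mult \<psi> y \<in> sets \<mu>" using W_mult_borel \<mu>(2) by simp
  show "emeasure \<mu> (W_mult \<psi> y) = 1"
    using prob_space.emeasure_eq_1_AE[OF \<mu>(1) W AE_W] .
qed

theorem theorem1p9:
  fixes \<mu> :: "(real ^ 'n::finite) measure"
  assumes "borel_prob_on_cube \<mu>"
    and "l1_dim \<mu> > real CARD('n) - (real CARD('n) - 1) / (real CARD('n) + 1)"
  shows "inhom_div_Khinchin \<mu> \<and> inhom_div_Gallagher \<mu>"
proof -
  have \<mu>: "prob_space \<mu>" "sets \<mu> = sets borel" "emeasure \<mu> unit_cube = 1"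
    using assms(1) by (auto simp: borel_prob_on_cube_def)
  interpret prob_space \<mu> by (rule \<mu>)
  obtain \<sigma> C where \<sigma>: "0 \<le> \<sigma>" "\<sigma> < real CARD('n) - (real CARD('n) - (real CARD('n) - 1) / (real CARD('n) + 1))"
    and C: "0 \<le> C" and fourier': "\<forall>Q::nat. 1 \<le> Q \<longrightarrow>
      (\<Sum>\<zeta>\<in>freq_box Q. norm (fourier_coeff \<mu> (\<chi> l. \<zeta> l))) \<le> C * real Q powr \<sigma>"
    by (rule l1_dim_exponent[OF \<mu>(1) assms(2)])
  have fourier: "(\<Sum>\<zeta>\<in>freq_box Q. norm (fourier_coeff \<mu> (\<chi> l. \<zeta> l))) \<le> C * real Q powr \<sigma>"
    if "1 \<le> Q" for Q :: nat
    using fourier' that by blast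
  have \<sigma>': "\<sigma> < (real CARD('n) - 1) / (real CARD('n) + 1)" using \<sigma>(2) by simp
  \<comment> \<open>For k = 1 the range 0 \<le> \<sigma> < 0 is empty: no measure has dimension
    above 1 there.\<close>
  have "CARD('n) \<noteq> 1" using \<sigma>(1) \<sigma>' by auto
  then have k2: "2 \<le> CARD('n)" using zero_less_card_finite[where 'a = 'n] by linarith
  have "(real CARD('n) - 1) / (real CARD('n) + 1) < 1" by simp
  then have \<sigma>1: "\<sigma> < 1" using \<sigma>' by linarith
  \<comment> \<open>A set outside the \<sigma>-algebra would have \<open>emeasure\<close> 0, not
    1.\<close>
  have "unit_cube \<in> sets \<mu>"
    using \<mu>(3) emeasure_notin_sets[of unit_cube \<mu>] by force
  then have "AE x in \<mu>. x \<in> unit_cube"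
    using \<mu>(3) by (intro AE_prob_1) (simp add: measure_def)
  moreover have "AE x in \<mu>. \<forall>l. x $ l \<noteq> 1"
    unfolding AE_all_countable using AE_coordinate_neq_1[OF \<mu>(1,2) \<sigma>1 fourier] by blast
  ultimately have cube: "AE x in \<mu>. x \<in> unit_cube_ho"
    by eventually_elim (auto simp: unit_cube_def unit_cube_ho_def order_le_less)
  obtain \<epsilon> where \<epsilon>: "0 < \<epsilon>" "\<epsilon> \<le> 1 / (6 * real CARD('n) ^ 2)" and hit: "box_hitting \<mu> \<epsilon>"
    by (rule box_hitting_exists[OF \<mu>(1,2) k2 \<sigma>(1) \<sigma>' C fourier])
  show ?thesis
    using box_hitting_imp_Khinchin[OF \<mu>(1,2) k2 cube \<epsilon> hit]
      box_hitting_imp_Gallagher[OF \<mu>(1,2) k2 cube \<epsilon> hit] by blast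
qed

end
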